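(* Let $\mathbb{K}$ be a field of characteristic $0$, let $S=\mathbb{K}[x_1,\dots,x_l]$ with the standard grading, let $I$ be a homogeneous ideal of $S$ and let $1\le k\le l$. Then the following two conditions are equivalent: (1) $S/I$ has the $k$-SLP (respectively the $k$-WLP); (2) $(S/\operatorname{rgin}(I),x_l,x_{l-1},\dots,x_{l-k+1})$ has the $k$-SLP (respectively the $k$-WLP).
   Context: A linear map is full-rank if it is injective or surjective. A graded ring $R=\bigoplus_{i\ge0}R_i$ over $\mathbb{K}$ with $\dim_{\mathbb{K}}R_i<\infty$ (not necessarily Artinian) has the WLP (resp. SLP) with Lefschetz element $\ell\in R_1$ if $\times\ell\colon R_i\to R_{i+1}$ is full-rank for all $i\ge0$ (resp. $\times\ell^s\colon R_i\to R_{i+s}$ is full-rank for all $i\ge 0$, $s\ge1$). For $k\ge1$, $(R,\ell_1,\dots,\ell_k)$ with $\ell_i\in R_1$ has the $k$-SLP (resp. $k$-WLP) if $R$ has the SLP (resp. WLP) with Lefschetz element $\ell_1$ and, for all $i=2,\dots,k$, $R/\langle\ell_1,\dots,\ell_{i-1}\rangle$ has the SLP (resp. WLP) with Lefschetz element (the class of) $\ell_i$. $R$ has the $k$-SLP (resp. $k$-WLP) if such $\ell_1,\dots,\ell_k\in R_1$ exist. $\operatorname{rgin}(I)$ is the generic initial ideal of $I$ with respect to the degree reverse lexicographic order DegRevLex with $x_1>x_2>\dots>x_l$: by Galligo's theorem there is a nonempty Zariski open set $U\subseteq \mathrm{GL}(l)$ such that the leading term ideal $\mathrm{LT}_{\mathrm{DegRevLex}}(g(I))$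 is the same monomial ideal for all $g\in U$, and this ideal is $\operatorname{rgin}(I)$. *)

theory Defs
  imports
    "HOL-Library.Poly_Mapping"
    "HOL-Algebra.QuotRing"
    "Jordan_Normal_Form.Matrix"
begin

text \<open>
  A graded ring is given by a ring \<open>R\<close> together with its family \<open>A\<close> of homogeneous
  components: \<open>A i\<close> is the subset \<open>R\<^sub>i\<close> of the carrier.
\<close>

definition full_rank_on :: "('a \<Rightarrow> 'b) \<Rightarrow> 'a set \<Rightarrow> 'b set \<Rightarrow> bool" where
  "full_rank_on f V W \<longleftrightarrow> inj_on f V \<or> f ` V = W"

definition has_SLP_with :: "('a, 'm) ring_scheme \<Rightarrow> (nat \<Rightarrow> 'a set) \<Rightarrow> 'a \<Rightarrow> bool" where
  "has_SLP_with R A a \<longleftrightarrow> a \<in> A 1 \<and>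
     (\<forall>i s. 1 \<le> s \<longrightarrow> full_rank_on (\<lambda>x. (a [^]\<^bsub>R\<^esub> s) \<otimes>\<^bsub>R\<^esub> x) (A i) (A (i + s)))"

definition has_WLP_with :: "('a, 'm) ring_scheme \<Rightarrow> (nat \<Rightarrow> 'a set) \<Rightarrow> 'a \<Rightarrow> bool" where
  "has_WLP_with R A a \<longleftrightarrow> a \<in> A 1 \<and>
     (\<forall>i. full_rank_on (\<lambda>x. a \<otimes>\<^bsub>R\<^esub> x) (A i) (A (i + 1)))"

definition quot_grading ::
    "('a, 'm) ring_scheme \<Rightarrow> 'a set \<Rightarrow> (nat \<Rightarrow> 'a set) \<Rightarrow> nat \<Rightarrow> 'a set set" where
  "quot_grading R I A i = (\<lambda>x. I +>\<^bsub>R\<^esub> x) ` A i"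

text \<open>
  In the following two definitions the list \<open>as\<close> is \<open>[\<ell>\<^sub>1, \<dots>, \<ell>\<^sub>k]\<close>. List positions are
  counted from 0, so \<open>as ! i\<close> is \<open>\<ell>\<close> with index \<open>i + 1\<close>, to be considered modulo
  the ideal generated by its predecessors \<open>take i as\<close>.
\<close>

definition has_kSLP_with ::
    "nat \<Rightarrow> ('a, 'm) ring_scheme \<Rightarrow> (nat \<Rightarrow> 'a set) \<Rightarrow> 'a list \<Rightarrow> bool" where
  "has_kSLP_with k R A as \<longleftrightarrow> 1 \<le> k \<and> length as = k \<and> set as \<subseteq> A 1 \<and>
     has_SLP_with R A (as ! 0) \<and>
     (\<forall>i\<in>{1..<k}. let J = Idl\<^bsub>R\<^esub> (set (take i as)) in
        has_SLP_with (R Quot J) (quot_grading R J A) (J +>\<^bsub>R\<^esub> (as ! i)))"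

definition has_kWLP_with ::
    "nat \<Rightarrow> ('a, 'm) ring_scheme \<Rightarrow> (nat \<Rightarrow> 'a set) \<Rightarrow> 'a list \<Rightarrow> bool" where
  "has_kWLP_with k R A as \<longleftrightarrow> 1 \<le> k \<and> length as = k \<and> set as \<subseteq> A 1 \<and>
     has_WLP_with R A (as ! 0) \<and>
     (\<forall>i\<in>{1..<k}. let J = Idl\<^bsub>R\<^esub> (set (take i as)) in
        has_WLP_with (R Quot J) (quot_grading R J A) (J +>\<^bsub>R\<^esub> (as ! i)))"

definition has_kSLP :: "nat \<Rightarrow> ('a, 'm) ring_scheme \<Rightarrow> (nat \<Rightarrow> 'a set) \<Rightarrow> bool" where
  "has_kSLP k R A \<longleftrightarrow> (\<exists>as. has_kSLP_with k R A as)"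

definition has_kWLP :: "nat \<Rightarrow> ('a, 'm) ring_scheme \<Rightarrow> (nat \<Rightarrow> 'a set) \<Rightarrow> bool" where
  "has_kWLP k R A \<longleftrightarrow> (\<exists>as. has_kWLP_with k R A as)"

text \<open>
  A monomial is its exponent vector, and a polynomial maps monomials to coefficients;
  multiplication of \<open>poly_mapping\<close>s is then convolution, that is, polynomial multiplication.
\<close>

type_synonym 'x monomial = "'x \<Rightarrow>\<^sub>0 nat"

type_synonym ('x, 'a) mpoly = "'x monomial \<Rightarrow>\<^sub>0 'a"

definition var :: "'x \<Rightarrow> ('x, 'a::comm_ring_1) mpoly" where
  "var i = Poly_Mapping.single (Poly_Mapping.single i 1) 1"

definition const :: "'a \<Rightarrow> ('x, 'a::comm_ring_1) mpoly" where
  "const c = Poly_Mapping.single 0 c"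

definition mdeg :: "'x monomial \<Rightarrow> nat" where
  "mdeg m = (\<Sum>i\<in>Poly_Mapping.keys m. Poly_Mapping.lookup m i)"

definition polys_in :: "'x set \<Rightarrow> ('x, 'a::comm_ring_1) mpoly set" where
  "polys_in V = {p. \<forall>m\<in>Poly_Mapping.keys p. Poly_Mapping.keys m \<subseteq> V}"

text \<open>
  The value of \<open>p\<close> at the point \<open>a\<close> of a commutative ring, where \<open>h\<close> maps the coefficients
  into that ring.
\<close>

definition eval_poly ::
    "('a \<Rightarrow> 'b) \<Rightarrow> ('x \<Rightarrow> 'b) \<Rightarrow> ('x, 'a::comm_ring_1) mpoly \<Rightarrow> 'b::comm_ring_1" where
  "eval_poly h a p =
     (\<Sum>m\<in>Poly_Mapping.keys p. h (Poly_Mapping.lookup p m) *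
        (\<Prod>i\<in>Poly_Mapping.keys m. a i ^ Poly_Mapping.lookup m i))"

text \<open>
  The ring \<open>S = K[x\<^sub>1, \<dots>, x\<^sub>l]\<close> and its standard grading. Variables are numbered from 0, as
  are the rows and columns of matrices: \<open>var i\<close> with \<open>i < l\<close> is \<open>x\<close> with index \<open>i + 1\<close>.
\<close>

definition S_ring :: "nat \<Rightarrow> (nat, 'a::field) mpoly ring" where
  "S_ring l = \<lparr>carrier = polys_in {..<l}, monoid.mult = (*), one = 1,
                ring.zero = 0, add = (+)\<rparr>"

definition S_deg :: "nat \<Rightarrow> nat \<Rightarrow> (nat, 'a::field) mpoly set" where
  "S_deg l d = {p \<in> polys_in {..<l}. \<forall>m\<in>Poly_Mapping.keys p. mdeg m = d}"

definition homogeneous_ideal :: "nat \<Rightarrow> (nat, 'a::field) mpoly set \<Rightarrow> bool" where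
  "homogeneous_ideal l I \<longleftrightarrow> ideal I (S_ring l) \<and>
     (\<exists>G \<subseteq> (\<Union>d. S_deg l d). I = Idl\<^bsub>S_ring l\<^esub> G)"

text \<open>
  The degree reverse lexicographic order with \<open>x\<^sub>1 > x\<^sub>2 > \<dots> > x\<^sub>l\<close>: among monomials of equal
  degree, the smaller one has the larger exponent at the last position where they differ.
\<close>

definition degrevlex_less :: "nat monomial \<Rightarrow> nat monomial \<Rightarrow> bool" where
  "degrevlex_less m n \<longleftrightarrow> mdeg m < mdeg n \<or>
     (mdeg m = mdeg n \<and>
      (\<exists>j. Poly_Mapping.lookup n j < Poly_Mapping.lookup m j \<and>
           (\<forall>i>j. Poly_Mapping.lookup m i = Poly_Mapping.lookup n i)))"

definition lead_monomial :: "(nat, 'a::field) mpoly \<Rightarrow> nat monomial" where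
  "lead_monomial p = (THE m. m \<in> Poly_Mapping.keys p \<and>
     (\<forall>n\<in>Poly_Mapping.keys p. n \<noteq> m \<longrightarrow> degrevlex_less n m))"

definition lead_term :: "(nat, 'a::field) mpoly \<Rightarrow> (nat, 'a) mpoly" where
  "lead_term p =
     Poly_Mapping.single (lead_monomial p) (Poly_Mapping.lookup p (lead_monomial p))"

definition LT_ideal :: "nat \<Rightarrow> (nat, 'a::field) mpoly set \<Rightarrow> (nat, 'a) mpoly set" where
  "LT_ideal l I = Idl\<^bsub>S_ring l\<^esub> (lead_term ` (I - {0}))"

definition GL :: "nat \<Rightarrow> 'a::field mat set" where
  "GL l = {g \<in> carrier_mat l l. invertible_mat g}"

text \<open>
  \<open>g\<close> acts on \<open>S\<close> by the \<open>K\<close>-algebra automorphism sending each variable to the linear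
  form whose coefficients are the corresponding column of \<open>g\<close>.
\<close>

definition GL_act :: "nat \<Rightarrow> 'a::field mat \<Rightarrow> (nat, 'a) mpoly \<Rightarrow> (nat, 'a) mpoly" where
  "GL_act l g = eval_poly const (\<lambda>j. \<Sum>i<l. const (g $$ (i, j)) * var i)"

text \<open>
  Zariski open subsets of \<open>GL l\<close>: complements of the common zeros of a set of polynomials
  in the matrix entries.
\<close>

definition zariski_open_GL :: "nat \<Rightarrow> 'a::field mat set \<Rightarrow> bool" where
  "zariski_open_GL l U \<longleftrightarrow>
     (\<exists>F \<subseteq> polys_in ({..<l} \<times> {..<l}).
        U = {g \<in> GL l. \<exists>p\<in>F. eval_poly id (\<lambda>ij. g $$ ij) p \<noteq> 0})"

text \<open>
  For homogeneous \<open>I\<close> over an infinite field, Galligo's theorem gives the existence of the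
  ideal \<open>J\<close> below; it is unique since any two nonempty Zariski open sets intersect.
\<close>

definition rgin :: "nat \<Rightarrow> (nat, 'a::field) mpoly set \<Rightarrow> (nat, 'a) mpoly set" where
  "rgin l I = (THE J. \<exists>U. zariski_open_GL l U \<and> U \<noteq> {} \<and>
     (\<forall>g\<in>U. LT_ideal l (GL_act l g ` I) = J))"

end

theory Submission
  imports Defs "Jordan_Normal_Form.Determinant"
begin

text \<open>
  By rank--nullity, multiplication by \<open>\<ell>\<^sup>s\<close> from degree \<open>d\<close> to degree \<open>d + s\<close> on \<open>S/K\<close> is of full rank
  iff the Hilbert function of \<open>S/(K + \<ell>\<^sup>s)\<close> in degree \<open>d + s\<close> takes its least possible value
  \<open>max 0 (H (d + s) - H d)\<close>, where \<open>H\<close> is the Hilbert function of \<open>S/K\<close>. If the \<open>\<ell>\<close>s are the last variables,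
  then these Hilbert functions count the monomials in the first variables that are not leading monomials
  of \<open>I\<close>, since the reverse lexicographic leading monomials are compatible with adding
  \<open>(x\<^sub>l, \<dots>, x\<^sub>p\<^sub>+\<^sub>1, x\<^sub>p\<^sup>s)\<close>. Hence the Lefschetz properties of \<open>g I\<close> with respect to the last variables
  depend only on the leading monomials of \<open>g I\<close>, which for generic \<open>g\<close> are those of \<open>rgin l I\<close>; this gives
  (2) \<open>\<Longrightarrow>\<close> (1). For the converse, \<open>\<ell>\<^sub>1, \<dots>, \<ell>\<^sub>k\<close> can be replaced by linearly independent forms (where
  \<open>\<ell>\<^sub>i\<close> vanishes modulo its predecessors, so does every linear form) and then be moved to the last
  variables. The generic leading monomials maximise the number of leading monomials in every up-set of
  monomials of a given degree, so the counts for \<open>rgin l I\<close> are at most those for \<open>g I\<close>; by induction on the number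
  of variables cut off, they attain the same lower bounds. No uncountability of the field is needed, because each
  of the infinitely many rank conditions is compared with \<open>rgin l I\<close> separately.
\<close>

text \<open>One nonempty open set controls finitely many degrees, whereas the generic initial ideal
  has to be right in all of them. Its monomials \<open>L\<close> are therefore collected degree by
  degree from matrices \<open>g0 d\<close> that may differ, and Dickson's lemma bounds the degrees
  in which \<open>L\<close> is generated. Genericity in those degrees makes \<open>L\<close> a lower
  bound for the leading monomials in every degree; maximality of \<open>L\<close> in the full degree
  gives equality. The maximality refers to all of \<open>GL l\<close>, since the coordinates
  produced from given Lefschetz elements need not be generic. In the comparison of counts, exponent
  1, present for both properties, has a second task: besides being a rank condition, it computes the
  Hilbert function after one more variable is cut off, from which the bounds of the next stage are
  formed.\<close>

abbreviation keys :: "('x \<Rightarrow>\<^sub>0 'b::zero) \<Rightarrow> 'x set" where "keys \<equiv> Poly_Mapping.keys"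
abbreviation lookup :: "('x \<Rightarrow>\<^sub>0 'b::zero) \<Rightarrow> 'x \<Rightarrow> 'b" where "lookup \<equiv> Poly_Mapping.lookup"
abbreviation single :: "'x \<Rightarrow> 'b \<Rightarrow> 'x \<Rightarrow>\<^sub>0 'b::zero" where "single \<equiv> Poly_Mapping.single"

section \<open>Polynomials, monomials and homogeneous components\<close>

lemma sum_single_lookup:
  fixes p :: "'x \<Rightarrow>\<^sub>0 'b::comm_monoid_add"
  assumes "finite A" and "keys p \<subseteq> A"
  shows "p = (\<Sum>m\<in>A. single m (lookup p m))"
proof (rule poly_mapping_eqI)
  fix k
  have "lookup (\<Sum>m\<in>A. single m (lookup p m)) k = (\<Sum>m\<in>A. lookup p m when m = k)"
    by (simp add: lookup_sum lookup_single)
  also have "\<dots> = (\<Sum>m\<in>A. if m = k then lookup p k else 0)"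
    by (rule sum.cong) (auto simp: when_def)
  also have "\<dots> = lookup p k"
    using assms by (auto simp: in_keys_iff)
  finally show "lookup p k = lookup (\<Sum>m\<in>A. single m (lookup p m)) k" ..
qed

lemma mult_single_lookup:
  fixes p :: "('x, 'a::comm_ring_1) mpoly"
  shows "single n c * p = (\<Sum>m\<in>keys p. single (n + m) (c * lookup p m))"
  by (subst sum_single_lookup[of "keys p" p]) (simp_all add: sum_distrib_left mult_single)

lemma lookup_single_mult_add:
  fixes p :: "('x, 'a::comm_ring_1) mpoly"
  shows "lookup (single n c * p) (n + m) = c * lookup p m"
proof -
  have "lookup (single n c * p) (n + m) = (\<Sum>k\<in>keys p. if k = m then c * lookup p m else 0)"
    unfolding mult_single_lookup lookup_sum
    by (rule sum.cong) (auto simp: lookup_single when_def)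
  also have "\<dots> = c * lookup p m"
    by (auto simp: in_keys_iff)
  finally show ?thesis .
qed

lemma keys_single_mult_subset:
  fixes p :: "('x, 'a::comm_ring_1) mpoly"
  shows "keys (single n c * p) \<subseteq> (+) n ` keys p"
  using keys_mult[of "single n c" p] by (auto split: if_splits)

lemma const_mult_lookup [simp]:
  fixes p :: "('x, 'a::comm_ring_1) mpoly"
  shows "lookup (const c * p) m = c * lookup p m"
  using lookup_single_mult_add[of 0 c p m] by (simp add: const_def)

lemma const_0 [simp]: "const 0 = 0" and const_1 [simp]: "const 1 = 1"
  and const_add: "const (a + b) = const a + const b"
  and const_mult: "const (a * b) = const a * const b"
  and const_uminus: "const (- a) = - const a"
  by (auto simp: const_def single_add mult_single single_uminus)

lemma const_sum: "const (sum f A) = (\<Sum>x\<in>A. const (f x))"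
  by (induction A rule: infinite_finite_induct) (auto simp: const_add)

lemma keys_const_mult: "keys (const c * p) \<subseteq> keys p"
  by (auto simp: in_keys_iff)

lemma mdeg_add [simp]: "mdeg (m + n) = mdeg m + mdeg n"
proof -
  have *: "mdeg m = (\<Sum>i\<in>A. lookup m i)" if "finite A" "keys m \<subseteq> A" for A and m :: "'a monomial"
    unfolding mdeg_def by (rule sum.mono_neutral_left) (use that in \<open>auto simp: in_keys_iff\<close>)
  let ?A = "keys m \<union> keys n"
  have "mdeg (m + n) = (\<Sum>i\<in>?A. lookup (m + n) i)" by (rule *) (auto simp: keys_add)
  also have "\<dots> = mdeg m + mdeg n"
    by (simp add: lookup_add sum.distrib *[of ?A])
  finally show ?thesis .
qed

lemma mdeg_0 [simp]: "mdeg 0 = 0" by (simp add: mdeg_def)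

lemma mdeg_single [simp]: "mdeg (single i a) = a"
  by (cases "a = 0") (auto simp: mdeg_def)

lemma keys_add_monomial [simp]: "keys ((m :: 'x monomial) + n) = keys m \<union> keys n"
  by (auto simp: in_keys_iff lookup_add)

lemma mdeg_eq_0_iff: "mdeg m = 0 \<longleftrightarrow> m = 0"
proof
  assume "mdeg m = 0"
  then have "\<forall>i\<in>keys m. lookup m i = 0" by (simp add: mdeg_def)
  then show "m = 0" by (auto intro!: poly_mapping_eqI simp: in_keys_iff)
qed simp

text \<open>Used for homogeneous components (\<open>hcomp\<close>) and, in
  \<open>full_rank_mod_var_iff\<close>, for splitting a polynomial according to the variables that
  occur in its terms.\<close>

definition restr :: "'m set \<Rightarrow> ('m \<Rightarrow>\<^sub>0 'b) \<Rightarrow> ('m \<Rightarrow>\<^sub>0 'b::comm_monoid_add)" where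
  "restr T p = (\<Sum>m\<in>keys p \<inter> T. single m (lookup p m))"

lemma lookup_restr: "lookup (restr T p) m = (if m \<in> T then lookup p m else 0)"
proof -
  have "lookup (restr T p) m = (\<Sum>k\<in>keys p \<inter> T. if k = m then lookup p m else 0)"
    unfolding restr_def lookup_sum by (rule sum.cong) (auto simp: lookup_single when_def)
  then show ?thesis by (auto simp: in_keys_iff)
qed

lemma keys_restr [simp]: "keys (restr T p) = keys p \<inter> T"
  by (auto simp: in_keys_iff lookup_restr split: if_splits)

lemma restr_add: "restr T (p + q) = restr T p + restr T q"
  by (rule poly_mapping_eqI) (auto simp: lookup_restr lookup_add)

lemma restr_0 [simp]: "restr T 0 = 0"
  by (rule poly_mapping_eqI) (auto simp: lookup_restr)

lemma restr_sum: "restr T (sum f A) = (\<Sum>x\<in>A. restr T (f x))"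
  by (induction A rule: infinite_finite_induct) (auto simp: restr_add)

lemma restr_eq_self: "keys p \<subseteq> T \<Longrightarrow> restr T p = p"
  by (rule poly_mapping_eqI) (auto simp: lookup_restr in_keys_iff)

lemma restr_plus_restr_compl: 
  fixes p :: "'m \<Rightarrow>\<^sub>0 'b::comm_monoid_add"
  shows "restr T p + restr (- T) p = p"
  by (rule poly_mapping_eqI) (auto simp: lookup_restr lookup_add)

abbreviation hcomp :: "nat \<Rightarrow> ('x, 'a::comm_ring_1) mpoly \<Rightarrow> ('x, 'a) mpoly" where
  "hcomp d \<equiv> restr {m. mdeg m = d}"

lemma hcomp_single_mult:
  fixes p :: "('x, 'a::comm_ring_1) mpoly"
  shows "hcomp d (single n c * p) = (if mdeg n \<le> d then single n c * hcomp (d - mdeg n) p else 0)"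
proof -
  have *: "hcomp d (single (n + m) b) = (if mdeg m + mdeg n = d then single (n + m) b else 0)" for m and b :: 'a
    by (rule poly_mapping_eqI) (auto simp: lookup_restr lookup_single when_def)
  show ?thesis
  proof (cases "mdeg n \<le> d")
    case True
    have "hcomp d (single n c * p) = (\<Sum>m\<in>keys p. if mdeg m = d - mdeg n then single (n + m) (c * lookup p m) else 0)"
      unfolding mult_single_lookup restr_sum * by (rule sum.cong) (use True in auto)
    also have "\<dots> = single n c * hcomp (d - mdeg n) p"
      by (simp add: restr_def sum_distrib_left mult_single sum.If_cases Collect_conj_eq)
    finally show ?thesis using True by simp
  next
    case False
    then show ?thesis unfolding mult_single_lookup restr_sum * by simp
  qed
qed

section \<open>Closure properties of polynomial rings and graded pieces\<close>

lemma polys_in_0 [simp]: "0 \<in> polys_in V"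
  and polys_in_1 [simp]: "1 \<in> polys_in V"
  and polys_in_const [simp]: "const c \<in> polys_in V"
  by (auto simp: polys_in_def const_def split: if_splits)

lemma polys_in_var: "i \<in> V \<Longrightarrow> var i \<in> polys_in V"
  by (auto simp: polys_in_def var_def)

lemma polys_in_single: "keys m \<subseteq> V \<Longrightarrow> single m c \<in> polys_in V"
  by (auto simp: polys_in_def)

lemma polys_in_add: "p \<in> polys_in V \<Longrightarrow> q \<in> polys_in V \<Longrightarrow> p + q \<in> polys_in V"
  using keys_add[of p q] by (auto simp: polys_in_def)

lemma polys_in_uminus: "p \<in> polys_in V \<Longrightarrow> - p \<in> polys_in V"
  by (auto simp: polys_in_def in_keys_iff)

lemma polys_in_diff: "p \<in> polys_in V \<Longrightarrow> q \<in> polys_in V \<Longrightarrow> p - q \<in> polys_in V"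
  using polys_in_add[OF _ polys_in_uminus, of p V q] by simp

lemma polys_in_mult: "p \<in> polys_in V \<Longrightarrow> q \<in> polys_in V \<Longrightarrow> p * q \<in> polys_in V"
  using keys_mult[of p q] by (force simp: polys_in_def)

lemma polys_in_sum: "(\<And>x. x \<in> A \<Longrightarrow> f x \<in> polys_in V) \<Longrightarrow> sum f A \<in> polys_in V"
  by (induction A rule: infinite_finite_induct) (auto simp: polys_in_add)

lemma polys_in_prod: "(\<And>x. x \<in> A \<Longrightarrow> f x \<in> polys_in V) \<Longrightarrow> prod f A \<in> polys_in V"
  by (induction A rule: infinite_finite_induct) (auto simp: polys_in_mult)

lemma polys_in_power: "p \<in> polys_in V \<Longrightarrow> p ^ n \<in> polys_in V"
  by (induction n) (auto simp: polys_in_mult)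

lemma polys_in_restr: "p \<in> polys_in V \<Longrightarrow> restr T p \<in> polys_in V"
  by (auto simp: polys_in_def)

lemma S_degD: "p \<in> S_deg l d \<Longrightarrow> p \<in> polys_in {..<l}"
  and S_deg_0 [simp]: "0 \<in> S_deg l d"
  by (auto simp: S_deg_def)

lemma S_deg_add: "p \<in> S_deg l d \<Longrightarrow> q \<in> S_deg l d \<Longrightarrow> p + q \<in> S_deg l d"
  using keys_add[of p q] by (auto simp: S_deg_def polys_in_add)

lemma S_deg_uminus: "p \<in> S_deg l d \<Longrightarrow> - p \<in> S_deg l d"
  by (auto simp: S_deg_def polys_in_uminus in_keys_iff)

lemma S_deg_diff: "p \<in> S_deg l d \<Longrightarrow> q \<in> S_deg l d \<Longrightarrow> p - q \<in> S_deg l d"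
  using S_deg_add[OF _ S_deg_uminus, of p l d q] by simp

lemma S_deg_mult: "p \<in> S_deg l d \<Longrightarrow> q \<in> S_deg l e \<Longrightarrow> p * q \<in> S_deg l (d + e)"
  using keys_mult[of p q] by (fastforce simp: S_deg_def polys_in_mult)

lemma S_deg_const_mult: "p \<in> S_deg l d \<Longrightarrow> const c * p \<in> S_deg l d"
  using keys_const_mult[of c p] by (auto simp: S_deg_def polys_in_mult)

lemma S_deg_1 [simp]: "1 \<in> S_deg l 0"
  by (auto simp: S_deg_def)

lemma S_deg_power: "p \<in> S_deg l d \<Longrightarrow> p ^ s \<in> S_deg l (s * d)"
  by (induction s) (auto dest: S_deg_mult)

lemma S_deg_var: "i < l \<Longrightarrow> var i \<in> S_deg l 1"
  by (auto simp: S_deg_def polys_in_var) (auto simp: var_def)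

lemma S_deg_sum: "(\<And>x. x \<in> A \<Longrightarrow> f x \<in> S_deg l d) \<Longrightarrow> sum f A \<in> S_deg l d"
  by (induction A rule: infinite_finite_induct) (auto simp: S_deg_add)

lemma hcomp_S_deg: "p \<in> polys_in {..<l} \<Longrightarrow> hcomp d p \<in> S_deg l d"
  by (auto simp: S_deg_def polys_in_restr)

lemma hcomp_of_S_deg: "p \<in> S_deg l d \<Longrightarrow> hcomp e p = (if e = d then p else 0)"
  by (auto intro!: restr_eq_self poly_mapping_eqI simp: S_deg_def lookup_restr in_keys_iff)

definition mons :: "nat \<Rightarrow> nat monomial set" where
  "mons l = {m. keys m \<subseteq> {..<l}}"

definition Mon :: "nat \<Rightarrow> nat \<Rightarrow> nat monomial set" where
  "Mon l d = {m. keys m \<subseteq> {..<l} \<and> mdeg m = d}"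

lemma S_deg_iff_keys: "p \<in> S_deg l d \<longleftrightarrow> keys p \<subseteq> Mon l d"
  by (auto simp: S_deg_def polys_in_def Mon_def)

lemma polys_in_iff_keys: "p \<in> polys_in {..<l} \<longleftrightarrow> keys p \<subseteq> mons l"
  by (auto simp: polys_in_def mons_def)

lemma finite_Mon: "finite (Mon l d)"
proof -
  have "lookup ` Mon l d \<subseteq> {f. \<forall>x. (x \<in> {..<l} \<longrightarrow> f x \<in> {..d}) \<and> (x \<notin> {..<l} \<longrightarrow> f x = 0)}"
  proof clarify
    fix m x assume m: "m \<in> Mon l d"
    have "lookup m x \<le> mdeg m" if "x \<in> keys m"
      unfolding mdeg_def by (rule member_le_sum) (use that in auto)
    then have "lookup m x \<le> d" using m by (cases "x \<in> keys m") (auto simp: Mon_def in_keys_iff)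
    then show "(x \<in> {..<l} \<longrightarrow> lookup m x \<in> {..d}) \<and> (x \<notin> {..<l} \<longrightarrow> lookup m x = 0)"
      using m by (auto simp: Mon_def in_keys_iff subset_iff)
  qed
  then have "finite (lookup ` Mon l d)"
    by (rule finite_subset) (intro finite_set_of_finite_funs, auto)
  then show ?thesis
    by (rule finite_imageD) (simp add: inj_on_def poly_mapping_eq_iff[symmetric])
qed

section \<open>The degree reverse lexicographic order\<close>

lemma degrevlex_irrefl: "\<not> degrevlex_less m m"
  by (auto simp: degrevlex_less_def)

lemma degrevlex_trans:
  assumes "degrevlex_less a b" and "degrevlex_less b c"
  shows "degrevlex_less a c"
proof -
  consider "mdeg a < mdeg c" | "mdeg a = mdeg b" "mdeg b = mdeg c"
    using assms by (auto simp: degrevlex_less_def)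
  then show ?thesis
  proof cases
    case 2
    obtain i where i: "lookup b i < lookup a i" "\<forall>k>i. lookup a k = lookup b k"
      using assms(1) 2 by (auto simp: degrevlex_less_def)
    obtain j where j: "lookup c j < lookup b j" "\<forall>k>j. lookup b k = lookup c k"
      using assms(2) 2 by (auto simp: degrevlex_less_def)
    have "lookup c (max i j) < lookup a (max i j) \<and> (\<forall>k>max i j. lookup a k = lookup c k)"
      using i j by (cases i j rule: linorder_cases) (auto simp: max_def)
    then show ?thesis using 2 by (auto simp: degrevlex_less_def)
  qed (auto simp: degrevlex_less_def)
qed

lemma degrevlex_total: "m \<noteq> n \<Longrightarrow> degrevlex_less m n \<or> degrevlex_less n m"
proof -
  assume "m \<noteq> n"
  let ?D = "{i. lookup m i \<noteq> lookup n i}"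
  have fin: "finite ?D"
    by (rule finite_subset[of _ "keys m \<union> keys n"]) (auto simp: in_keys_iff)
  have ne: "?D \<noteq> {}" using \<open>m \<noteq> n\<close> by (auto simp: poly_mapping_eq_iff fun_eq_iff)
  obtain j where j: "lookup m j \<noteq> lookup n j" "\<forall>i>j. lookup m i = lookup n i"
  proof
    show "lookup m (Max ?D) \<noteq> lookup n (Max ?D)" using Max_in[OF fin ne] by blast
    show "\<forall>i>Max ?D. lookup m i = lookup n i"
    proof (intro allI impI, rule ccontr)
      fix i assume "Max ?D < i" "lookup m i \<noteq> lookup n i"
      then show False using Max_ge[OF fin, of i] by simp
    qed
  qed
  show ?thesis
  proof (cases "mdeg m = mdeg n")
    case True
    have "lookup m j < lookup n j \<or> lookup n j < lookup m j" using j(1) by linarith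
    then show ?thesis
    proof
      assume "lookup m j < lookup n j"
      then have "degrevlex_less n m" unfolding degrevlex_less_def using True j(2) by metis
      then show ?thesis ..
    next
      assume "lookup n j < lookup m j"
      then have "degrevlex_less m n" unfolding degrevlex_less_def using True j(2) by metis
      then show ?thesis ..
    qed
  next
    case False
    then show ?thesis unfolding degrevlex_less_def by linarith
  qed
qed

lemma degrevlex_asym: "degrevlex_less m n \<Longrightarrow> \<not> degrevlex_less n m"
  using degrevlex_trans degrevlex_irrefl by blast

lemma degrevlex_add: "degrevlex_less m n \<Longrightarrow> degrevlex_less (a + m) (a + n)"
  by (auto simp: degrevlex_less_def lookup_add)

lemma finite_degrevlex_max:
  assumes "finite A" and "A \<noteq> {}"
  shows "\<exists>m\<in>A. \<forall>n\<in>A. n \<noteq> m \<longrightarrow> degrevlex_less n m"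
  using assms
proof (induction rule: finite_ne_induct)
  case (insert x F)
  then obtain m where m: "m \<in> F" "\<forall>n\<in>F. n \<noteq> m \<longrightarrow> degrevlex_less n m" by blast
  show ?case
  proof (cases "degrevlex_less x m")
    case True
    then show ?thesis using m by blast
  next
    case False
    have "x \<noteq> m" using m insert by auto
    then have mx: "degrevlex_less m x" using degrevlex_total[of m x] False by auto
    have "\<forall>n\<in>insert x F. n \<noteq> x \<longrightarrow> degrevlex_less n x"
    proof (intro ballI impI)
      fix n assume "n \<in> insert x F" "n \<noteq> x"
      then show "degrevlex_less n x" using m mx degrevlex_trans[of n m x] by (cases "n = m") auto
    qed
    then show ?thesis by blast
  qed
qed auto

lemma lead_monomial_eqI:
  assumes "m \<in> keys p" and "\<And>n. n \<in> keys p \<Longrightarrow> n \<noteq> m \<Longrightarrow> degrevlex_less n m"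
  shows "lead_monomial p = m"
  unfolding lead_monomial_def
proof (rule the_equality)
  show "m \<in> keys p \<and> (\<forall>n\<in>keys p. n \<noteq> m \<longrightarrow> degrevlex_less n m)" using assms by blast
  fix k assume k: "k \<in> keys p \<and> (\<forall>n\<in>keys p. n \<noteq> k \<longrightarrow> degrevlex_less n k)"
  show "k = m"
  proof (rule ccontr)
    assume "k \<noteq> m"
    then have "degrevlex_less k m" "degrevlex_less m k" using k assms by auto
    then show False using degrevlex_asym by simp
  qed
qed

lemma
  assumes "p \<noteq> 0"
  shows lead_monomial_in_keys: "lead_monomial p \<in> keys p"
    and lead_monomial_greatest: "n \<in> keys p \<Longrightarrow> n \<noteq> lead_monomial p \<Longrightarrow> degrevlex_less n (lead_monomial p)"
proof -
  obtain m where m: "m \<in> keys p" "\<forall>n\<in>keys p. n \<noteq> m \<longrightarrow> degrevlex_less n m"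
    using finite_degrevlex_max[of "keys p"] assms by auto
  then have "lead_monomial p = m" by (intro lead_monomial_eqI) auto
  then show "lead_monomial p \<in> keys p" "n \<in> keys p \<Longrightarrow> n \<noteq> lead_monomial p \<Longrightarrow> degrevlex_less n (lead_monomial p)"
    using m by auto
qed

lemma lead_monomial_single_mult:
  fixes p :: "(nat, 'a::field) mpoly"
  assumes "p \<noteq> 0" and "c \<noteq> 0"
  shows "single n c * p \<noteq> 0" and "lead_monomial (single n c * p) = n + lead_monomial p"
proof -
  have "lookup (single n c * p) (n + lead_monomial p) \<noteq> 0"
    using assms lead_monomial_in_keys[OF assms(1)] by (simp add: lookup_single_mult_add in_keys_iff)
  then have k: "n + lead_monomial p \<in> keys (single n c * p)" by (simp add: in_keys_iff)
  then show "single n c * p \<noteq> 0" by auto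
  show "lead_monomial (single n c * p) = n + lead_monomial p"
  proof (rule lead_monomial_eqI[OF k])
    fix k assume "k \<in> keys (single n c * p)" "k \<noteq> n + lead_monomial p"
    then obtain m where "k = n + m" "m \<in> keys p" "m \<noteq> lead_monomial p"
      using keys_single_mult_subset[of n c p] by auto
    then show "degrevlex_less k (n + lead_monomial p)"
      using lead_monomial_greatest[OF assms(1)] degrevlex_add by blast
  qed
qed

section \<open>Evaluation and linear changes of coordinates\<close>

text \<open>The inner product of \<open>eval_poly\<close>, named because it is multiplicative in
  \<open>m\<close>.\<close>

definition mon_value :: "('x \<Rightarrow> 'b) \<Rightarrow> 'x monomial \<Rightarrow> 'b::comm_ring_1" where
  "mon_value a m = (\<Prod>i\<in>keys m. a i ^ lookup m i)"

lemma mon_value_add: "mon_value a (m + n) = mon_value a m * mon_value a n"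
proof -
  have *: "mon_value a m = (\<Prod>i\<in>A. a i ^ lookup m i)" if "finite A" "keys m \<subseteq> A" for A m
    unfolding mon_value_def by (rule prod.mono_neutral_left) (use that in \<open>auto simp: in_keys_iff\<close>)
  show ?thesis
    using *[of "keys m \<union> keys n"] by (simp add: lookup_add power_add prod.distrib)
qed

lemma eval_poly_mon_value: "eval_poly h a p = (\<Sum>m\<in>keys p. h (lookup p m) * mon_value a m)"
  by (simp add: eval_poly_def mon_value_def)

lemma mon_value_var: "mon_value var m = (single m 1 :: ('x, 'a::comm_ring_1) mpoly)"
proof -
  have pow: "var i ^ n = (single (single i n) 1 :: ('x, 'a) mpoly)" for i n
    by (induction n) (auto simp: var_def mult_single single_add[symmetric])
  have prod: "(\<Prod>i\<in>A. single (f i) 1) = (single (sum f A) 1 :: ('x, 'a) mpoly)" for f and A :: "'x set"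
    by (induction A rule: infinite_finite_induct) (auto simp: mult_single)
  have "(\<Sum>i\<in>keys m. single i (lookup m i)) = m"
    by (rule sum_single_lookup[symmetric]) auto
  then show ?thesis unfolding mon_value_def pow prod by simp
qed

lemma eval_poly_const_var: "eval_poly const var p = (p :: ('x, 'a::comm_ring_1) mpoly)"
proof -
  have "eval_poly const var p = (\<Sum>m\<in>keys p. single m (lookup p m))"
    unfolding eval_poly_mon_value mon_value_var by (simp add: const_def mult_single)
  then show ?thesis using sum_single_lookup[of "keys p" p] by simp
qed

lemma eval_poly_cong:
  assumes "p \<in> polys_in V" and "\<And>i. i \<in> V \<Longrightarrow> a i = b i"
  shows "eval_poly h a p = eval_poly h b p"
  unfolding eval_poly_mon_value
proof (rule sum.cong[OF refl])
  fix m assume "m \<in> keys p"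
  then have "a i = b i" if "i \<in> keys m" for i
    using assms that by (auto simp: polys_in_def)
  then have "mon_value a m = mon_value b m"
    unfolding mon_value_def by (intro prod.cong) simp_all
  then show "h (lookup p m) * mon_value a m = h (lookup p m) * mon_value b m"
    by simp
qed

context comm_ring_hom
begin

lemma eval_poly_superset:
  assumes "finite A" and "keys p \<subseteq> A"
  shows "eval_poly hom a p = (\<Sum>m\<in>A. hom (lookup p m) * mon_value a m)"
  unfolding eval_poly_mon_value
  by (rule sum.mono_neutral_left) (use assms in \<open>auto simp: in_keys_iff\<close>)

lemma eval_poly_single: "eval_poly hom a (single m c) = hom c * mon_value a m"
  using eval_poly_superset[of "{m}" "single m c" a] by auto

lemma eval_poly_0 [simp]: "eval_poly hom a 0 = 0"
  by (simp add: eval_poly_mon_value)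

lemma eval_poly_add: "eval_poly hom a (p + q) = eval_poly hom a p + eval_poly hom a q"
  using eval_poly_superset[of "keys p \<union> keys q"] keys_add[of p q]
  by (simp add: lookup_add hom_add distrib_right sum.distrib)

lemma eval_poly_sum: "eval_poly hom a (sum f A) = (\<Sum>x\<in>A. eval_poly hom a (f x))"
  by (induction A rule: infinite_finite_induct) (auto simp: eval_poly_add)

lemma eval_poly_mult: "eval_poly hom a (p * q) = eval_poly hom a p * eval_poly hom a q"
proof -
  have p: "p = (\<Sum>m\<in>keys p. single m (lookup p m))" and q: "q = (\<Sum>m\<in>keys q. single m (lookup q m))"
    by (rule sum_single_lookup; simp)+
  have "p * q = (\<Sum>m\<in>keys p. \<Sum>n\<in>keys q. single (m + n) (lookup p m * lookup q n))"
    by (subst p, subst q) (simp add: sum_product mult_single)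
  then have "eval_poly hom a (p * q) = (\<Sum>m\<in>keys p. \<Sum>n\<in>keys q.
      (hom (lookup p m) * mon_value a m) * (hom (lookup q n) * mon_value a n))"
    by (simp add: eval_poly_sum eval_poly_single hom_mult mon_value_add mult_ac)
  then show ?thesis by (simp add: eval_poly_mon_value sum_product)
qed

lemma comm_ring_hom_eval_poly: "comm_ring_hom (eval_poly hom a)"
  by unfold_locales
    (use eval_poly_single[of a 0 1] in \<open>auto simp: eval_poly_add eval_poly_mult mon_value_def\<close>)

lemma eval_poly_const: "eval_poly hom a (const c) = hom c"
  by (simp add: const_def eval_poly_single mon_value_def)

lemma eval_poly_var: "eval_poly hom a (var i) = a i"
  by (simp add: var_def eval_poly_single mon_value_def)

end

lemma comm_ring_hom_const: "comm_ring_hom (const :: 'a::comm_ring_1 \<Rightarrow> ('x, 'a) mpoly)"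
  by unfold_locales (auto simp: const_add const_mult)

lemma comm_ring_hom_id: "comm_ring_hom (id :: 'a::comm_ring_1 \<Rightarrow> 'a)"
  by unfold_locales auto

section \<open>The action of matrices on polynomials\<close>

interpretation GL_act: comm_ring_hom "GL_act l g"
  unfolding GL_act_def by (rule comm_ring_hom.comm_ring_hom_eval_poly[OF comm_ring_hom_const])

lemma GL_act_const [simp]: "GL_act l g (const c) = const c"
  unfolding GL_act_def by (rule comm_ring_hom.eval_poly_const[OF comm_ring_hom_const])

lemma GL_act_var: "GL_act l g (var j) = (\<Sum>i<l. const (g $$ (i, j)) * var i)"
  unfolding GL_act_def by (rule comm_ring_hom.eval_poly_var[OF comm_ring_hom_const])

lemma GL_act_diff: "GL_act l g (p - q) = GL_act l g p - GL_act l g q"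
  by (rule GL_act.hom_minus)

lemma GL_act_sum: "GL_act l g (sum f A) = (\<Sum>x\<in>A. GL_act l g (f x))"
  by (rule GL_act.hom_sum)

lemma eval_poly_hom:
  assumes "comm_ring_hom h" and "\<And>c. h (const c) = const c"
  shows "h (eval_poly const a p) = eval_poly const (\<lambda>j. h (a j)) p"
proof -
  interpret h: comm_ring_hom h by fact
  show ?thesis unfolding eval_poly_mon_value mon_value_def
    by (simp add: h.hom_sum h.hom_mult h.hom_prod h.hom_power assms(2))
qed

text \<open>Substituting the forms of \<open>g\<close> into those of \<open>h\<close> gives the
  product in the order \<open>g * h\<close>, because the coefficients of a form are a column. The
  condition on \<open>p\<close> confines the variables to indices below \<open>l\<close>, where
  matrix entries are specified.\<close>

lemma GL_act_mult:
  assumes "g \<in> carrier_mat l l" and "h \<in> carrier_mat l l" and "p \<in> polys_in {..<l}"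
  shows "GL_act l g (GL_act l h p) = GL_act l (g * h) p"
proof -
  have "GL_act l g (GL_act l h p) =
      eval_poly const (\<lambda>j. GL_act l g (\<Sum>i<l. const (h $$ (i, j)) * var i)) p"
    unfolding GL_act_def[of l h] by (rule eval_poly_hom[OF GL_act.comm_ring_hom_axioms]) simp
  also have "\<dots> = GL_act l (g * h) p"
    unfolding GL_act_def[of l "g * h"]
  proof (rule eval_poly_cong[OF assms(3)])
    fix j assume j: "j \<in> {..<l}"
    have "GL_act l g (\<Sum>i<l. const (h $$ (i, j)) * var i)
        = (\<Sum>i<l. \<Sum>m<l. const (h $$ (i, j) * g $$ (m, i)) * var m)"
      by (simp add: GL_act_sum GL_act.hom_mult GL_act_var sum_distrib_left const_mult mult.assoc)
    also have "\<dots> = (\<Sum>m<l. \<Sum>i<l. const (g $$ (m, i) * h $$ (i, j)) * var m)"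
      by (subst sum.swap) (simp add: mult.commute)
    also have "\<dots> = (\<Sum>m<l. const ((g * h) $$ (m, j)) * var m)"
    proof (rule sum.cong[OF refl])
      fix m assume "m \<in> {..<l}"
      then have "(g * h) $$ (m, j) = (\<Sum>i<l. g $$ (m, i) * h $$ (i, j))"
        using assms j by (simp add: scalar_prod_def atLeast0LessThan)
      then show "(\<Sum>i<l. const (g $$ (m, i) * h $$ (i, j)) * var m) = const ((g * h) $$ (m, j)) * var m"
        by (simp add: const_sum sum_distrib_right)
    qed
    finally show "GL_act l g (\<Sum>i<l. const (h $$ (i, j)) * var i) = (\<Sum>m<l. const ((g * h) $$ (m, j)) * var m)" .
  qed
  finally show ?thesis .
qed

lemma GL_act_one: "p \<in> polys_in {..<l} \<Longrightarrow> GL_act l (1\<^sub>m l) p = p"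
proof -
  assume p: "p \<in> polys_in {..<l}"
  have "GL_act l (1\<^sub>m l) p = eval_poly const var p"
    unfolding GL_act_def
  proof (rule eval_poly_cong[OF p])
    fix j assume "j \<in> {..<l}"
    then have "(\<Sum>i<l. const (1\<^sub>m l $$ (i, j)) * var i) = (\<Sum>i<l. if i = j then var i else (0 :: (nat, 'a) mpoly))"
      by (intro sum.cong) auto
    then show "(\<Sum>i<l. const (1\<^sub>m l $$ (i, j)) * var i) = (var j :: (nat, 'a) mpoly)"
      using \<open>j \<in> {..<l}\<close> by simp
  qed
  then show ?thesis by (simp add: eval_poly_const_var)
qed

lemma GL_act_S_deg:
  assumes "p \<in> S_deg l d"
  shows "GL_act l g p \<in> S_deg l d"
proof -
  have lin: "(\<Sum>i<l. const (g $$ (i, j)) * var i) \<in> S_deg l 1" for j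
    by (intro S_deg_sum S_deg_const_mult S_deg_var) auto
  have mon: "(\<Prod>j\<in>A. (\<Sum>i<l. const (g $$ (i, j)) * var i) ^ lookup m j) \<in> S_deg l (sum (lookup m) A)" for m A
    by (induction A rule: infinite_finite_induct) (use S_deg_power[OF lin] in \<open>auto intro!: S_deg_mult\<close>)
  show ?thesis
    unfolding GL_act_def eval_poly_def
  proof (intro S_deg_sum S_deg_const_mult)
    fix m assume "m \<in> keys p"
    then have "sum (lookup m) (keys m) = d" using assms by (auto simp: S_deg_def mdeg_def)
    then show "(\<Prod>j\<in>keys m. (\<Sum>i<l. const (g $$ (i, j)) * var i) ^ lookup m j) \<in> S_deg l d"
      using mon[of m "keys m"] by simp
  qed
qed

lemma GL_act_polys_in:
  assumes "p \<in> polys_in {..<l}"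
  shows "GL_act l g p \<in> polys_in {..<l}"
  unfolding GL_act_def eval_poly_def
  by (intro polys_in_sum polys_in_mult polys_in_prod polys_in_power polys_in_const polys_in_var) auto

section \<open>The general linear group\<close>

lemma GL_carrier: "g \<in> GL l \<Longrightarrow> g \<in> carrier_mat l l"
  by (simp add: GL_def)

lemma GL_I:
  assumes "g \<in> carrier_mat l l" and "h \<in> carrier_mat l l" and "g * h = 1\<^sub>m l"
  shows "g \<in> GL l"
  using assms mat_mult_left_right_inverse[OF assms]
  by (auto simp: GL_def invertible_mat_def inverts_mat_def)

lemma GL_inverse:
  assumes "g \<in> GL l"
  obtains h where "h \<in> GL l" and "g * h = 1\<^sub>m l" and "h * g = 1\<^sub>m l"
proof -
  have g: "g \<in> carrier_mat l l" by (rule GL_carrier[OF assms])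
  obtain h where h: "g * h = 1\<^sub>m l" "h * g = 1\<^sub>m (dim_row h)"
    using assms g by (auto simp: GL_def invertible_mat_def inverts_mat_def)
  have "dim_col h = l" using h(1) g by (metis index_mult_mat(3) index_one_mat(3))
  moreover have "dim_row h = l" using h(2) g
    by (metis carrier_matD(2) index_mult_mat(3) index_one_mat(3))
  ultimately have hc: "h \<in> carrier_mat l l" by auto
  then have "h * g = 1\<^sub>m l" using h by auto
  then show ?thesis using that[of h] GL_I[OF hc g] h by auto
qed

lemma GL_mult: "g \<in> GL l \<Longrightarrow> h \<in> GL l \<Longrightarrow> g * h \<in> GL l"
proof -
  assume gh: "g \<in> GL l" "h \<in> GL l"
  obtain g' h' where "g' \<in> GL l" "g * g' = 1\<^sub>m l" "h' \<in> GL l" "h * h' = 1\<^sub>m l"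
    using GL_inverse[OF gh(1)] GL_inverse[OF gh(2)] by metis
  moreover from this have "(g * h) * (h' * g') = g * (h * h') * g'"
    using gh by (intro trans[OF assoc_mult_mat[of g l l h l "h' * g'" l]])
      (auto dest!: GL_carrier simp: assoc_mult_mat[symmetric, of _ l l _ l _ l])
  ultimately show ?thesis using gh
    by (intro GL_I[of "g * h" l "h' * g'"]) (auto dest!: GL_carrier)
qed

lemma GL_one: "1\<^sub>m l \<in> GL l"
  by (rule GL_I[of _ _ "1\<^sub>m l"]) auto

lemma GL_act_inverse:
  assumes "g \<in> GL l" and "h \<in> GL l" and "g * h = 1\<^sub>m l" and "p \<in> polys_in {..<l}"
  shows "GL_act l g (GL_act l h p) = p"
  using assms by (simp add: GL_act_mult GL_carrier GL_act_one)

lemma GL_det_iff: "g \<in> carrier_mat l l \<Longrightarrow> g \<in> GL l \<longleftrightarrow> det (g :: 'a::field mat) \<noteq> 0"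
proof
  assume g: "g \<in> carrier_mat l l" "g \<in> GL l"
  then obtain h where h: "h \<in> GL l" "g * h = 1\<^sub>m l" using GL_inverse by metis
  then have "det g * det h = 1" using g by (metis GL_carrier det_mult det_one)
  then show "det g \<noteq> 0" by auto
next
  assume g: "g \<in> carrier_mat l l" "det g \<noteq> 0"
  from det_non_zero_imp_unit[OF g]
  obtain h where "h \<in> carrier_mat l l" "g * h = 1\<^sub>m l"
    by (auto simp: Units_def ring_mat_def)
  then show "g \<in> GL l" using GL_I g by blast
qed

section \<open>Ideals of the polynomial ring\<close>

interpretation S: cring "S_ring l :: (nat, 'a::field) mpoly ring" for l
proof (rule cringI)
  show "abelian_group (S_ring l :: (nat, 'a) mpoly ring)"
  proof (rule abelian_groupI)
    fix x :: "(nat, 'a) mpoly" assume "x \<in> carrier (S_ring l)"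
    then show "\<exists>y\<in>carrier (S_ring l). y \<oplus>\<^bsub>S_ring l\<^esub> x = \<zero>\<^bsub>S_ring l\<^esub>"
      by (intro bexI[of _ "- x"]) (auto simp: S_ring_def polys_in_uminus)
  qed (auto simp: S_ring_def polys_in_add add_ac)
  show "Group.comm_monoid (S_ring l :: (nat, 'a) mpoly ring)"
    by (rule comm_monoidI) (auto simp: S_ring_def polys_in_mult mult_ac)
qed (auto simp: S_ring_def distrib_right)

lemma S_ring_simps [simp]:
  "carrier (S_ring l) = polys_in {..<l}" "x \<otimes>\<^bsub>S_ring l\<^esub> y = x * y" "x \<oplus>\<^bsub>S_ring l\<^esub> y = x + y"
  "\<one>\<^bsub>S_ring l\<^esub> = 1" "\<zero>\<^bsub>S_ring l\<^esub> = 0"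
  by (auto simp: S_ring_def)

lemma S_ring_a_inv: "x \<in> polys_in {..<l} \<Longrightarrow> \<ominus>\<^bsub>S_ring l\<^esub> x = - x"
  by (rule S.minus_equality) (auto simp: polys_in_uminus)

lemma S_ring_minus [simp]: "y \<in> polys_in {..<l} \<Longrightarrow> x \<ominus>\<^bsub>S_ring l\<^esub> y = x - y"
  by (simp add: a_minus_def S_ring_a_inv)

lemma S_ring_pow [simp]: "x [^]\<^bsub>S_ring l\<^esub> (n::nat) = x ^ n"
  by (induction n) auto

lemma ideal_S_ring_iff:
  "ideal I (S_ring l) \<longleftrightarrow> I \<subseteq> polys_in {..<l} \<and> 0 \<in> I \<and> (\<forall>p\<in>I. \<forall>q\<in>I. p + q \<in> I) \<and>
     (\<forall>r\<in>polys_in {..<l}. \<forall>p\<in>I. r * p \<in> I)"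
  (is "_ \<longleftrightarrow> ?R")
proof
  assume "ideal I (S_ring l)"
  then interpret ideal I "S_ring l" .
  show ?R using a_subset zero_closed a_closed I_l_closed by auto
next
  assume R: ?R
  show "ideal I (S_ring l)"
  proof (rule idealI)
    show "ring (S_ring l)" by (rule S.ring_axioms)
    show "subgroup I (add_monoid (S_ring l))"
    proof (rule group.subgroupI[OF S.a_group])
      fix a assume "a \<in> I"
      then have "const (-1) * a \<in> I" "a \<in> polys_in {..<l}" using R by auto
      then have "\<ominus>\<^bsub>S_ring l\<^esub> a \<in> I" by (simp add: S_ring_a_inv const_uminus)
      then show "inv\<^bsub>add_monoid (S_ring l)\<^esub> a \<in> I" unfolding a_inv_def .
    qed (use R in auto)
    show "x \<otimes>\<^bsub>S_ring l\<^esub> a \<in> I" "a \<otimes>\<^bsub>S_ring l\<^esub> x \<in> I" if "a \<in> I" "x \<in> carrier (S_ring l)" for a x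
      using R that by (auto simp: mult.commute)
  qed
qed

lemma
  assumes "ideal I (S_ring l)"
  shows ideal_polys_in: "p \<in> I \<Longrightarrow> p \<in> polys_in {..<l}"
    and ideal_0: "0 \<in> I"
    and ideal_add: "p \<in> I \<Longrightarrow> q \<in> I \<Longrightarrow> p + q \<in> I"
    and ideal_mult: "r \<in> polys_in {..<l} \<Longrightarrow> p \<in> I \<Longrightarrow> r * p \<in> I"
    and ideal_diff: "p \<in> I \<Longrightarrow> q \<in> I \<Longrightarrow> p - q \<in> I"
    and ideal_sum: "(\<And>x. x \<in> A \<Longrightarrow> f x \<in> I) \<Longrightarrow> sum f A \<in> I"
proof -
  note R = assms[unfolded ideal_S_ring_iff]
  show "p \<in> I \<Longrightarrow> p \<in> polys_in {..<l}" "0 \<in> I" "p \<in> I \<Longrightarrow> q \<in> I \<Longrightarrow> p + q \<in> I"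
    "r \<in> polys_in {..<l} \<Longrightarrow> p \<in> I \<Longrightarrow> r * p \<in> I" using R by blast+
  have u: "- p \<in> I" if "p \<in> I" for p
    using R that polys_in_const[of "-1" "{..<l}"] by (metis const_1 const_uminus mult_minus1)
  show "p \<in> I \<Longrightarrow> q \<in> I \<Longrightarrow> p - q \<in> I" using R u[of q] by (metis diff_conv_add_uminus)
  show "(\<And>x. x \<in> A \<Longrightarrow> f x \<in> I) \<Longrightarrow> sum f A \<in> I"
    by (induction A rule: infinite_finite_induct) (use R in auto)
qed

text \<open>The elements of \<open>I\<close> all of whose components lie in \<open>I\<close> form an
  ideal containing the homogeneous generators, hence all of \<open>I\<close>. Closure under
  multiplication is checked term by term, since a single term just shifts the components.\<close>

lemma homogeneous_ideal_hcomp: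
  assumes "homogeneous_ideal l I" and "f \<in> I"
  shows "hcomp d f \<in> I"
proof -
  obtain G where I: "ideal I (S_ring l)" and G: "G \<subseteq> (\<Union>d. S_deg l d)" "I = Idl\<^bsub>S_ring l\<^esub> G"
    using assms(1) by (auto simp: homogeneous_ideal_def)
  have Gc: "G \<subseteq> carrier (S_ring l)" using G by (auto dest: S_degD)
  let ?H = "{f \<in> I. \<forall>d. hcomp d f \<in> I}"
  have single: "hcomp d (single n c * f) \<in> I" if "f \<in> ?H" "keys n \<subseteq> {..<l}" for f d n c
    using that ideal_mult[OF I] ideal_0[OF I] polys_in_single[of n "{..<l}" c] by (auto simp: hcomp_single_mult)
  have "ideal ?H (S_ring l)"
    unfolding ideal_S_ring_iff
  proof (intro conjI ballI)
    fix r f :: "(nat, 'a) mpoly" assume r: "r \<in> polys_in {..<l}" and f: "f \<in> ?H"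
    have "hcomp d (r * f) \<in> I" for d
    proof -
      have "r * f = (\<Sum>m\<in>keys r. single m (lookup r m) * f)"
        by (subst sum_single_lookup[of "keys r" r]) (auto simp: sum_distrib_right)
      then have "hcomp d (r * f) = (\<Sum>m\<in>keys r. hcomp d (single m (lookup r m) * f))"
        by (simp add: restr_sum)
      also have "\<dots> \<in> I" by (intro ideal_sum[OF I] single[OF f]) (use r in \<open>auto simp: polys_in_def\<close>)
      finally show ?thesis .
    qed
    then show "r * f \<in> ?H" using ideal_mult[OF I r] f by auto
  qed (use ideal_polys_in[OF I] ideal_add[OF I] ideal_0[OF I] in \<open>auto simp: restr_add\<close>)
  moreover have "G \<subseteq> ?H"
  proof
    fix g assume g: "g \<in> G"
    then obtain e where "g \<in> S_deg l e" using G by auto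
    moreover have "g \<in> I" using g S.genideal_self[OF Gc] G by auto
    ultimately show "g \<in> ?H" using ideal_0[OF I] by (auto simp: hcomp_of_S_deg)
  qed
  ultimately have "Idl\<^bsub>S_ring l\<^esub> G \<subseteq> ?H" by (rule S.genideal_minimal)
  then show ?thesis using assms G by auto
qed

section \<open>Lefschetz properties in terms of ideals of the polynomial ring\<close>

text \<open>Injectivity or surjectivity of multiplication by \<open>f ^ s\<close> from degree
  \<open>d\<close> of \<open>S/K\<close>, with all classes replaced by homogeneous representatives
  in \<open>S\<close>. This avoids quotient rings in the rest of the argument.\<close>

definition full_rank_mod :: "nat \<Rightarrow> (nat, 'a::field) mpoly set \<Rightarrow> (nat, 'a) mpoly \<Rightarrow> nat \<Rightarrow> nat \<Rightarrow> bool" where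
  "full_rank_mod l K f s d \<longleftrightarrow> (\<forall>x\<in>S_deg l d. f ^ s * x \<in> K \<longrightarrow> x \<in> K) \<or>
     (\<forall>y\<in>S_deg l (d + s). \<exists>x\<in>S_deg l d. y - f ^ s * x \<in> K)"

text \<open>An arbitrary homomorphism with kernel \<open>K\<close> is allowed so that the lemma
  serves both the quotient by \<open>I\<close> and the iterated quotient by a further ideal.\<close>

lemma full_rank_on_hom_iff:
  fixes l :: nat and h :: "(nat, 'a::field) mpoly \<Rightarrow> 'b"
  assumes hom: "ring_hom_ring (S_ring l) Q h"
    and ker: "\<And>x y. x \<in> polys_in {..<l} \<Longrightarrow> y \<in> polys_in {..<l} \<Longrightarrow> h x = h y \<longleftrightarrow> x - y \<in> K"
    and f: "f \<in> S_deg l 1"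
  shows "full_rank_on (\<lambda>z. (h f [^]\<^bsub>Q\<^esub> s) \<otimes>\<^bsub>Q\<^esub> z) (h ` S_deg l d) (h ` S_deg l (d + s)) \<longleftrightarrow> full_rank_mod l K f s d"
proof -
  interpret h: ring_hom_ring "S_ring l" Q h by fact
  have fc: "f \<in> polys_in {..<l}" using S_degD[OF f] .
  have fs: "f ^ s * x \<in> S_deg l (d + s)" if "x \<in> S_deg l d" for x
    using S_deg_mult[OF S_deg_power[OF f, of s] that] by (simp add: add.commute)
  have pow: "h f [^]\<^bsub>Q\<^esub> s = h (f ^ s)"
    using h.hom_nat_pow[of f s] fc by simp
  have mult: "(h f [^]\<^bsub>Q\<^esub> s) \<otimes>\<^bsub>Q\<^esub> h x = h (f ^ s * x)" if "x \<in> polys_in {..<l}" for x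
    unfolding pow using h.hom_mult[of "f ^ s" x] that fc by (simp add: polys_in_power)
  have "inj_on (\<lambda>z. (h f [^]\<^bsub>Q\<^esub> s) \<otimes>\<^bsub>Q\<^esub> z) (h ` S_deg l d) \<longleftrightarrow> (\<forall>x\<in>S_deg l d. f ^ s * x \<in> K \<longrightarrow> x \<in> K)"
    (is "?A \<longleftrightarrow> ?B")
  proof
    assume A: ?A
    show ?B
    proof (intro ballI impI)
      fix x assume x: "x \<in> S_deg l d" "f ^ s * x \<in> K"
      have "h (f ^ s * x) = h (f ^ s * 0)"
        using ker[of "f ^ s * x" "f ^ s * 0"] x S_degD[OF fs[OF x(1)]] by simp
      then have "h x = h 0"
        using A x mult[OF S_degD[OF x(1)]] mult[of 0] by (auto simp: inj_on_def)
      then show "x \<in> K" using ker[of x 0] S_degD[OF x(1)] by simp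
    qed
  next
    assume B: ?B
    show ?A
    proof (rule inj_onI, clarify)
      fix x y assume x: "x \<in> S_deg l d" and y: "y \<in> S_deg l d"
        and "h f [^]\<^bsub>Q\<^esub> s \<otimes>\<^bsub>Q\<^esub> h x = h f [^]\<^bsub>Q\<^esub> s \<otimes>\<^bsub>Q\<^esub> h y"
      then have "h (f ^ s * x) = h (f ^ s * y)" using mult S_degD by metis
      then have "f ^ s * (x - y) \<in> K"
        using ker fs[OF x] fs[OF y] by (auto dest!: S_degD simp: right_diff_distrib)
      then have "x - y \<in> K" using B S_deg_diff[OF x y] by blast
      then show "h x = h y" using ker x y S_degD by blast
    qed
  qed
  moreover have "(\<lambda>z. (h f [^]\<^bsub>Q\<^esub> s) \<otimes>\<^bsub>Q\<^esub> z) ` (h ` S_deg l d) = h ` S_deg l (d + s) \<longleftrightarrow>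
      (\<forall>y\<in>S_deg l (d + s). \<exists>x\<in>S_deg l d. y - f ^ s * x \<in> K)" (is "?A \<longleftrightarrow> ?B")
  proof -
    have "(\<lambda>z. (h f [^]\<^bsub>Q\<^esub> s) \<otimes>\<^bsub>Q\<^esub> z) ` (h ` S_deg l d) = (\<lambda>x. h (f ^ s * x)) ` S_deg l d"
      unfolding image_image by (rule image_cong[OF refl]) (use mult S_degD in blast)
    also have "\<dots> = h ` S_deg l (d + s) \<longleftrightarrow> (\<forall>y\<in>S_deg l (d + s). \<exists>x\<in>S_deg l d. h y = h (f ^ s * x))"
      using fs by (auto simp: image_def) 
    also have "\<dots> \<longleftrightarrow> ?B"
      using ker fs S_degD by (intro ball_cong bex_cong refl) blast
    finally show ?thesis .
  qed
  ultimately show ?thesis by (simp add: full_rank_on_def full_rank_mod_def)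
qed

text \<open>The correspondence of ideals of \<open>S/I\<close> with ideals containing
  \<open>I\<close>: the image of \<open>?K\<close> is an ideal containing the given cosets, and the
  preimage of \<open>?J\<close> is an ideal containing \<open>I\<close> and
  \<open>G\<close>.\<close>

lemma coset_mem_quotient_genideal_iff:
  assumes I: "ideal I (S_ring l)" and G: "G \<subseteq> polys_in {..<l}" and x: "x \<in> polys_in {..<l}"
  shows "I +>\<^bsub>S_ring l\<^esub> x \<in> Idl\<^bsub>S_ring l Quot I\<^esub> ((\<lambda>g. I +>\<^bsub>S_ring l\<^esub> g) ` G) \<longleftrightarrow> x \<in> Idl\<^bsub>S_ring l\<^esub> (I \<union> G)"
    (is "_ \<in> ?J \<longleftrightarrow> _ \<in> ?K")
proof -
  let ?c = "\<lambda>g. I +>\<^bsub>S_ring l\<^esub> g"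
  interpret I: ideal I "S_ring l" by fact
  interpret Q: ring "S_ring l Quot I" by (rule I.quotient_is_ring)
  interpret h: ring_hom_ring "S_ring l" "S_ring l Quot I" ?c by (rule I.rcos_ring_hom_ring)
  have sub: "I \<union> G \<subseteq> carrier (S_ring l)" using G I.a_subset by auto
  have K: "ideal ?K (S_ring l)" and KI: "I \<union> G \<subseteq> ?K"
    using S.genideal_ideal[OF sub] S.genideal_self[OF sub] by auto
  have GQ: "?c ` G \<subseteq> carrier (S_ring l Quot I)" using G h.hom_closed by auto
  have J: "ideal ?J (S_ring l Quot I)" by (rule Q.genideal_ideal[OF GQ])
  show ?thesis
  proof
    assume xJ: "?c x \<in> ?J"
    have "?J \<subseteq> ?c ` ?K"
      using KI by (intro Q.genideal_minimal S.ring_ideal_imp_quot_ideal I K) auto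
    then obtain k where k: "k \<in> ?K" "?c x = ?c k" using xJ by auto
    then have kp: "k \<in> polys_in {..<l}" using ideal_polys_in[OF K] by blast
    have "x \<ominus>\<^bsub>S_ring l\<^esub> k \<in> I"
      using S.quotient_eq_iff_same_a_r_cos[OF I, of x k] x kp k by simp
    then have "(x - k) + k \<in> ?K" using kp KI k by (intro ideal_add[OF K]) auto
    then show "x \<in> ?K" by simp
  next
    assume "x \<in> ?K"
    moreover have "?K \<subseteq> {r \<in> carrier (S_ring l). ?c r \<in> ?J}"
    proof (rule S.genideal_minimal[OF h.ideal_vimage[OF J]], intro Un_least subsetI CollectI conjI)
      fix i assume i: "i \<in> I"
      then have "?c i = I" by (rule I.a_rcos_const)
      moreover have "I \<in> ?J" using additive_subgroup.zero_closed[OF ideal.axioms(1)[OF J]]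
        by (simp add: FactRing_def)
      ultimately show "?c i \<in> ?J" by simp
    qed (use sub Q.genideal_self[OF GQ] in auto)
    ultimately show "?c x \<in> ?J" by blast
  qed
qed

text \<open>The exponent set \<open>A\<close> is \<open>{1..}\<close> for the SLP and \<open>{1}\<close> for the WLP.\<close>

definition Lefschetz_mod :: "nat \<Rightarrow> nat set \<Rightarrow> (nat, 'a::field) mpoly set \<Rightarrow> (nat, 'a) mpoly list \<Rightarrow> bool" where
  "Lefschetz_mod l A I fs \<longleftrightarrow> (\<forall>i<length fs. \<forall>s\<in>A. \<forall>d. full_rank_mod l (Idl\<^bsub>S_ring l\<^esub> (I \<union> set (take i fs))) (fs ! i) s d)"

context
  fixes l :: nat and I :: "(nat, 'a::field) mpoly set"
  assumes I: "ideal I (S_ring l)"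
begin

text \<open>The shape \<open>I \<union> {}\<close> is the case \<open>i = 0\<close> of the ideals in
  \<open>Lefschetz_mod\<close>, where \<open>take 0 fs\<close> is empty.\<close>

lemma full_rank_on_quot_iff:
  assumes f: "f \<in> S_deg l 1"
  shows "full_rank_on (\<lambda>z. ((I +>\<^bsub>S_ring l\<^esub> f) [^]\<^bsub>S_ring l Quot I\<^esub> s) \<otimes>\<^bsub>S_ring l Quot I\<^esub> z)
      (quot_grading (S_ring l) I (S_deg l) d) (quot_grading (S_ring l) I (S_deg l) (d + s)) \<longleftrightarrow>
    full_rank_mod l (Idl\<^bsub>S_ring l\<^esub> (I \<union> {})) f s d"
  unfolding quot_grading_def
proof (rule full_rank_on_hom_iff[OF ideal.rcos_ring_hom_ring[OF I] _ f])
  have "Idl\<^bsub>S_ring l\<^esub> I = I"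
    using S.genideal_minimal[OF I order.refl] S.genideal_self[of I l] ideal_polys_in[OF I] by auto
  then show "(I +>\<^bsub>S_ring l\<^esub> x = I +>\<^bsub>S_ring l\<^esub> y) = (x - y \<in> Idl\<^bsub>S_ring l\<^esub> (I \<union> {}))"
    if "x \<in> polys_in {..<l}" "y \<in> polys_in {..<l}" for x y
    using S.quotient_eq_iff_same_a_r_cos[OF I, of x y] that by simp
qed

lemma full_rank_on_quot_quot_iff:
  assumes G: "G \<subseteq> S_deg l 1" and f: "f \<in> S_deg l 1"
  defines "Q \<equiv> S_ring l Quot I" and "J \<equiv> Idl\<^bsub>S_ring l Quot I\<^esub> ((\<lambda>g. I +>\<^bsub>S_ring l\<^esub> g) ` G)"
  shows "full_rank_on (\<lambda>z. ((J +>\<^bsub>Q\<^esub> (I +>\<^bsub>S_ring l\<^esub> f)) [^]\<^bsub>Q Quot J\<^esub> s) \<otimes>\<^bsub>Q Quot J\<^esub> z)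
      (quot_grading Q J (quot_grading (S_ring l) I (S_deg l)) d)
      (quot_grading Q J (quot_grading (S_ring l) I (S_deg l)) (d + s)) \<longleftrightarrow>
    full_rank_mod l (Idl\<^bsub>S_ring l\<^esub> (I \<union> G)) f s d"
proof -
  let ?c = "\<lambda>g. I +>\<^bsub>S_ring l\<^esub> g"
  have Gp: "G \<subseteq> polys_in {..<l}" using G S_degD by blast
  interpret I: ideal I "S_ring l" by (rule I)
  interpret Q: ring Q unfolding Q_def by (rule I.quotient_is_ring)
  interpret h: ring_hom_ring "S_ring l" Q ?c unfolding Q_def by (rule I.rcos_ring_hom_ring)
  have "?c ` G \<subseteq> carrier Q" using Gp h.hom_closed by auto
  then have J: "ideal J Q" unfolding J_def Q_def[symmetric] by (rule Q.genideal_ideal)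
  interpret J: ideal J Q by (rule J)
  interpret h': ring_hom_ring Q "Q Quot J" "\<lambda>z. J +>\<^bsub>Q\<^esub> z" by (rule J.rcos_ring_hom_ring)
  have hom: "ring_hom_ring (S_ring l) (Q Quot J) (\<lambda>x. J +>\<^bsub>Q\<^esub> (?c x))"
    using ring_hom_trans[OF h.homh h'.homh]
    by (intro ring_hom_ringI2) (auto simp: comp_def S.ring_axioms h'.S.ring_axioms)
  show ?thesis
    unfolding quot_grading_def image_image
  proof (rule full_rank_on_hom_iff[OF hom _ f])
    fix x y :: "(nat, 'a) mpoly" assume xy: "x \<in> polys_in {..<l}" "y \<in> polys_in {..<l}"
    have "?c x \<ominus>\<^bsub>Q\<^esub> ?c y = ?c (x - y)"
      using h.hom_add[of x "\<ominus>\<^bsub>S_ring l\<^esub> y"] h.hom_a_inv[of y] xy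
      by (simp add: a_minus_def S_ring_a_inv polys_in_uminus)
    then have "J +>\<^bsub>Q\<^esub> ?c x = J +>\<^bsub>Q\<^esub> ?c y \<longleftrightarrow> ?c (x - y) \<in> J"
      using Q.quotient_eq_iff_same_a_r_cos[OF J, of "?c x" "?c y"] xy h.hom_closed by simp
    also have "\<dots> \<longleftrightarrow> x - y \<in> Idl\<^bsub>S_ring l\<^esub> (I \<union> G)"
      unfolding J_def Q_def using coset_mem_quotient_genideal_iff[OF I Gp, of "x - y"] xy
      by (simp add: polys_in_diff)
    finally show "J +>\<^bsub>Q\<^esub> ?c x = J +>\<^bsub>Q\<^esub> ?c y \<longleftrightarrow> x - y \<in> Idl\<^bsub>S_ring l\<^esub> (I \<union> G)" .
  qed
qed

lemma
  assumes k: "1 \<le> k" "length fs = k" and fs: "set fs \<subseteq> S_deg l 1"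
  defines "Q \<equiv> S_ring l Quot I" and "A \<equiv> quot_grading (S_ring l) I (S_deg l)"
    and "as \<equiv> map (\<lambda>f. I +>\<^bsub>S_ring l\<^esub> f) fs"
  shows has_kSLP_with_quot_iff: "has_kSLP_with k Q A as \<longleftrightarrow> Lefschetz_mod l {1..} I fs"
    and has_kWLP_with_quot_iff: "has_kWLP_with k Q A as \<longleftrightarrow> Lefschetz_mod l {1} I fs"
proof -
  have as_A: "set as \<subseteq> A 1" using fs by (auto simp: as_def A_def quot_grading_def)
  have f: "fs ! i \<in> S_deg l 1" if "i < k" for i using fs k that by auto
  have tk: "set (take i as) = (\<lambda>g. I +>\<^bsub>S_ring l\<^esub> g) ` set (take i fs)" for i
    by (simp add: as_def take_map)
  have tkS: "set (take i fs) \<subseteq> S_deg l 1" for i using fs set_take_subset[of i fs] by auto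
  have nth: "as ! i = I +>\<^bsub>S_ring l\<^esub> (fs ! i)" if "i < k" for i using that k by (simp add: as_def)
  \<comment> \<open>The definitions treat the first element without a further quotient, while
    \<open>Lefschetz_mod\<close> is uniform in \<open>i\<close>.\<close>
  have split: "(\<forall>i<k. P i) \<longleftrightarrow> P 0 \<and> (\<forall>i\<in>{1..<k}. P i)" for P :: "nat \<Rightarrow> bool"
  proof -
    have "{..<k} = insert 0 {1..<k}" using k(1) by auto
    then have "(\<forall>i\<in>{..<k}. P i) \<longleftrightarrow> P 0 \<and> (\<forall>i\<in>{1..<k}. P i)" by (simp only: ball_simps)
    then show ?thesis by auto
  qed
  have nth_A: "as ! i \<in> A 1" if "i < k" for i using as_A that k by (metis as_def length_map nth_mem subsetD)
  then have as0: "as ! 0 \<in> A 1" using k by auto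
  have asJ: "J +>\<^bsub>Q\<^esub> as ! i \<in> quot_grading Q J A 1" if "i < k" for i J
    unfolding quot_grading_def[of Q] using nth_A[OF that] by (rule imageI)
  have z: "full_rank_on (\<lambda>z. (as ! 0 [^]\<^bsub>Q\<^esub> s) \<otimes>\<^bsub>Q\<^esub> z) (A d) (A (d + s)) \<longleftrightarrow>
      full_rank_mod l (Idl\<^bsub>S_ring l\<^esub> (I \<union> set (take 0 fs))) (fs ! 0) s d" for s d
    using full_rank_on_quot_iff[OF f[of 0], of s d] k nth[of 0] by (simp add: Q_def A_def)
  have n: "full_rank_on (\<lambda>z. ((J +>\<^bsub>Q\<^esub> as ! i) [^]\<^bsub>Q Quot J\<^esub> s) \<otimes>\<^bsub>Q Quot J\<^esub> z)
        (quot_grading Q J A d) (quot_grading Q J A (d + s)) \<longleftrightarrow>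
      full_rank_mod l (Idl\<^bsub>S_ring l\<^esub> (I \<union> set (take i fs))) (fs ! i) s d"
    if "i < k" "J = Idl\<^bsub>Q\<^esub> (set (take i as))" for i s d J
    using full_rank_on_quot_quot_iff[OF tkS f[OF that(1)], of i s d] nth[OF that(1)]
    unfolding that(2) tk by (simp add: Q_def A_def)
  show "has_kSLP_with k Q A as \<longleftrightarrow> Lefschetz_mod l {1..} I fs"
    unfolding has_kSLP_with_def Lefschetz_mod_def k(2) split has_SLP_with_def Let_def z
    using k as_A as0 asJ n by (auto simp: as_def)
  have ring: "ring Q" unfolding Q_def by (rule ideal.quotient_is_ring[OF I])
  \<comment> \<open>The WLP is defined without an exponent. The power with exponent 1 unfolds to the
    unit times \<open>x\<close>, so replacing it by \<open>x\<close> takes the unit law on the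
    carrier.\<close>
  have pow1: "x [^]\<^bsub>R\<^esub> (1::nat) = x" if "ring R" "x \<in> carrier R" for x and R :: "('b, 'c) ring_scheme"
    using that by (simp add: Group.monoid.nat_pow_Suc Group.monoid.nat_pow_0 ring.is_monoid)
  have AQ: "A 1 \<subseteq> carrier Q"
  proof -
    interpret ideal I "S_ring l" by (rule I)
    show ?thesis using rcos_ring_hom ring_hom_closed S_degD by (fastforce simp: A_def Q_def quot_grading_def)
  qed
  have idl: "ideal (Idl\<^bsub>Q\<^esub> (set (take i as))) Q" for i
    using as_A AQ set_take_subset[of i as] by (intro ring.genideal_ideal[OF ring]) auto
  have c0: "as ! 0 [^]\<^bsub>Q\<^esub> (1::nat) = as ! 0" using pow1[OF ring] as0 AQ by blast
  have ci: "(J +>\<^bsub>Q\<^esub> as ! i) [^]\<^bsub>Q Quot J\<^esub> (1::nat) = J +>\<^bsub>Q\<^esub> as ! i"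
    if "i < k" "J = Idl\<^bsub>Q\<^esub> (set (take i as))" for i J
  proof (rule pow1)
    interpret J: ideal J Q unfolding that(2) by (rule idl)
    show "ring (Q Quot J)" by (rule J.quotient_is_ring)
    have "as ! i \<in> carrier Q" using nth_A AQ that(1) by blast
    then show "J +>\<^bsub>Q\<^esub> as ! i \<in> carrier (Q Quot J)" using J.rcos_ring_hom by (rule ring_hom_closed[rotated])
  qed
  show "has_kWLP_with k Q A as \<longleftrightarrow> Lefschetz_mod l {1} I fs"
    unfolding has_kWLP_with_def Lefschetz_mod_def k(2) split has_WLP_with_def Let_def
    using k as_A as0 asJ n[of _ _ 1] ci z[of 1] c0 by (auto simp: as_def)
qed

lemma quot_grading_lift:
  assumes "set as \<subseteq> quot_grading (S_ring l) I (S_deg l) 1"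
  obtains fs where "as = map (\<lambda>f. I +>\<^bsub>S_ring l\<^esub> f) fs" and "set fs \<subseteq> S_deg l 1"
proof -
  have "\<exists>fs. as = map (\<lambda>f. I +>\<^bsub>S_ring l\<^esub> f) fs \<and> set fs \<subseteq> S_deg l 1"
    using assms
  proof (induction as)
    case (Cons a as)
    then obtain fs f where "as = map (\<lambda>f. I +>\<^bsub>S_ring l\<^esub> f) fs" "set fs \<subseteq> S_deg l 1"
      "a = I +>\<^bsub>S_ring l\<^esub> f" "f \<in> S_deg l 1" by (auto simp: quot_grading_def)
    then show ?case by (intro exI[of _ "f # fs"]) auto
  qed auto
  then show ?thesis using that by blast
qed

lemma
  assumes k: "1 \<le> k"
  defines "Q \<equiv> S_ring l Quot I" and "A \<equiv> quot_grading (S_ring l) I (S_deg l)"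
  shows has_kSLP_quot_iff: "has_kSLP k Q A \<longleftrightarrow> (\<exists>fs. length fs = k \<and> set fs \<subseteq> S_deg l 1 \<and> Lefschetz_mod l {1..} I fs)"
    and has_kWLP_quot_iff: "has_kWLP k Q A \<longleftrightarrow> (\<exists>fs. length fs = k \<and> set fs \<subseteq> S_deg l 1 \<and> Lefschetz_mod l {1} I fs)"
proof -
  have "\<exists>fs. length fs = k \<and> set fs \<subseteq> S_deg l 1 \<and> Lefschetz_mod l {1..} I fs" if H: "has_kSLP_with k Q A as" for as
  proof -
    have "set as \<subseteq> A 1" "length as = k" using H by (auto simp: has_kSLP_with_def)
    then obtain fs where fs: "as = map (\<lambda>f. I +>\<^bsub>S_ring l\<^esub> f) fs" "set fs \<subseteq> S_deg l 1" "length fs = k"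
      unfolding A_def by (metis length_map quot_grading_lift)
    then show ?thesis using has_kSLP_with_quot_iff[OF k fs(3,2)] H by (auto simp: Q_def A_def)
  qed
  then show "has_kSLP k Q A \<longleftrightarrow> (\<exists>fs. length fs = k \<and> set fs \<subseteq> S_deg l 1 \<and> Lefschetz_mod l {1..} I fs)"
    using has_kSLP_with_quot_iff[OF k] unfolding has_kSLP_def Q_def A_def by blast
  have "\<exists>fs. length fs = k \<and> set fs \<subseteq> S_deg l 1 \<and> Lefschetz_mod l {1} I fs" if H: "has_kWLP_with k Q A as" for as
  proof -
    have "set as \<subseteq> A 1" "length as = k" using H by (auto simp: has_kWLP_with_def)
    then obtain fs where fs: "as = map (\<lambda>f. I +>\<^bsub>S_ring l\<^esub> f) fs" "set fs \<subseteq> S_deg l 1" "length fs = k"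
      unfolding A_def by (metis length_map quot_grading_lift)
    then show ?thesis using has_kWLP_with_quot_iff[OF k fs(3,2)] H by (auto simp: Q_def A_def)
  qed
  then show "has_kWLP k Q A \<longleftrightarrow> (\<exists>fs. length fs = k \<and> set fs \<subseteq> S_deg l 1 \<and> Lefschetz_mod l {1} I fs)"
    using has_kWLP_with_quot_iff[OF k] unfolding has_kWLP_def Q_def A_def by blast
qed

end

section \<open>Dimension counts\<close>

context vector_space
begin

text \<open>The cardinality of an infinite basis is 0 by convention, so monotonicity of
  \<open>dim\<close> takes a finite spanning set; the space of all polynomials has none, but its
  graded pieces do.\<close>

lemma dim_mono_finite:
  assumes "finite W" and "V \<subseteq> span W" and "U \<subseteq> V"
  shows "dim U \<le> dim V"
proof -
  obtain B where B: "B \<subseteq> V" "independent B" "V \<subseteq> span B" "card B = dim V" by (rule basis_exists)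
  obtain C where C: "C \<subseteq> U" "independent C" "U \<subseteq> span C" "card C = dim U" by (rule basis_exists)
  have "finite B" using independent_span_bound[OF assms(1) B(2)] B(1) assms(2) by auto
  then show ?thesis using independent_span_bound[OF _ C(2), of B] C B assms(3) by auto
qed

lemma subspace_eq_if_dim_eq:
  assumes "finite W" and "V \<subseteq> span W" and "U \<subseteq> V" and "subspace U" and "dim V \<le> dim U"
  shows "U = V"
proof (rule ccontr)
  assume "U \<noteq> V"
  then obtain x where x: "x \<in> V" "x \<notin> U" using assms(3) by auto
  obtain C where C: "C \<subseteq> U" "independent C" "U \<subseteq> span C" "card C = dim U" by (rule basis_exists)
  have fC: "finite C" using independent_span_bound[OF assms(1) C(2)] C(1) assms(2,3) by auto
  have "x \<notin> span C" using x C(1) assms(4) span_minimal by blast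
  then have ind: "independent (insert x C)" using C(2) by (rule independent_insertI)
  have "card (insert x C) = dim (insert x C)"
    using dim_eq_card_independent[OF ind] by simp
  also have "\<dots> \<le> dim V"
    by (rule dim_mono_finite[OF assms(1,2)]) (use x C assms(3) in auto)
  finally show False using \<open>x \<notin> span C\<close> fC C(4) assms(5) span_base[of x C] by (auto simp: card_insert_if split: if_splits)
qed

text \<open>Rank-nullity for the map from \<open>A\<close> to the quotient by \<open>K\<close>
  induced by \<open>f\<close>, without forming that quotient. A basis \<open>BN\<close> of the
  kernel is extended to a basis \<open>BA\<close> of \<open>A\<close>; the images of the added
  vectors \<open>C\<close>, together with a basis of \<open>K\<close>, are a basis of the sum of
  \<open>f A\<close> and \<open>K\<close>.\<close>

lemma dim_image_plus_subspace:
  assumes f: "Vector_Spaces.linear scale scale f"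
    and A: "subspace A" "finite FA" "A \<subseteq> span FA"
    and K: "subspace K" "finite FK" "K \<subseteq> span FK"
  shows "dim {f x + k |x k. x \<in> A \<and> k \<in> K} + dim {x \<in> A. f x \<in> K} = dim A + dim K"
proof -
  interpret f: Vector_Spaces.linear scale scale f by fact
  let ?W = "{f x + k |x k. x \<in> A \<and> k \<in> K}" and ?N = "{x \<in> A. f x \<in> K}"
  have N: "subspace ?N"
    using A(1) K(1) by (auto simp: subspace_def f.add f.scale)
  obtain BN where BN: "BN \<subseteq> ?N" "independent BN" "?N \<subseteq> span BN" "card BN = dim ?N" by (rule basis_exists)
  obtain BK where BK: "BK \<subseteq> K" "independent BK" "K \<subseteq> span BK" "card BK = dim K" by (rule basis_exists)
  obtain BA where BA: "BN \<subseteq> BA" "BA \<subseteq> A" "independent BA" "A \<subseteq> span BA"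
    using maximal_independent_subset_extend[of BN A] BN by blast
  have cBA: "card BA = dim A" using basis_card_eq_dim BA by blast
  have fBA: "finite BA" using independent_span_bound[OF A(2) BA(3)] BA(2) A(3) by auto
  have fBK: "finite BK" using independent_span_bound[OF K(2) BK(2)] BK(1) K(3) by auto
  have spK: "span BK = K" using BK K(1) by (metis span_subspace)
  have spN: "span BN = ?N" using BN N by (metis span_subspace)
  have spA: "span BA = A" using BA A(1) by (metis span_subspace)
  define C where "C = BA - BN"
  have CA: "C \<subseteq> A" "C \<subseteq> BA" "C \<inter> BN = {}" "BA = C \<union> BN" using BA by (auto simp: C_def)
  have fC: "finite C" using fBA by (simp add: C_def)
  have "independent (f ` D \<union> BK) \<and> card (f ` D \<union> BK) = card D + card BK" if "D \<subseteq> C" for D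
    using finite_subset[OF that fC] that
  proof (induction D rule: finite_induct)
    case empty
    then show ?case using BK by simp
  next
    case (insert c D)
    \<comment> \<open>A relation \<open>f c = f u + k\<close> puts \<open>c - u\<close> into the
      kernel, hence \<open>c\<close> into the span of \<open>D \<union> BN\<close>, against the
      independence of \<open>BA\<close>.\<close>
    have "f c \<notin> span (f ` D \<union> BK)"
    proof
      assume "f c \<in> span (f ` D \<union> BK)"
      then obtain u k where u: "u \<in> span D" and k: "k \<in> K" and fc: "f c = f u + k"
        unfolding span_Un spK f.span_image by auto
      have "u \<in> A" using u insert.prems CA A(1) span_minimal[of D A] by auto
      moreover have "c \<in> A" using insert.prems CA by auto
      moreover have "f (c - u) \<in> K" using fc k by (simp add: f.diff)
      ultimately have "c - u \<in> span BN" unfolding spN using A(1) by (simp add: subspace_diff)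
      then have "u + (c - u) \<in> span (D \<union> BN)" using u unfolding span_Un by blast
      then have "c \<in> span (D \<union> BN)" by simp
      moreover have "D \<union> BN \<subseteq> BA - {c}" using insert.prems insert.hyps CA by auto
      ultimately have "c \<in> span (BA - {c})" using span_mono by blast
      moreover have "c \<in> BA" using insert.prems CA by auto
      ultimately show False using BA(3) dependent_def by blast
    qed
    then have nin: "f c \<notin> f ` D \<union> BK" and ind: "independent (insert (f c) (f ` D \<union> BK))"
      using span_base insert.IH insert.prems independent_insertI[of "f c" "f ` D \<union> BK"] by auto
    have "card (insert (f c) (f ` D \<union> BK)) = Suc (card (f ` D \<union> BK))"
      using nin fBK insert.hyps(1) by (intro card_insert_disjoint) auto
    also have "\<dots> = card (insert c D) + card BK"
      using insert.IH insert.prems insert.hyps by simp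
    finally show ?case using ind by simp
  qed
  from this[of C] have ind: "independent (f ` C \<union> BK)" and cd: "card (f ` C \<union> BK) = card C + card BK" by auto
  have "f ` C \<union> BK \<subseteq> ?W"
  proof (intro Un_least subsetI)
    fix y assume "y \<in> f ` C"
    then obtain c where "c \<in> C" "y = f c + 0" by auto
    then show "y \<in> ?W" using CA subspace_0[OF K(1)] by blast
  next
    fix y assume "y \<in> BK"
    then have "y = f 0 + y" "y \<in> K" using BK f.zero by auto
    then show "y \<in> ?W" using subspace_0[OF A(1)] by blast
  qed
  moreover have "?W \<subseteq> span (f ` C \<union> BK)"
  proof clarify
    fix x k assume x: "x \<in> A" and k: "k \<in> K"
    obtain u n where u: "u \<in> span C" and n: "n \<in> span BN" and xun: "x = u + n"
      using x unfolding spA[symmetric] CA(4) span_Un by auto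
    have "f n + k \<in> K" using n k unfolding spN by (auto intro: subspace_add[OF K(1)])
    then have "f u + (f n + k) \<in> span (f ` C \<union> BK)"
      using u unfolding span_Un spK f.span_image by blast
    then show "f x + k \<in> span (f ` C \<union> BK)" by (simp add: xun f.add add.assoc)
  qed
  ultimately have "card (f ` C \<union> BK) = dim ?W" by (rule basis_card_eq_dim[OF _ _ ind])
  moreover have "card (C \<union> BN) = card C + card BN"
    by (rule card_Un_disjoint[OF fC finite_subset[OF BA(1) fBA] CA(3)])
  ultimately show ?thesis using BN(4) BK(4) cBA cd CA(4) by simp
qed

end

section \<open>Leading monomials and dimensions of graded pieces\<close>

interpretation mp: vector_space "\<lambda>c (p :: (nat, 'a::field) mpoly). const c * p"
  by unfold_locales (auto simp: distrib_left distrib_right const_add const_mult mult.assoc)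

text \<open>0 is left out because it has no leading monomial. For an ideal these are the monomials
  of its initial ideal, see \<open>LT_ideal_eq_mon_span\<close>.\<close>

definition LMs :: "(nat, 'a::field) mpoly set \<Rightarrow> nat monomial set" where
  "LMs V = lead_monomial ` (V - {0})"

lemma LMsI: "p \<in> V \<Longrightarrow> p \<noteq> 0 \<Longrightarrow> lead_monomial p \<in> LMs V"
  by (auto simp: LMs_def)

lemma LMs_mono: "V \<subseteq> W \<Longrightarrow> LMs V \<subseteq> LMs W"
  by (auto simp: LMs_def)

lemma LMs_subset_Mon: "V \<subseteq> S_deg l d \<Longrightarrow> LMs V \<subseteq> Mon l d"
  using lead_monomial_in_keys by (fastforce simp: LMs_def S_deg_iff_keys)

lemma finite_LMs: "V \<subseteq> S_deg l d \<Longrightarrow> finite (LMs V)"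
  by (rule finite_subset[OF LMs_subset_Mon finite_Mon])

text \<open>The largest index \<open>m0\<close> with nonzero coefficient cannot cancel: every other
  contributing \<open>v m\<close> has a smaller leading monomial and hence no term at
  \<open>m0\<close>.\<close>

lemma
  fixes v :: "nat monomial \<Rightarrow> (nat, 'a::field) mpoly"
  assumes v: "\<And>m. m \<in> X \<Longrightarrow> v m \<noteq> 0 \<and> lead_monomial (v m) = m" and "finite X"
    and nz: "\<exists>m\<in>X. c m \<noteq> 0"
  defines "p \<equiv> \<Sum>m\<in>X. const (c m) * v m"
  shows sum_distinct_lead_monomials_nonzero: "p \<noteq> 0"
    and lead_monomial_sum_distinct: "lead_monomial p \<in> X"
proof -
  let ?X = "{m \<in> X. c m \<noteq> 0}"
  have "?X \<noteq> {}" using nz by blast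
  then obtain m0 where m0: "m0 \<in> ?X" "\<And>n. n \<in> ?X \<Longrightarrow> n \<noteq> m0 \<Longrightarrow> degrevlex_less n m0"
    using finite_degrevlex_max[of ?X] \<open>finite X\<close> by auto
  have le: "n = m \<or> degrevlex_less n m" if "m \<in> X" "n \<in> keys (v m)" for n m
    using lead_monomial_greatest[of "v m" n] v[OF that(1)] that by auto
  have lk: "lookup p n = (\<Sum>m\<in>X. c m * lookup (v m) n)" for n
    by (simp add: p_def lookup_sum)
  have "lookup p m0 = (\<Sum>m\<in>X. if m = m0 then c m0 * lookup (v m0) m0 else 0)"
    unfolding lk
  proof (rule sum.cong[OF refl])
    fix m assume m: "m \<in> X"
    show "c m * lookup (v m) m0 = (if m = m0 then c m0 * lookup (v m0) m0 else 0)"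
    proof (cases "m = m0 \<or> c m = 0")
      case False
      then have "degrevlex_less m m0" using m0(2) m by auto
      then have "m0 \<notin> keys (v m)" using le[OF m] False degrevlex_asym by blast
      then show ?thesis using False by (simp add: in_keys_iff)
    qed (use m0 in auto)
  qed
  also have "\<dots> = c m0 * lookup (v m0) m0" using m0 \<open>finite X\<close> by simp
  also have "\<dots> \<noteq> 0" using m0 v[of m0] lead_monomial_in_keys[of "v m0"] by (auto simp: in_keys_iff)
  finally have "m0 \<in> keys p" by (simp add: in_keys_iff)
  moreover have "degrevlex_less n m0" if n: "n \<in> keys p" "n \<noteq> m0" for n
  proof -
    have "\<exists>m\<in>X. c m * lookup (v m) n \<noteq> 0"
      using n(1) lk[of n] sum.neutral[of X "\<lambda>m. c m * lookup (v m) n"] by (auto simp: in_keys_iff)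
    then obtain m where m: "m \<in> ?X" "n \<in> keys (v m)" by (auto simp: in_keys_iff)
    then show ?thesis
      using le[of m n] m0(2)[of m] degrevlex_trans[of n m m0] n(2) by (cases "m = m0") auto
  qed
  ultimately have "lead_monomial p = m0" by (rule lead_monomial_eqI)
  then show "lead_monomial p \<in> X" using m0 by simp
  show "p \<noteq> 0" using \<open>m0 \<in> keys p\<close> by auto
qed

lemma lead_monomial_in_if_in_span:
  fixes v :: "nat monomial \<Rightarrow> (nat, 'a::field) mpoly"
  assumes v: "\<And>m. m \<in> X \<Longrightarrow> v m \<noteq> 0 \<and> lead_monomial (v m) = m" and "finite X"
    and p: "p \<in> mp.span (v ` X)" "p \<noteq> 0"
  shows "lead_monomial p \<in> X"
proof -
  have inj: "inj_on v X" using v by (intro inj_on_inverseI[of _ lead_monomial]) auto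
  obtain u where "p = (\<Sum>q\<in>v ` X. const (u q) * q)"
    using p(1) mp.span_finite[of "v ` X"] \<open>finite X\<close> by auto
  then have c: "p = (\<Sum>m\<in>X. const (u (v m)) * v m)" by (simp add: sum.reindex[OF inj])
  have "\<exists>m\<in>X. u (v m) \<noteq> 0"
  proof (rule ccontr)
    assume "\<not> ?thesis"
    then have "p = 0" unfolding c by (intro sum.neutral) auto
    then show False using p by simp
  qed
  from lead_monomial_sum_distinct[OF v \<open>finite X\<close> this] show ?thesis by (simp add: c)
qed

text \<open>One polynomial is chosen for each leading monomial. Distinct leading monomials give
  independence. Spanning is Gaussian reduction: subtracting a multiple of \<open>v m\<close> removes
  the leading term, and the number of monomials below the leading one drops.\<close>

lemma lead_monomial_basis:
  fixes V :: "(nat, 'a::field) mpoly set"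
  assumes V: "mp.subspace V" "V \<subseteq> S_deg l d"
  obtains B where "B \<subseteq> V" "finite B" "mp.independent B" "V \<subseteq> mp.span B" "card B = card (LMs V)"
proof -
  have "\<forall>m\<in>LMs V. \<exists>p\<in>V. p \<noteq> 0 \<and> lead_monomial p = m" by (auto simp: LMs_def)
  then obtain v where v: "\<And>m. m \<in> LMs V \<Longrightarrow> v m \<in> V \<and> v m \<noteq> 0 \<and> lead_monomial (v m) = m"
    by metis
  have inj: "inj_on v (LMs V)" using v by (intro inj_on_inverseI[of _ lead_monomial]) auto
  let ?B = "v ` LMs V"
  have fin: "finite (LMs V)" by (rule finite_LMs[OF V(2)])
  have "mp.independent ?B"
    unfolding mp.dependent_def
  proof clarify
    fix m assume m: "m \<in> LMs V" "v m \<in> mp.span (?B - {v m})"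
    have "?B - {v m} = v ` (LMs V - {m})" using inj m(1) by (auto simp: inj_on_def)
    then have "lead_monomial (v m) \<in> LMs V - {m}"
      using m v[OF m(1)] v fin by (intro lead_monomial_in_if_in_span[of "LMs V - {m}" v]) auto
    then show False using v[OF m(1)] by auto
  qed
  moreover have "p \<in> mp.span ?B" if "p \<in> V" for p
    using that
  proof (induction "card {n \<in> Mon l d. degrevlex_less n (lead_monomial p)}" arbitrary: p rule: less_induct)
    case less
    show ?case
    proof (cases "p = 0")
      case False
      define m where "m = lead_monomial p"
      have m: "m \<in> LMs V" using False less.prems LMsI by (auto simp: m_def)
      note vm = v[OF m]
      define a where "a = lookup p m / lookup (v m) m"
      define q where "q = p - const a * v m"
      have vB: "const a * v m \<in> mp.span ?B" using m by (intro mp.span_scale mp.span_base) auto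
      have qV: "q \<in> V" unfolding q_def using vm less.prems by (intro mp.subspace_diff V(1) mp.subspace_scale) auto
      have "lookup (v m) m \<noteq> 0" using vm lead_monomial_in_keys[of "v m"] by (auto simp: in_keys_iff)
      then have qm: "m \<notin> keys q" by (simp add: q_def a_def lookup_minus in_keys_iff)
      have "q \<in> mp.span ?B"
      proof (cases "q = 0")
        case False
        have "keys q \<subseteq> keys p \<union> keys (v m)" by (auto simp: q_def in_keys_iff lookup_minus)
        then have "lead_monomial q \<in> keys p \<union> keys (v m)" "lead_monomial q \<noteq> m"
          using lead_monomial_in_keys[OF False] qm by auto
        then have lt: "degrevlex_less (lead_monomial q) m"
          using lead_monomial_greatest[OF \<open>p \<noteq> 0\<close>] lead_monomial_greatest[of "v m"] vm by (auto simp: m_def)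
        have "lead_monomial q \<in> Mon l d" using LMs_subset_Mon[OF V(2)] LMsI[OF qV False] by blast
        then have "{n \<in> Mon l d. degrevlex_less n (lead_monomial q)} \<subset> {n \<in> Mon l d. degrevlex_less n (lead_monomial p)}"
          using lt degrevlex_trans degrevlex_irrefl unfolding m_def by blast
        then have "card {n \<in> Mon l d. degrevlex_less n (lead_monomial q)} < card {n \<in> Mon l d. degrevlex_less n (lead_monomial p)}"
          by (intro psubset_card_mono) (auto simp: finite_Mon)
        then show ?thesis using less.hyps qV by blast
      qed (simp add: mp.span_zero)
      then have "q + const a * v m \<in> mp.span ?B" using vB by (rule mp.span_add)
      then show ?thesis by (simp add: q_def)
    qed (simp add: mp.span_zero)
  qed
  ultimately show ?thesis
    using that[of ?B] v fin card_image[OF inj] by auto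
qed

lemma dim_eq_card_LMs:
  assumes "mp.subspace V" "V \<subseteq> S_deg l d"
  shows "mp.dim V = card (LMs V)"
proof -
  obtain B where "B \<subseteq> V" "mp.independent B" "V \<subseteq> mp.span B" "card B = card (LMs V)"
    by (rule lead_monomial_basis[OF assms])
  then show ?thesis using mp.basis_card_eq_dim[of B V] by simp
qed

lemma subspace_S_deg: "mp.subspace (S_deg l d)"
  by (auto simp: mp.subspace_def S_deg_add S_deg_const_mult)

lemma LMs_S_deg: "LMs (S_deg l d :: (nat, 'a::field) mpoly set) = Mon l d"
proof
  show "Mon l d \<subseteq> LMs (S_deg l d :: (nat, 'a) mpoly set)"
  proof
    fix m assume "m \<in> Mon l d"
    then have "single m 1 \<in> (S_deg l d :: (nat, 'a) mpoly set)" by (simp add: S_deg_iff_keys)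
    moreover have "lead_monomial (single m 1 :: (nat, 'a) mpoly) = m" by (rule lead_monomial_eqI) auto
    ultimately show "m \<in> LMs (S_deg l d :: (nat, 'a) mpoly set)"
      using LMsI[of "single m (1::'a)"] by (metis keys_eq_empty keys_single insert_not_empty zero_neq_one)
  qed
qed (rule LMs_subset_Mon[OF order.refl])

lemma S_deg_finite_span: "\<exists>F. finite F \<and> S_deg l d \<subseteq> mp.span F"
  by (rule lead_monomial_basis[OF subspace_S_deg order.refl]) blast

lemma subspace_ideal_S_deg:
  assumes "ideal K (S_ring l)"
  shows "mp.subspace (K \<inter> S_deg l d)"
  using ideal_0[OF assms] ideal_add[OF assms] ideal_mult[OF assms]
  by (auto simp: mp.subspace_def S_deg_add S_deg_const_mult)

lemma linear_mult: "Vector_Spaces.linear (\<lambda>c p. const c * p) (\<lambda>c p. const c * p) (\<lambda>x. (f :: (nat, 'a::field) mpoly) * x)"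
  by unfold_locales (auto simp: distrib_left mult_ac)

text \<open>Rank--nullity for multiplication by \<open>f ^ s\<close> on the graded pieces, with dimensions of
  cokernels counted by standard monomials; the subtraction on the right is truncated.\<close>

lemma
  fixes K :: "(nat, 'a::field) mpoly set" and d s :: nat
  assumes K: "ideal K (S_ring l)" and f: "f \<in> S_deg l 1"
  defines "W \<equiv> {f ^ s * x + k |x k. x \<in> S_deg l d \<and> k \<in> K \<inter> S_deg l (d + s)}"
  shows full_rank_mod_iff_card: "full_rank_mod l K f s d \<longleftrightarrow>
      card (Mon l (d + s) - LMs W) =
      card (Mon l (d + s) - LMs (K \<inter> S_deg l (d + s))) - card (Mon l d - LMs (K \<inter> S_deg l d))" (is ?A)
    and card_cokernel_ge: "card (Mon l (d + s) - LMs W) \<ge>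
      card (Mon l (d + s) - LMs (K \<inter> S_deg l (d + s))) - card (Mon l d - LMs (K \<inter> S_deg l d))" (is ?B)
proof -
  let ?e = "d + s"
  let ?N = "{x \<in> S_deg l d. f ^ s * x \<in> K \<inter> S_deg l ?e}"
  have fs: "f ^ s * x \<in> S_deg l ?e" if "x \<in> S_deg l d" for x
    using S_deg_mult[OF S_deg_power[OF f, of s] that] by (simp add: add.commute)
  obtain Fd Fe :: "(nat, 'a) mpoly set" where
    F: "finite Fd" "S_deg l d \<subseteq> mp.span Fd" "finite Fe" "S_deg l ?e \<subseteq> mp.span Fe"
    using S_deg_finite_span by metis
  have sK: "mp.subspace (K \<inter> S_deg l d)" for d by (rule subspace_ideal_S_deg[OF K])
  interpret M: Vector_Spaces.linear "\<lambda>c p. const c * p" "\<lambda>c p. const c * p" "\<lambda>x. f ^ s * x"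
    by (rule linear_mult)
  have sW: "mp.subspace W"
  proof -
    have "mp.subspace {a + b |a b. a \<in> (\<lambda>x. f ^ s * x) ` S_deg l d \<and> b \<in> K \<inter> S_deg l ?e}"
      by (intro mp.subspace_sums M.subspace_image sK subspace_S_deg)
    also have "{a + b |a b. a \<in> (\<lambda>x. f ^ s * x) ` S_deg l d \<and> b \<in> K \<inter> S_deg l ?e} = W"
      by (auto simp: W_def)
    finally show ?thesis .
  qed
  have sN: "mp.subspace ?N"
    using fs sK[of ?e] subspace_S_deg[of l d, where ?'a = 'a]
    by (auto simp: mp.subspace_def distrib_left mult.left_commute)
  have WS: "W \<subseteq> S_deg l ?e" using fs by (auto simp: W_def S_deg_add)
  have cc: "card (Mon l d - LMs V) = card (Mon l d) - mp.dim V" "mp.dim V \<le> card (Mon l d)"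
    if "mp.subspace V" "V \<subseteq> S_deg l d" for V :: "(nat, 'a) mpoly set" and d
    using LMs_subset_Mon[OF that(2)] finite_LMs[OF that(2)] finite_Mon
    by (auto simp: card_Diff_subset dim_eq_card_LMs[OF that] card_mono)
  have cS: "mp.dim (S_deg l d :: (nat, 'a) mpoly set) = card (Mon l d)" for d
    by (simp add: dim_eq_card_LMs[OF subspace_S_deg order.refl] LMs_S_deg)
  have rank: "mp.dim W + mp.dim ?N = mp.dim (S_deg l d :: (nat, 'a) mpoly set) + mp.dim (K \<inter> S_deg l ?e)"
    unfolding W_def
    by (rule mp.dim_image_plus_subspace[OF linear_mult subspace_S_deg F(1,2) sK F(3)]) (use F in auto)
  have KN: "K \<inter> S_deg l d \<subseteq> ?N"
    using fs ideal_mult[OF K polys_in_power[OF S_degD[OF f]]] by auto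
  have NS: "?N \<subseteq> mp.span Fd" using F(2) by auto
  have dKN: "mp.dim (K \<inter> S_deg l d) \<le> mp.dim ?N"
    by (rule mp.dim_mono_finite[OF F(1) NS KN])
  have inj: "(\<forall>x\<in>S_deg l d. f ^ s * x \<in> K \<longrightarrow> x \<in> K) \<longleftrightarrow> mp.dim ?N = mp.dim (K \<inter> S_deg l d)"
  proof -
    have "(\<forall>x\<in>S_deg l d. f ^ s * x \<in> K \<longrightarrow> x \<in> K) \<longleftrightarrow> ?N = K \<inter> S_deg l d"
      using KN fs by blast
    also have "\<dots> \<longleftrightarrow> mp.dim ?N = mp.dim (K \<inter> S_deg l d)"
    proof
      assume "mp.dim ?N = mp.dim (K \<inter> S_deg l d)"
      then show "?N = K \<inter> S_deg l d"
        by (intro mp.subspace_eq_if_dim_eq[OF F(1) NS KN sK, symmetric]) simp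
    qed simp
    finally show ?thesis .
  qed
  have surj: "(\<forall>y\<in>S_deg l ?e. \<exists>x\<in>S_deg l d. y - f ^ s * x \<in> K) \<longleftrightarrow> mp.dim W = card (Mon l ?e)"
  proof -
    have "(\<forall>y\<in>S_deg l ?e. \<exists>x\<in>S_deg l d. y - f ^ s * x \<in> K) \<longleftrightarrow> W = S_deg l ?e"
    proof
      assume H: "\<forall>y\<in>S_deg l ?e. \<exists>x\<in>S_deg l d. y - f ^ s * x \<in> K"
      have "y \<in> W" if y: "y \<in> S_deg l ?e" for y
      proof -
        obtain x where x: "x \<in> S_deg l d" "y - f ^ s * x \<in> K" using H y by blast
        then have "y = f ^ s * x + (y - f ^ s * x)" "y - f ^ s * x \<in> K \<inter> S_deg l ?e"
          using S_deg_diff[OF y fs[OF x(1)]] by auto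
        then show ?thesis using x unfolding W_def by blast
      qed
      then show "W = S_deg l ?e" using WS by auto
    next
      assume W: "W = S_deg l ?e"
      show "\<forall>y\<in>S_deg l ?e. \<exists>x\<in>S_deg l d. y - f ^ s * x \<in> K"
      proof
        fix y :: "(nat, 'a) mpoly" assume "y \<in> S_deg l ?e"
        then have "y \<in> W" by (simp add: W)
        then obtain x k where "x \<in> S_deg l d" "k \<in> K" "y = f ^ s * x + k"
          unfolding W_def by blast
        then show "\<exists>x\<in>S_deg l d. y - f ^ s * x \<in> K" by (intro bexI[of _ x]) auto
      qed
    qed
    also have "\<dots> \<longleftrightarrow> mp.dim W = card (Mon l ?e)"
    proof
      assume "mp.dim W = card (Mon l ?e)"
      then show "W = S_deg l ?e"
        by (intro mp.subspace_eq_if_dim_eq[OF F(3,4) WS sW]) (simp add: cS)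
    qed (simp add: cS)
    finally show ?thesis .
  qed
  note c = cc[OF sW WS] cc[OF sK[of d]] cc[OF sK[of ?e]]
  have N: "mp.dim ?N \<le> card (Mon l d)" by (rule cc(2)[OF sN]) auto
  \<comment> \<open>With \<open>H\<close> the counts for \<open>K\<close> and
    \<open>r = card (Mon l d) - dim ?N\<close> the rank, the cokernel has dimension
    \<open>H (d + s) - r\<close>, and \<open>r \<le> H d\<close> by \<open>dKN\<close>. It attains
    the truncated bound iff it is 0 (surjective) or \<open>r = H d\<close> (injective).\<close>
  show ?A unfolding full_rank_mod_def inj surj using c N rank dKN unfolding cS by auto
  show ?B using c N rank dKN unfolding cS by auto
qed

section \<open>Generic coordinates\<close>

text \<open>Regular functions on the affine space of square matrices; their nonvanishing sets are
  the principal open sets.\<close>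

definition regular :: "nat \<Rightarrow> ('a::field mat \<Rightarrow> 'a) \<Rightarrow> bool" where
  "regular l f \<longleftrightarrow> (\<exists>p\<in>polys_in ({..<l} \<times> {..<l}). \<forall>g. f g = eval_poly id (\<lambda>ij. g $$ ij) p)"

lemma regular_const: "regular l (\<lambda>_. c)"
  unfolding regular_def
  by (intro bexI[of _ "const c"]) (auto simp: comm_ring_hom.eval_poly_const[OF comm_ring_hom_id])

lemma regular_entry: "i < l \<Longrightarrow> j < l \<Longrightarrow> regular l (\<lambda>g. g $$ (i, j))"
  unfolding regular_def
  by (intro bexI[of _ "var (i, j)"])
    (auto simp: comm_ring_hom.eval_poly_var[OF comm_ring_hom_id] polys_in_var)

lemma regular_add: "regular l f \<Longrightarrow> regular l h \<Longrightarrow> regular l (\<lambda>g. f g + h g)"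
proof -
  assume "regular l f" "regular l h"
  then obtain p q where "p \<in> polys_in ({..<l} \<times> {..<l})" "q \<in> polys_in ({..<l} \<times> {..<l})"
    "\<And>g. f g = eval_poly id (\<lambda>ij. g $$ ij) p" "\<And>g. h g = eval_poly id (\<lambda>ij. g $$ ij) q"
    unfolding regular_def by auto
  then show ?thesis unfolding regular_def
    by (intro bexI[of _ "p + q"]) (auto simp: comm_ring_hom.eval_poly_add[OF comm_ring_hom_id] polys_in_add)
qed

lemma regular_mult: "regular l f \<Longrightarrow> regular l h \<Longrightarrow> regular l (\<lambda>g. f g * h g)"
proof -
  assume "regular l f" "regular l h"
  then obtain p q where "p \<in> polys_in ({..<l} \<times> {..<l})" "q \<in> polys_in ({..<l} \<times> {..<l})"
    "\<And>g. f g = eval_poly id (\<lambda>ij. g $$ ij) p" "\<And>g. h g = eval_poly id (\<lambda>ij. g $$ ij) q"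
    unfolding regular_def by auto
  then show ?thesis unfolding regular_def
    by (intro bexI[of _ "p * q"]) (auto simp: comm_ring_hom.eval_poly_mult[OF comm_ring_hom_id] polys_in_mult)
qed

lemma regular_if: "regular l f \<Longrightarrow> regular l h \<Longrightarrow> regular l (\<lambda>g. if b then f g else h g)"
  by (cases b) auto

lemma regular_sum: "(\<And>x. x \<in> A \<Longrightarrow> regular l (f x)) \<Longrightarrow> regular l (\<lambda>g. \<Sum>x\<in>A. f x g)"
  by (induction A rule: infinite_finite_induct) (auto intro: regular_add regular_const)

lemma regular_prod: "(\<And>x. x \<in> A \<Longrightarrow> regular l (f x)) \<Longrightarrow> regular l (\<lambda>g. \<Prod>x\<in>A. f x g)"
  by (induction A rule: infinite_finite_induct) (auto intro: regular_mult regular_const)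

lemma regular_det:
  assumes "\<And>i j. i < n \<Longrightarrow> j < n \<Longrightarrow> regular l (\<lambda>g. A g i j)"
  shows "regular l (\<lambda>g. det (mat n n (\<lambda>(i, j). A g i j)))"
proof -
  have perm: "p i < n" if "p permutes {0..<n}" "i < n" for p i
    using permutes_in_image[OF that(1), of i] that(2) by simp
  have "det (mat n n (\<lambda>(i, j). A g i j)) =
      (\<Sum>p | p permutes {0..<n}. signof p * (\<Prod>i = 0..<n. A g i (p i)))" for g
    by (subst det_def'[of _ n])
      (auto intro!: sum.cong arg_cong2[of _ _ _ _ "(*)"] prod.cong
        simp: perm)
  moreover have "regular l (\<lambda>g. \<Sum>p | p permutes {0..<n}. signof p * (\<Prod>i = 0..<n. A g i (p i)))"
    using assms by (intro regular_sum regular_mult regular_const regular_prod) (auto simp: perm)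
  ultimately show ?thesis by simp
qed

text \<open>Along the line through \<open>g\<close> and \<open>h\<close> every entry is a linear
  polynomial in \<open>t\<close>, so \<open>f\<close> becomes a univariate polynomial, which has
  finitely many roots unless it is zero.\<close>

lemma regular_line:
  assumes "regular l f" and g: "g \<in> carrier_mat l l" and h: "h \<in> carrier_mat l l"
  shows "\<exists>q. \<forall>t. poly q t = f (g + t \<cdot>\<^sub>m (h - g))"
proof -
  obtain p where p: "p \<in> polys_in ({..<l} \<times> {..<l})" "\<And>g. f g = eval_poly id (\<lambda>ij. g $$ ij) p"
    using assms(1) unfolding regular_def by auto
  let ?q = "\<Sum>m\<in>keys p. smult (lookup p m) (\<Prod>ij\<in>keys m. [:g $$ ij, h $$ ij - g $$ ij:] ^ lookup m ij)"
  have "poly ?q t = f (g + t \<cdot>\<^sub>m (h - g))" for t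
  proof -
    have "(g + t \<cdot>\<^sub>m (h - g)) $$ ij = poly [:g $$ ij, h $$ ij - g $$ ij:] t" if "ij \<in> {..<l} \<times> {..<l}" for ij
      using that g h by (cases ij) auto
    then have "f (g + t \<cdot>\<^sub>m (h - g)) = eval_poly id (\<lambda>ij. poly [:g $$ ij, h $$ ij - g $$ ij:] t) p"
      unfolding p(2) by (rule eval_poly_cong[OF p(1)])
    then show ?thesis by (simp add: eval_poly_def poly_sum poly_prod)
  qed
  then show ?thesis by blast
qed

text \<open>\<open>P\<close> holds on a nonempty principal open subset of \<open>GL l\<close>. A
  single function \<open>f\<close> is used rather than a family, so that two conditions are combined
  by a product.\<close>

definition generic :: "nat \<Rightarrow> ('a::field mat \<Rightarrow> bool) \<Rightarrow> bool" where
  "generic l P \<longleftrightarrow> (\<exists>f. regular l f \<and> (\<exists>g\<in>GL l. f g \<noteq> 0) \<and> (\<forall>g\<in>GL l. f g \<noteq> 0 \<longrightarrow> P g))"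

lemma genericI:
  "regular l f \<Longrightarrow> g \<in> GL l \<Longrightarrow> f g \<noteq> 0 \<Longrightarrow> (\<And>h. h \<in> GL l \<Longrightarrow> f h \<noteq> 0 \<Longrightarrow> P h) \<Longrightarrow> generic l P"
  unfolding generic_def by blast

lemma generic_ex: "generic l P \<Longrightarrow> \<exists>g\<in>GL l. P g"
  unfolding generic_def by blast

lemma generic_mono: "generic l P \<Longrightarrow> (\<And>g. g \<in> GL l \<Longrightarrow> P g \<Longrightarrow> Q g) \<Longrightarrow> generic l Q"
  unfolding generic_def by blast

lemma generic_True: "generic l (\<lambda>g. True)"
  by (rule genericI[OF regular_const[of _ 1] GL_one]) auto

text \<open>Two nonempty principal open sets meet: restrict to the line through a point of each.\<close>

lemma generic_conj:
  fixes P Q :: "'a::field_char_0 mat \<Rightarrow> bool"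
  assumes "generic l P" and "generic l Q"
  shows "generic l (\<lambda>g. P g \<and> Q g)"
proof -
  obtain f1 g1 where 1: "regular l f1" "g1 \<in> GL l" "f1 g1 \<noteq> 0" "\<forall>g\<in>GL l. f1 g \<noteq> 0 \<longrightarrow> P g"
    using assms(1) unfolding generic_def by auto
  obtain f2 g2 where 2: "regular l f2" "g2 \<in> GL l" "f2 g2 \<noteq> 0" "\<forall>g\<in>GL l. f2 g \<noteq> 0 \<longrightarrow> Q g"
    using assms(2) unfolding generic_def by auto
  note c = GL_carrier[OF 1(2)] GL_carrier[OF 2(2)]
  have e: "g1 + 0 \<cdot>\<^sub>m (g2 - g1) = g1" "g1 + 1 \<cdot>\<^sub>m (g2 - g1) = g2" using c by (auto intro!: eq_matI)
  have rd: "regular l (\<lambda>g. det (mat l l (\<lambda>(i, j). g $$ (i, j))) :: 'a)"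
    by (rule regular_det) (rule regular_entry)
  have md: "mat l l (\<lambda>(i, j). g $$ (i, j)) = g" if "g \<in> carrier_mat l l" for g :: "'a mat"
    using that by (auto intro!: eq_matI)
  obtain q1 where q1: "\<And>t. poly q1 t = f1 (g1 + t \<cdot>\<^sub>m (g2 - g1))" using regular_line[OF 1(1) c] by blast
  obtain q2 where q2: "\<And>t. poly q2 t = f2 (g1 + t \<cdot>\<^sub>m (g2 - g1))" using regular_line[OF 2(1) c] by blast
  \<comment> \<open>The determinant along the line is a third polynomial to be kept nonzero, so that
    the point found is in \<open>GL l\<close>.\<close>
  obtain q3 where q3: "\<And>t. poly q3 t = det (mat l l (\<lambda>(i, j). (g1 + t \<cdot>\<^sub>m (g2 - g1)) $$ (i, j)))"
    using regular_line[OF rd c] by blast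
  have "poly q1 0 \<noteq> 0" "poly q2 1 \<noteq> 0" "poly q3 0 \<noteq> 0"
    using 1 2 GL_det_iff[OF c(1)] by (auto simp: q1 q2 q3 e md[simplified] c)
  then have "q1 * q2 * q3 \<noteq> 0" by auto
  then have "finite {t. poly (q1 * q2 * q3) t = 0}" by (rule poly_roots_finite)
  then obtain t where t: "poly (q1 * q2 * q3) t \<noteq> 0"
    using infinite_UNIV_char_0[where ?'a = 'a] by (metis (mono_tags) UNIV_eq_I mem_Collect_eq)
  define g where "g = g1 + t \<cdot>\<^sub>m (g2 - g1)"
  have gc: "g \<in> carrier_mat l l" using c by (auto simp: g_def)
  have "g \<in> GL l" using t md[OF gc] by (auto simp: GL_det_iff[OF gc] q3 g_def[symmetric] md[simplified])
  moreover have "f1 g * f2 g \<noteq> 0" using t by (auto simp: q1 q2 g_def[symmetric])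
  ultimately show ?thesis
    using 1(4) 2(4) by (intro genericI[OF regular_mult[OF 1(1) 2(1)]]) auto
qed

lemma generic_ball:
  fixes P :: "'b \<Rightarrow> 'a::field_char_0 mat \<Rightarrow> bool"
  assumes "finite A" and "\<And>x. x \<in> A \<Longrightarrow> generic l (P x)"
  shows "generic l (\<lambda>g. \<forall>x\<in>A. P x g)"
  using assms
proof (induction A rule: finite_induct)
  case (insert x A)
  then have "generic l (\<lambda>g. P x g \<and> (\<forall>x\<in>A. P x g))" by (intro generic_conj) auto
  then show ?case by (rule generic_mono) auto
qed (simp add: generic_True)

text \<open>A nonempty open set contains a principal one: some member of the defining family is
  nonzero at a given point of the set.\<close>

lemma generic_iff_zariski_open:
  "generic l P \<longleftrightarrow> (\<exists>U. zariski_open_GL l U \<and> U \<noteq> {} \<and> (\<forall>g\<in>U. P g))"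
proof
  assume "generic l P"
  then obtain p g where p: "p \<in> polys_in ({..<l} \<times> {..<l})" "g \<in> GL l" "eval_poly id (\<lambda>ij. g $$ ij) p \<noteq> 0"
    "\<forall>g\<in>GL l. eval_poly id (\<lambda>ij. g $$ ij) p \<noteq> 0 \<longrightarrow> P g"
    unfolding generic_def regular_def by auto
  let ?U = "{g \<in> GL l. \<exists>q\<in>{p}. eval_poly id (\<lambda>ij. g $$ ij) q \<noteq> 0}"
  have "zariski_open_GL l ?U"
    unfolding zariski_open_GL_def using p(1) by (intro exI[of _ "{p}"]) simp
  moreover have "g \<in> ?U" using p by simp
  ultimately show "\<exists>U. zariski_open_GL l U \<and> U \<noteq> {} \<and> (\<forall>g\<in>U. P g)"
    using p(4) by (intro exI[of _ ?U]) auto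
next
  assume "\<exists>U. zariski_open_GL l U \<and> U \<noteq> {} \<and> (\<forall>g\<in>U. P g)"
  then obtain U where "zariski_open_GL l U" "U \<noteq> {}" "\<forall>g\<in>U. P g" by blast
  moreover from this obtain F where "F \<subseteq> polys_in ({..<l} \<times> {..<l})"
    "U = {g \<in> GL l. \<exists>p\<in>F. eval_poly id (\<lambda>ij. g $$ ij) p \<noteq> 0}"
    unfolding zariski_open_GL_def by blast
  ultimately obtain F g where U: "F \<subseteq> polys_in ({..<l} \<times> {..<l})"
    "U = {g \<in> GL l. \<exists>p\<in>F. eval_poly id (\<lambda>ij. g $$ ij) p \<noteq> 0}" "g \<in> U" "\<forall>g\<in>U. P g"
    by blast
  then obtain p where p: "p \<in> F" "g \<in> GL l" "eval_poly id (\<lambda>ij. g $$ ij) p \<noteq> 0" by auto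
  show "generic l P"
  proof (rule genericI[where f = "\<lambda>g. eval_poly id (\<lambda>ij. g $$ ij) p", OF _ p(2,3)])
    show "regular l (\<lambda>g. eval_poly id (\<lambda>ij. g $$ ij) p)"
      unfolding regular_def using U(1) p(1) by auto
    show "P h" if "h \<in> GL l" "eval_poly id (\<lambda>ij. h $$ ij) p \<noteq> 0" for h
      using that U p(1) by auto
  qed
qed

text \<open>A polynomial whose coefficients depend regularly on \<open>g\<close>. The bound
  \<open>N\<close> on the supports is uniform in \<open>g\<close>, so that the coefficients of a
  product are sums over a fixed finite range.\<close>

definition regular_poly :: "nat \<Rightarrow> ('a::field mat \<Rightarrow> (nat, 'a) mpoly) \<Rightarrow> bool" where
  "regular_poly l F \<longleftrightarrow> (\<exists>N. finite N \<and> (\<forall>g. keys (F g) \<subseteq> N)) \<and> (\<forall>m. regular l (\<lambda>g. lookup (F g) m))"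

lemma regular_poly_const: "regular_poly l (\<lambda>_. p)"
  unfolding regular_poly_def by (intro conjI exI[of _ "keys p"] allI) (auto intro: regular_const)

lemma regular_poly_scalar: "regular l f \<Longrightarrow> regular_poly l (\<lambda>g. const (f g))"
  unfolding regular_poly_def
  by (intro conjI exI[of _ "{0}"] allI)
    (auto simp: const_def lookup_single when_def regular_const regular_if split: if_splits)

lemma regular_poly_add:
  assumes "regular_poly l F" and "regular_poly l G"
  shows "regular_poly l (\<lambda>g. F g + G g)"
proof -
  obtain M N where MN: "finite M" "finite N" "\<And>g. keys (F g) \<subseteq> M" "\<And>g. keys (G g) \<subseteq> N"
    using assms unfolding regular_poly_def by metis
  have "keys (F g + G g) \<subseteq> M \<union> N" for g
    using keys_add[of "F g" "G g"] MN(3)[of g] MN(4)[of g] by blast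
  then show ?thesis
    using assms MN(1,2) unfolding regular_poly_def
    by (intro conjI exI[of _ "M \<union> N"]) (auto simp: lookup_add intro!: regular_add)
qed

lemma regular_poly_mult:
  assumes "regular_poly l F" and "regular_poly l G"
  shows "regular_poly l (\<lambda>g. F g * G g)"
proof -
  obtain M N where MN: "finite M" "finite N" "\<And>g. keys (F g) \<subseteq> M" "\<And>g. keys (G g) \<subseteq> N"
    using assms unfolding regular_poly_def by metis
  have "F g * G g = (\<Sum>a\<in>M. \<Sum>b\<in>N. single (a + b) (lookup (F g) a * lookup (G g) b))" for g
    by (subst sum_single_lookup[OF MN(1,3)], subst sum_single_lookup[OF MN(2,4)])
      (simp add: sum_product mult_single)
  then have "lookup (F g * G g) m = (\<Sum>a\<in>M. \<Sum>b\<in>N. if a + b = m then lookup (F g) a * lookup (G g) b else 0)" for g m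
    by (simp add: lookup_sum lookup_single when_def)
  moreover have "regular l (\<lambda>g. \<Sum>a\<in>M. \<Sum>b\<in>N. if a + b = m then lookup (F g) a * lookup (G g) b else 0)" for m
    using assms by (intro regular_sum) (auto simp: regular_poly_def intro!: regular_if regular_mult regular_const)
  moreover have "keys (F g * G g) \<subseteq> (\<lambda>(a, b). a + b) ` (M \<times> N)" for g
    using keys_mult[of "F g" "G g"] MN(3)[of g] MN(4)[of g] by force
  ultimately show ?thesis
    using MN(1,2) unfolding regular_poly_def by (intro conjI exI[of _ "(\<lambda>(a, b). a + b) ` (M \<times> N)"]) auto
qed

lemma regular_poly_sum: "(\<And>x. x \<in> A \<Longrightarrow> regular_poly l (F x)) \<Longrightarrow> regular_poly l (\<lambda>g. \<Sum>x\<in>A. F x g)"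
  by (induction A rule: infinite_finite_induct) (auto intro: regular_poly_add regular_poly_const)

lemma regular_poly_prod: "(\<And>x. x \<in> A \<Longrightarrow> regular_poly l (F x)) \<Longrightarrow> regular_poly l (\<lambda>g. \<Prod>x\<in>A. F x g)"
  by (induction A rule: infinite_finite_induct) (auto intro: regular_poly_mult regular_poly_const)

lemma regular_poly_power: "regular_poly l F \<Longrightarrow> regular_poly l (\<lambda>g. F g ^ n)"
  by (induction n) (auto intro: regular_poly_mult regular_poly_const)

lemma regular_lookup_GL_act:
  assumes "b \<in> polys_in {..<l}"
  shows "regular l (\<lambda>g. lookup (GL_act l g b) m)"
proof -
  have "regular_poly l (\<lambda>g. GL_act l g b)"
    unfolding GL_act_def eval_poly_def
  proof (intro regular_poly_sum regular_poly_mult regular_poly_prod regular_poly_power regular_poly_const regular_poly_scalar)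
    fix m i j assume "m \<in> keys b" "j \<in> keys m" "i \<in> {..<l}"
    then show "regular l (\<lambda>g. g $$ (i, j))" using assms by (intro regular_entry) (auto simp: polys_in_def)
  qed
  then show ?thesis by (simp add: regular_poly_def)
qed

section \<open>Dickson's lemma\<close>

text \<open>\<open>B\<close> settles the first \<open>n\<close> coordinates. If coordinate
  \<open>n\<close> of \<open>a\<close> is at least \<open>N\<close>, an upper bound for that
  coordinate on \<open>B\<close>, then \<open>B\<close> still suffices; the remaining elements lie
  in finitely many slices with \<open>a n\<close> fixed, and each slice is covered by the induction
  hypothesis.\<close>

lemma dickson_functions:
  fixes A :: "(nat \<Rightarrow> nat) set"
  shows "\<exists>B\<subseteq>A. finite B \<and> (\<forall>a\<in>A. \<exists>b\<in>B. \<forall>i<n. b i \<le> a i)"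
proof (induction n arbitrary: A)
  case 0
  show ?case
  proof (cases "A = {}")
    case False
    then obtain a where "a \<in> A" by blast
    then show ?thesis by (intro exI[of _ "{a}"]) auto
  qed auto
next
  case (Suc n)
  obtain B where B: "B \<subseteq> A" "finite B" "\<forall>a\<in>A. \<exists>b\<in>B. \<forall>i<n. b i \<le> a i" using Suc[of A] by blast
  have "\<forall>k. \<exists>C\<subseteq>{a \<in> A. a n = k}. finite C \<and> (\<forall>a\<in>{a \<in> A. a n = k}. \<exists>b\<in>C. \<forall>i<n. b i \<le> a i)"
    using Suc by blast
  then obtain C where "\<forall>k. C k \<subseteq> {a \<in> A. a n = k} \<and> finite (C k) \<and> (\<forall>a\<in>{a \<in> A. a n = k}. \<exists>b\<in>C k. \<forall>i<n. b i \<le> a i)"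
    by (rule choice[THEN exE])
  then have C: "C k \<subseteq> {a \<in> A. a n = k}" "finite (C k)" "\<forall>a\<in>{a \<in> A. a n = k}. \<exists>b\<in>C k. \<forall>i<n. b i \<le> a i" for k
    by blast+
  define N where "N = (\<Sum>b\<in>B. b n)"
  have N: "b n \<le> N" if "b \<in> B" for b
    unfolding N_def by (rule member_le_sum[of _ _ "\<lambda>b. b n"]) (use that B in auto)
  let ?B = "B \<union> (\<Union>k<N. C k)"
  have "\<exists>b\<in>?B. \<forall>i<Suc n. b i \<le> a i" if a: "a \<in> A" for a
  proof (cases "a n < N")
    case True
    obtain b where b: "b \<in> C (a n)" "\<forall>i<n. b i \<le> a i" using C(3)[of "a n"] a by blast
    then have "b n = a n" using C(1)[of "a n"] by blast
    then show ?thesis using b True by (intro bexI[of _ b]) (auto simp: less_Suc_eq)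
  next
    case False
    obtain b where b: "b \<in> B" "\<forall>i<n. b i \<le> a i" using B(3) a by blast
    then show ?thesis using False N[OF b(1)] by (intro bexI[of _ b]) (auto simp: less_Suc_eq)
  qed
  moreover have "?B \<subseteq> A" using B(1) C(1) by fast
  moreover have "finite ?B" using B(2) C(2) by simp
  ultimately show ?case by blast
qed

text \<open>The bound \<open>D\<close> is what matters: genericity in degrees up to \<open>D\<close>
  will suffice. The sum of the degrees of the finitely many generators serves as
  \<open>D\<close>.\<close>

lemma dickson:
  assumes "L \<subseteq> mons l"
  shows "\<exists>D. \<forall>m\<in>L. \<exists>b\<in>L. \<exists>n\<in>mons l. mdeg b \<le> D \<and> m = n + b"
proof -
  obtain B where B: "B \<subseteq> lookup ` L" "finite B" "\<forall>a\<in>lookup ` L. \<exists>b\<in>B. \<forall>i<l. b i \<le> a i"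
    using dickson_functions[of "lookup ` L" l] by blast
  obtain B' where B': "B' \<subseteq> L" "finite B'" "B = lookup ` B'" using finite_subset_image[OF B(2,1)] by blast
  show ?thesis
  proof (intro exI[of _ "\<Sum>b\<in>B'. mdeg b"] ballI)
    fix m assume m: "m \<in> L"
    then obtain b where b: "b \<in> B'" "\<forall>i<l. lookup b i \<le> lookup m i" using B(3) B'(3) by blast
    have ml: "keys m \<subseteq> {..<l}" "keys b \<subseteq> {..<l}" using assms m b B' by (auto simp: mons_def)
    have le: "lookup b i \<le> lookup m i" for i
    proof (cases "i \<in> keys b")
      case True
      then show ?thesis using b(2) ml(2) by auto
    qed (simp add: in_keys_iff)
    have "m = (m - b) + b" by (rule poly_mapping_eqI) (simp add: lookup_add lookup_minus le)
    moreover have "m - b \<in> mons l"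
      using ml(1) by (auto simp: mons_def in_keys_iff lookup_minus subset_iff)
    moreover have "mdeg b \<le> (\<Sum>b\<in>B'. mdeg b)" by (rule member_le_sum) (use b B' in auto)
    ultimately show "\<exists>b\<in>L. \<exists>n\<in>mons l. mdeg b \<le> (\<Sum>b\<in>B'. mdeg b) \<and> m = n + b"
      using b(1) B'(1) by blast
  qed
qed

section \<open>Generic initial ideals\<close>

text \<open>Homogeneity in terms of components, so that no homogeneous generators have to be
  exhibited for transformed or monomial ideals.\<close>

definition graded_ideal :: "nat \<Rightarrow> (nat, 'a::field) mpoly set \<Rightarrow> bool" where
  "graded_ideal l I \<longleftrightarrow> ideal I (S_ring l) \<and> (\<forall>f\<in>I. \<forall>d. hcomp d f \<in> I)"

lemma graded_ideal_ideal: "graded_ideal l I \<Longrightarrow> ideal I (S_ring l)"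
  and graded_ideal_hcomp: "graded_ideal l I \<Longrightarrow> f \<in> I \<Longrightarrow> hcomp d f \<in> I"
  by (auto simp: graded_ideal_def)

lemma graded_ideal_if_homogeneous_ideal: "homogeneous_ideal l I \<Longrightarrow> graded_ideal l I"
  unfolding graded_ideal_def by (intro conjI ballI allI homogeneous_ideal_hcomp) (simp_all add: homogeneous_ideal_def)

lemma hcomp_GL_act:
  assumes "p \<in> polys_in {..<l}"
  shows "hcomp d (GL_act l g p) = GL_act l g (hcomp d p)"
proof -
  let ?t = "\<lambda>m. single m (lookup p m)"
  have S: "GL_act l g (?t m) \<in> S_deg l (mdeg m)" if "m \<in> keys p" for m
    using assms that by (intro GL_act_S_deg) (auto simp: S_deg_iff_keys Mon_def polys_in_def)
  have "hcomp d (GL_act l g p) = (\<Sum>m\<in>keys p. hcomp d (GL_act l g (?t m)))"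
    by (subst sum_single_lookup[of "keys p" p]) (simp_all add: GL_act_sum restr_sum)
  also have "\<dots> = (\<Sum>m\<in>keys p. if mdeg m = d then GL_act l g (?t m) else 0)"
    by (rule sum.cong[OF refl]) (auto simp: hcomp_of_S_deg[OF S])
  also have "\<dots> = GL_act l g (hcomp d p)"
    by (simp add: restr_def GL_act_sum sum.If_cases Collect_conj_eq)
  finally show ?thesis .
qed

text \<open>Absorption uses the inverse \<open>h\<close>: a multiplier \<open>r\<close> is itself
  the image of \<open>GL_act l h r\<close>.\<close>

lemma ideal_GL_act:
  assumes I: "ideal I (S_ring l)" and g: "g \<in> GL l"
  shows "ideal (GL_act l g ` I) (S_ring l)"
proof -
  obtain h where h: "h \<in> GL l" "g * h = 1\<^sub>m l" using GL_inverse[OF g] by metis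
  show ?thesis
    unfolding ideal_S_ring_iff
  proof (intro conjI ballI)
    show "GL_act l g ` I \<subseteq> polys_in {..<l}"
      using ideal_polys_in[OF I] GL_act_polys_in by blast
    show "0 \<in> GL_act l g ` I" using ideal_0[OF I] by (intro image_eqI[of _ _ 0]) auto
    fix p q assume "p \<in> GL_act l g ` I" "q \<in> GL_act l g ` I"
    then obtain a b where "a \<in> I" "b \<in> I" "p = GL_act l g a" "q = GL_act l g b" by blast
    then show "p + q \<in> GL_act l g ` I"
      using ideal_add[OF I, of a b] by (intro image_eqI[of _ _ "a + b"]) (simp_all add: GL_act.hom_add)
  next
    fix r p :: "(nat, 'a) mpoly" assume r: "r \<in> polys_in {..<l}" and "p \<in> GL_act l g ` I"
    then obtain f where f: "f \<in> I" "p = GL_act l g f" by blast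
    have "r * p = GL_act l g (GL_act l h r * f)"
      using GL_act_inverse[OF g h r] f(2) by (simp add: GL_act.hom_mult)
    then show "r * p \<in> GL_act l g ` I"
      using ideal_mult[OF I GL_act_polys_in[OF r] f(1)] by blast
  qed
qed

lemma graded_ideal_GL_act:
  assumes I: "graded_ideal l I" and g: "g \<in> GL l"
  shows "graded_ideal l (GL_act l g ` I)"
  unfolding graded_ideal_def
proof (intro conjI ballI allI)
  note id = graded_ideal_ideal[OF I]
  show "ideal (GL_act l g ` I) (S_ring l)" by (rule ideal_GL_act[OF id g])
  fix f d assume "f \<in> GL_act l g ` I"
  then obtain x where x: "x \<in> I" "f = GL_act l g x" by blast
  have "hcomp d f = GL_act l g (hcomp d x)"
    unfolding x(2) by (rule hcomp_GL_act[OF ideal_polys_in[OF id x(1)]])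
  then show "hcomp d f \<in> GL_act l g ` I" using graded_ideal_hcomp[OF I x(1)] by blast
qed

lemma GL_act_image_Int_S_deg:
  assumes I: "I \<subseteq> polys_in {..<l}" and g: "g \<in> GL l"
  shows "GL_act l g ` I \<inter> S_deg l d = GL_act l g ` (I \<inter> S_deg l d)"
proof -
  obtain h where h: "h \<in> GL l" "h * g = 1\<^sub>m l" using GL_inverse[OF g] by metis
  have "f \<in> S_deg l d" if "f \<in> I" "GL_act l g f \<in> S_deg l d" for f
    using GL_act_S_deg[OF that(2), of h] GL_act_inverse[OF h(1) g h(2), of f] I that(1) by auto
  then show ?thesis using GL_act_S_deg by blast
qed

lemma LMs_subset_mons: "ideal I (S_ring l) \<Longrightarrow> LMs I \<subseteq> mons l"
  using ideal_polys_in lead_monomial_in_keys by (fastforce simp: LMs_def polys_in_iff_keys)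

lemma LMs_add:
  assumes "ideal I (S_ring l)" and "m \<in> LMs I" and "n \<in> mons l"
  shows "n + m \<in> LMs I"
proof -
  obtain f where f: "f \<in> I" "f \<noteq> 0" "m = lead_monomial f" using assms(2) by (auto simp: LMs_def)
  have "single n 1 * f \<in> I"
    using assms(3) by (intro ideal_mult[OF assms(1) _ f(1)] polys_in_single) (simp add: mons_def)
  then show ?thesis
    using lead_monomial_single_mult[of f 1 n] f LMsI[of "single n 1 * f" I] by simp
qed

text \<open>The component of \<open>f\<close> in the degree of its leading monomial belongs to
  \<open>I\<close> and has the same leading monomial.\<close>

lemma LMs_Int_Mon:
  assumes I: "graded_ideal l I"
  shows "LMs I \<inter> Mon l d = LMs (I \<inter> S_deg l d)"
proof
  show "LMs (I \<inter> S_deg l d) \<subseteq> LMs I \<inter> Mon l d"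
    using LMs_subset_Mon[of "I \<inter> S_deg l d" l d] LMs_mono[of "I \<inter> S_deg l d" I] by auto
  show "LMs I \<inter> Mon l d \<subseteq> LMs (I \<inter> S_deg l d)"
  proof
    fix m assume m: "m \<in> LMs I \<inter> Mon l d"
    then obtain f where f: "f \<in> I" "f \<noteq> 0" "m = lead_monomial f" by (auto simp: LMs_def)
    let ?f = "hcomp d f"
    have mk: "m \<in> keys ?f" using m f lead_monomial_in_keys by (simp add: Mon_def)
    have "lead_monomial ?f = m"
      using mk lead_monomial_greatest[OF f(2)] f(3) by (intro lead_monomial_eqI) auto
    moreover have "?f \<in> I \<inter> S_deg l d"
      using graded_ideal_hcomp[OF I f(1)] hcomp_S_deg ideal_polys_in[OF graded_ideal_ideal[OF I] f(1)] by blast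
    moreover have "?f \<noteq> 0" using mk by (metis empty_iff keys_eq_empty)
    ultimately show "m \<in> LMs (I \<inter> S_deg l d)" using LMsI by metis
  qed
qed

lemma (in vector_space) independent_image_if_scalars_zero:
  assumes "finite I" and indep: "\<And>u. (\<Sum>i\<in>I. u i *s w i) = 0 \<Longrightarrow> \<forall>i\<in>I. u i = 0"
  shows "inj_on w I" and "independent (w ` I)"
proof -
  show inj: "inj_on w I"
  proof (rule inj_onI, rule ccontr)
    fix i j assume ij: "i \<in> I" "j \<in> I" "w i = w j" "i \<noteq> j"
    let ?u = "\<lambda>k. (if k = i then 1 else 0 :: 'a) - (if k = j then 1 else 0)"
    have "(\<Sum>k\<in>I. ?u k *s w k) = (\<Sum>k\<in>I. if k = i then w i else 0) - (\<Sum>k\<in>I. if k = j then w j else 0)"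
      unfolding sum_subtractf[symmetric] by (rule sum.cong) (auto simp: scale_left_diff_distrib)
    also have "\<dots> = 0" using ij assms(1) by simp
    finally have "(\<Sum>k\<in>I. ?u k *s w k) = 0" .
    from indep[OF this] ij(1) have "?u i = 0" by (rule bspec)
    then show False using ij(4) by simp
  qed
  show "independent (w ` I)"
  proof (rule independent_if_scalars_zero)
    show "finite (w ` I)" using assms(1) by simp
    fix f x assume "(\<Sum>x\<in>w ` I. f x *s x) = 0" and x: "x \<in> w ` I"
    then have "(\<Sum>i\<in>I. f (w i) *s w i) = 0" by (simp add: sum.reindex[OF inj])
    then show "f x = 0" using indep[of "\<lambda>i. f (w i)"] x by auto
  qed
qed

text \<open>If a form of degree \<open>d\<close> has any term in \<open>T\<close>, its leading
  monomial is in \<open>T\<close>. Hence leading monomials in \<open>T\<close> can be detected from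
  the coefficients at \<open>T\<close>, by linear algebra.\<close>

definition upset :: "nat \<Rightarrow> nat \<Rightarrow> nat monomial set \<Rightarrow> bool" where
  "upset l d T \<longleftrightarrow> T \<subseteq> Mon l d \<and> (\<forall>m\<in>T. \<forall>n\<in>Mon l d. degrevlex_less m n \<longrightarrow> n \<in> T)"

text \<open>The number of leading monomials of \<open>g V\<close> in an up-set \<open>T\<close> is the rank of the matrix of
  coefficients of \<open>g V\<close> at the monomials in \<open>T\<close>, and having rank at least \<open>c\<close> is an open condition on \<open>g\<close>.\<close>

lemma generic_card_LMs_ge:
  fixes V :: "(nat, 'a::field_char_0) mpoly set"
  assumes V: "mp.subspace V" "V \<subseteq> S_deg l d" and T: "upset l d T" and g0: "g0 \<in> GL l"
  shows "generic l (\<lambda>g. card (LMs (GL_act l g0 ` V) \<inter> T) \<le> card (LMs (GL_act l g ` V) \<inter> T))"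
proof -
  define X where "X = LMs (GL_act l g0 ` V) \<inter> T"
  define c where "c = card X"
  have "finite T" using T finite_Mon finite_subset by (auto simp: upset_def)
  then have fX: "finite X" by (simp add: X_def)
  obtain e where e: "bij_betw e {0..<c} X" using ex_bij_betw_nat_finite[OF fX] by (auto simp: c_def)
  have eX: "e i \<in> X" if "i < c" for i using bij_betwE[OF e] that by auto
  have "\<forall>m\<in>X. \<exists>p\<in>V. GL_act l g0 p \<noteq> 0 \<and> lead_monomial (GL_act l g0 p) = m"
    by (auto simp: X_def LMs_def)
  then obtain v where v: "\<And>m. m \<in> X \<Longrightarrow> v m \<in> V \<and> GL_act l g0 (v m) \<noteq> 0 \<and> lead_monomial (GL_act l g0 (v m)) = m"
    by metis
  define w where "w g j = GL_act l g (v (e j))" for g j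
  \<comment> \<open>A square minor of the coefficient matrix: the rows are the monomials in
    \<open>X\<close>, the columns are elements of \<open>V\<close> chosen so that \<open>g0\<close>
    gives them the leading monomials in \<open>X\<close>.\<close>
  define M where "M g = mat c c (\<lambda>(i, j). lookup (w g j) (e i))" for g
  have lk: "lookup (\<Sum>j<c. const (u j) * w g j) (e i) = (M g *\<^sub>v vec c u) $ i" if "i < c" for u g i
    using that by (simp add: M_def lookup_sum scalar_prod_def atLeast0LessThan mult.commute)
  have Mc: "M g \<in> carrier_mat c c" for g by (simp add: M_def)
  have vp: "v (e j) \<in> polys_in {..<l}" if "j < c" for j
    using v[OF eX[OF that]] V(2) S_degD by blast
  \<comment> \<open>A kernel vector would yield a combination whose coefficients vanish on
    \<open>X\<close>, although its leading monomial belongs to \<open>X\<close>.\<close>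
  have det0: "det (M g0) \<noteq> 0"
  proof
    assume "det (M g0) = 0"
    then obtain u where u: "u \<in> carrier_vec c" "u \<noteq> 0\<^sub>v c" "M g0 *\<^sub>v u = 0\<^sub>v c"
      using det_0_iff_vec_prod_zero_field[OF Mc] by blast
    have uv: "vec c (\<lambda>j. u $ j) = u" using u(1) by (intro eq_vecI) auto
    obtain j0 where j0: "j0 < c" "u $ j0 \<noteq> 0"
      using u(1,2) by (metis carrier_vecD eq_vecI index_zero_vec)
    define k where "k = inv_into {0..<c} e"
    have ke: "k (e j) = j" if "j < c" for j
      using bij_betw_inv_into_left[OF e, of j] that by (simp add: k_def)
    define p where "p = (\<Sum>m\<in>X. const (u $ k m) * GL_act l g0 (v m))"
    have nz: "\<exists>m\<in>X. u $ k m \<noteq> 0" using j0 eX ke by (intro bexI[of _ "e j0"]) auto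
    have pe: "p = (\<Sum>j<c. const (u $ j) * w g0 j)"
      unfolding p_def using sum.reindex_bij_betw[OF e, of "\<lambda>m. const (u $ k m) * GL_act l g0 (v m)"]
      by (simp add: atLeast0LessThan w_def ke)
    have "p \<noteq> 0" "lead_monomial p \<in> X"
      using sum_distinct_lead_monomials_nonzero[OF _ fX nz, of "\<lambda>m. GL_act l g0 (v m)"]
        lead_monomial_sum_distinct[OF _ fX nz, of "\<lambda>m. GL_act l g0 (v m)"] v
      unfolding p_def by auto
    moreover from this obtain i where i: "i < c" "lead_monomial p = e i"
      using e by (auto simp: bij_betw_def)
    ultimately have "lookup p (e i) \<noteq> 0" using lead_monomial_in_keys[of p] by (auto simp: in_keys_iff)
    then show False using lk[OF i(1), of "\<lambda>j. u $ j" g0] uv u(3) i(1) by (simp add: pe)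
  qed
  have reg: "regular l (\<lambda>g. det (M g))"
    unfolding M_def w_def by (intro regular_det regular_lookup_GL_act vp)
  show ?thesis
  proof (rule genericI[OF reg g0 det0])
    fix g assume g: "g \<in> GL l" and det: "det (M g) \<noteq> 0"
    \<comment> \<open>Since \<open>M g\<close> is invertible, a nontrivial combination has a nonzero
      coefficient at some \<open>e i\<close>, which is in \<open>T\<close>. This gives independence,
      and the up-set property then puts the leading monomial into \<open>T\<close>.\<close>
    have key: "\<exists>i<c. lookup (\<Sum>j<c. const (u j) * w g j) (e i) \<noteq> 0" if nz: "\<exists>j<c. u j \<noteq> 0" for u
    proof (rule ccontr)
      assume "\<not> ?thesis"
      then have "M g *\<^sub>v vec c u = 0\<^sub>v c" using lk Mc[of g] by (intro eq_vecI) auto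
      moreover obtain j where "j < c" "u j \<noteq> 0" using nz by blast
      then have "vec c u \<noteq> 0\<^sub>v c" by (metis index_vec index_zero_vec(1))
      ultimately show False using det det_0_iff_vec_prod_zero_field[OF Mc[of g]] vec_carrier by blast
    qed
    have indep: "\<forall>j\<in>{..<c}. u j = 0" if "(\<Sum>j<c. const (u j) * w g j) = 0" for u
      using key[of u] that by auto
    note ind = mp.independent_image_if_scalars_zero[of "{..<c}" "w g", OF _ indep]
    define B where "B = w g ` {..<c}"
    have B: "mp.independent B" "card B = c" using ind(2) card_image[OF ind(1)] by (simp_all add: B_def)
    have wV: "w g j \<in> GL_act l g ` V" if "j < c" for j using v eX that by (auto simp: w_def)
    have gV: "mp.subspace (GL_act l g ` V)"
    proof -
      interpret lin: Vector_Spaces.linear "\<lambda>c p. const c * p" "\<lambda>c p. const c * p" "GL_act l g"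
        by unfold_locales (auto simp: GL_act.hom_add GL_act.hom_mult)
      show ?thesis by (rule lin.subspace_image[OF V(1)])
    qed
    have gS: "GL_act l g ` V \<subseteq> S_deg l d" using V(2) GL_act_S_deg by blast
    have BV: "mp.span B \<subseteq> GL_act l g ` V" using wV gV by (intro mp.span_minimal) (auto simp: B_def)
    have "LMs (mp.span B) \<subseteq> T"
    proof
      fix m assume "m \<in> LMs (mp.span B)"
      then obtain p where p: "p \<in> mp.span B" "p \<noteq> 0" "m = lead_monomial p" by (auto simp: LMs_def)
      obtain u where "p = (\<Sum>q\<in>B. const (u q) * q)"
        using p(1) mp.span_finite[of B] by (auto simp: B_def)
      then have pu: "p = (\<Sum>j<c. const (u (w g j)) * w g j)"
        using ind(1) by (simp add: B_def sum.reindex)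
      then have "\<exists>j<c. u (w g j) \<noteq> 0"
        using p(2) sum.neutral[of "{..<c}" "\<lambda>j. const (u (w g j)) * w g j"] by (metis const_0 lessThan_iff mult_zero_left)
      from key[OF this] obtain i where i: "i < c" "lookup p (e i) \<noteq> 0"
        unfolding pu[symmetric] by blast
      then have eT: "e i \<in> T" and ek: "e i \<in> keys p" using eX by (auto simp: X_def in_keys_iff)
      have "m \<in> Mon l d"
        using LMs_subset_Mon[OF gS] LMsI[of p "GL_act l g ` V"] p BV by blast
      then show "m \<in> T" using T eT lead_monomial_greatest[OF p(2) ek] p(3)
        unfolding upset_def by (cases "e i = m") auto
    qed
    then have sub: "LMs (mp.span B) \<subseteq> LMs (GL_act l g ` V) \<inter> T" using LMs_mono[OF BV] by blast
    have "c = card (LMs (mp.span B))"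
      using dim_eq_card_LMs[OF mp.subspace_span, of B l d] BV gS mp.dim_eq_card_independent[OF B(1)] B(2) by auto
    also have "\<dots> \<le> card (LMs (GL_act l g ` V) \<inter> T)"
      using sub \<open>finite T\<close> by (intro card_mono) auto
    finally show "card (LMs (GL_act l g0 ` V) \<inter> T) \<le> card (LMs (GL_act l g ` V) \<inter> T)"
      by (simp add: c_def X_def)
  qed
qed

definition gin_max :: "nat \<Rightarrow> (nat, 'a::field) mpoly set \<Rightarrow> nat \<Rightarrow> 'a mat \<Rightarrow> bool" where
  "gin_max l I d g \<longleftrightarrow> (\<forall>T. upset l d T \<longrightarrow>
     (\<forall>h\<in>GL l. card (LMs (GL_act l h ` I) \<inter> T) \<le> card (LMs (GL_act l g ` I) \<inter> T)))"

lemma LMs_GL_act_Int_upset: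
  assumes "graded_ideal l I" and "g \<in> GL l" and "upset l d T"
  shows "LMs (GL_act l g ` I) \<inter> T = LMs (GL_act l g ` (I \<inter> S_deg l d)) \<inter> T"
proof -
  have T: "T = Mon l d \<inter> T" using assms(3) by (auto simp: upset_def)
  have 1: "LMs (GL_act l g ` I) \<inter> Mon l d = LMs (GL_act l g ` I \<inter> S_deg l d)"
    by (rule LMs_Int_Mon[OF graded_ideal_GL_act[OF assms(1,2)]])
  have 2: "GL_act l g ` I \<inter> S_deg l d = GL_act l g ` (I \<inter> S_deg l d)"
    using ideal_polys_in[OF graded_ideal_ideal[OF assms(1)]] by (intro GL_act_image_Int_S_deg[OF _ assms(2)]) auto
  have "LMs (GL_act l g ` I) \<inter> T = (LMs (GL_act l g ` I) \<inter> Mon l d) \<inter> T" using T by blast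
  then show ?thesis unfolding 1 2 .
qed

text \<open>The count in \<open>T\<close> is at most \<open>card T\<close>, so some
  \<open>g0\<close> maximises it, and generic \<open>g\<close> do at least as well as
  \<open>g0\<close>. A degree has finitely many up-sets, so these conditions hold jointly.\<close>

lemma generic_gin_max:
  fixes I :: "(nat, 'a::field_char_0) mpoly set"
  assumes I: "graded_ideal l I"
  shows "generic l (gin_max l I d)"
proof -
  let ?r = "\<lambda>T g. card (LMs (GL_act l g ` I) \<inter> T)"
  have "generic l (\<lambda>g. \<forall>T\<in>{T. upset l d T}. \<forall>h\<in>GL l. ?r T h \<le> ?r T g)"
  proof (rule generic_ball)
    show "finite {T. upset l d T}"
      by (rule finite_subset[of _ "Pow (Mon l d)"]) (auto simp: upset_def finite_Mon)
    fix T assume "T \<in> {T. upset l d T}"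
    then have T: "upset l d T" by simp
    then have "finite T" using finite_Mon finite_subset by (auto simp: upset_def)
    then have bound: "\<forall>g. g \<in> GL l \<longrightarrow> ?r T g < Suc (card T)"
      by (auto intro: card_mono simp: less_Suc_eq_le)
    obtain g0 where g0: "g0 \<in> GL l" "\<And>h. h \<in> GL l \<Longrightarrow> ?r T h \<le> ?r T g0"
      using ex_has_greatest_nat[of "\<lambda>g. g \<in> GL l", OF GL_one bound] by blast
    have "generic l (\<lambda>g. card (LMs (GL_act l g0 ` (I \<inter> S_deg l d)) \<inter> T)
        \<le> card (LMs (GL_act l g ` (I \<inter> S_deg l d)) \<inter> T))"
      by (rule generic_card_LMs_ge[OF subspace_ideal_S_deg[OF graded_ideal_ideal[OF I]] _ T g0(1)]) simp
    then show "generic l (\<lambda>g. \<forall>h\<in>GL l. ?r T h \<le> ?r T g)"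
    proof (rule generic_mono, intro ballI)
      fix g h :: "'a mat" assume g: "g \<in> GL l" and h: "h \<in> GL l"
        and le: "card (LMs (GL_act l g0 ` (I \<inter> S_deg l d)) \<inter> T) \<le> card (LMs (GL_act l g ` (I \<inter> S_deg l d)) \<inter> T)"
      have "?r T g0 \<le> ?r T g"
        using le unfolding LMs_GL_act_Int_upset[OF I g0(1) T] LMs_GL_act_Int_upset[OF I g T] .
      then show "?r T h \<le> ?r T g" using g0(2)[OF h] by linarith
    qed
  qed
  then show ?thesis by (rule generic_mono) (simp add: gin_max_def)
qed

text \<open>A set of monomials of degree \<open>d\<close> is determined by its numbers of elements in the up-sets.\<close>

lemma gin_max_unique:
  assumes g: "g \<in> GL l" "gin_max l I d g" and h: "h \<in> GL l" "gin_max l I d h"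
  shows "LMs (GL_act l g ` I) \<inter> Mon l d = LMs (GL_act l h ` I) \<inter> Mon l d"
proof -
  let ?X = "LMs (GL_act l g ` I)" and ?Y = "LMs (GL_act l h ` I)"
  have eq: "card (?X \<inter> T) = card (?Y \<inter> T)" if "upset l d T" for T
    using g h that unfolding gin_max_def by (meson order.antisym)
  have "m \<in> ?X \<longleftrightarrow> m \<in> ?Y" if m: "m \<in> Mon l d" for m
  proof -
    \<comment> \<open>The up-sets \<open>T\<close> and \<open>insert m T\<close> differ by
      \<open>m\<close> alone, so the two counts decide whether \<open>m\<close> is a member.\<close>
    define T where "T = {n \<in> Mon l d. degrevlex_less m n}"
    have fin: "finite T" by (simp add: T_def finite_Mon)
    have mT: "m \<notin> T" by (simp add: T_def degrevlex_irrefl)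
    have up: "upset l d T" "upset l d (insert m T)"
      using m by (auto simp: upset_def T_def intro: degrevlex_trans)
    have "card (?X \<inter> T) = card (?Y \<inter> T)" "card (?X \<inter> insert m T) = card (?Y \<inter> insert m T)"
      using eq[OF up(1)] eq[OF up(2)] .
    moreover have "card (Z \<inter> insert m T) = card (Z \<inter> T) + (if m \<in> Z then 1 else 0)" for Z
      using fin mT by (auto simp: Int_insert_right)
    ultimately show ?thesis by (auto split: if_splits)
  qed
  then show ?thesis by blast
qed

text \<open>The last conclusion compares \<open>L\<close> with the leading monomials of every
  transform of \<open>I\<close>, including those for which they differ from
  \<open>L\<close>.\<close>

theorem galligo:
  fixes I :: "(nat, 'a::field_char_0) mpoly set"
  assumes I: "graded_ideal l I"
  obtains L where "L \<subseteq> mons l" and "\<And>m n. m \<in> L \<Longrightarrow> n \<in> mons l \<Longrightarrow> n + m \<in> L"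
    and "generic l (\<lambda>g. LMs (GL_act l g ` I) = L)"
    and "\<And>g d T. g \<in> GL l \<Longrightarrow> upset l d T \<Longrightarrow> card (LMs (GL_act l g ` I) \<inter> T) \<le> card (L \<inter> T)"
proof -
  let ?M = "\<lambda>g. LMs (GL_act l g ` I)"
  have "\<forall>d. \<exists>g\<in>GL l. gin_max l I d g" using generic_ex[OF generic_gin_max[OF I]] by blast
  then obtain g0 where g0: "\<And>d. g0 d \<in> GL l" "\<And>d. gin_max l I d (g0 d)" by metis
  define L where "L = (\<Union>d. ?M (g0 d) \<inter> Mon l d)"
  have Mon_disj: "d = e" if "m \<in> Mon l d" "m \<in> Mon l e" for m d e using that by (simp add: Mon_def)
  have L_Mon: "L \<inter> Mon l d = ?M (g0 d) \<inter> Mon l d" for d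
    unfolding L_def using Mon_disj by blast
  have L_eq: "L \<inter> Mon l d = ?M g \<inter> Mon l d" if "g \<in> GL l" "gin_max l I d g" for g d
    unfolding L_Mon by (rule gin_max_unique[OF g0 that])
  have Lm: "L \<subseteq> mons l" by (auto simp: L_def Mon_def mons_def)
  have in_Mon: "m \<in> Mon l (mdeg m)" if "m \<in> mons l" for m using that by (simp add: mons_def Mon_def)
  have idg: "ideal (GL_act l g ` I) (S_ring l)" if "g \<in> GL l" for g
    by (rule graded_ideal_ideal[OF graded_ideal_GL_act[OF I that]])
  have L_add: "n + m \<in> L" if m: "m \<in> L" and n: "n \<in> mons l" for m n
  proof -
    \<comment> \<open>One matrix that is maximal in both degrees involved: there \<open>L\<close>
      agrees with the leading monomials of an ideal, which are closed under multiples.\<close>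
    obtain g where g: "g \<in> GL l" "gin_max l I (mdeg m) g" "gin_max l I (mdeg n + mdeg m) g"
      using generic_ex[OF generic_conj[OF generic_gin_max[OF I] generic_gin_max[OF I]]] by blast
    have "m \<in> ?M g" using L_eq[OF g(1,2)] m in_Mon Lm by blast
    then have nm: "n + m \<in> ?M g" by (rule LMs_add[OF idg[OF g(1)] _ n])
    then have "n + m \<in> Mon l (mdeg n + mdeg m)"
      using in_Mon[of "n + m"] LMs_subset_mons[OF idg[OF g(1)]] by auto
    then show ?thesis using L_eq[OF g(1,3)] nm by blast
  qed
  obtain D where D: "\<And>m. m \<in> L \<Longrightarrow> \<exists>b\<in>L. \<exists>n\<in>mons l. mdeg b \<le> D \<and> m = n + b"
    using dickson[OF Lm] by blast
  have max: "card (?M g \<inter> T) \<le> card (L \<inter> T)" if "g \<in> GL l" "upset l d T" for g d T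
  proof -
    have "L \<inter> T = ?M (g0 d) \<inter> T" using L_Mon[of d] that(2) by (auto simp: upset_def)
    then show ?thesis using g0(2)[of d] that by (simp add: gin_max_def)
  qed
  have "generic l (\<lambda>g. \<forall>d\<in>{..D}. gin_max l I d g)"
    by (rule generic_ball) (auto intro: generic_gin_max[OF I])
  then have gen: "generic l (\<lambda>g. ?M g = L)"
  proof (rule generic_mono)
    fix g assume g: "g \<in> GL l" and mx: "\<forall>d\<in>{..D}. gin_max l I d g"
    have sub: "L \<subseteq> ?M g"
    proof
      fix m assume "m \<in> L"
      then obtain b n where b: "b \<in> L" "n \<in> mons l" "mdeg b \<le> D" "m = n + b" using D by blast
      have "b \<in> Mon l (mdeg b)" using in_Mon b(1) Lm by blast
      then have "b \<in> ?M g" using L_eq[OF g, of "mdeg b"] mx b by blast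
      then show "m \<in> ?M g" unfolding b(4) by (rule LMs_add[OF idg[OF g] _ b(2)])
    qed
    \<comment> \<open>Beyond degree \<open>D\<close> nothing is known about maximality of
      \<open>g\<close>. The inclusion \<open>sub\<close> and the bound \<open>max\<close> on the
      full degree, which is itself an up-set, still force equality.\<close>
    have "L \<inter> Mon l d = ?M g \<inter> Mon l d" for d
    proof (rule card_subset_eq)
      show sub': "L \<inter> Mon l d \<subseteq> ?M g \<inter> Mon l d" using sub by blast
      have "card (?M g \<inter> Mon l d) \<le> card (L \<inter> Mon l d)" by (rule max[OF g, of d]) (simp add: upset_def)
      then show "card (L \<inter> Mon l d) = card (?M g \<inter> Mon l d)"
        using finite_Mon[of l d] by (intro order.antisym[OF card_mono[OF _ sub']]) auto
    qed (simp add: finite_Mon)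
    then show "?M g = L"
      using in_Mon LMs_subset_mons[OF idg[OF g]] Lm by blast
  qed
  show ?thesis by (rule that[OF Lm _ gen]; (rule L_add max; assumption))
qed

text \<open>For \<open>L\<close> closed under multiples this is a monomial ideal; for monomials of
  one degree it is merely their linear span. Both uses occur.\<close>

definition mon_span :: "nat monomial set \<Rightarrow> (nat, 'a::field) mpoly set" where
  "mon_span L = {p. keys p \<subseteq> L}"

lemma graded_ideal_mon_span:
  assumes "L \<subseteq> mons l" and "\<And>m n. m \<in> L \<Longrightarrow> n \<in> mons l \<Longrightarrow> n + m \<in> L"
  shows "graded_ideal l (mon_span L)"
  unfolding graded_ideal_def ideal_S_ring_iff
proof (intro conjI ballI allI)
  show "p + q \<in> mon_span L" if "p \<in> mon_span L" "q \<in> mon_span L" for p q :: "(nat, 'a) mpoly"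
    using that keys_add[of p q] by (auto simp: mon_span_def)
  show "r * p \<in> mon_span L" if "r \<in> polys_in {..<l}" "p \<in> mon_span L" for r p :: "(nat, 'a) mpoly"
  proof -
    have "n + m \<in> L" if "n \<in> keys r" "m \<in> keys p" for n m
      using that \<open>r \<in> polys_in {..<l}\<close> \<open>p \<in> mon_span L\<close>
      by (intro assms(2)) (auto simp: mon_span_def polys_in_iff_keys)
    then show ?thesis using keys_mult[of r p] by (auto simp: mon_span_def)
  qed
qed (use assms(1) in \<open>auto simp: mon_span_def polys_in_iff_keys\<close>)

lemma LMs_mon_span: "LMs (mon_span L :: (nat, 'a::field) mpoly set) = L"
proof
  show "LMs (mon_span L :: (nat, 'a) mpoly set) \<subseteq> L"
    using lead_monomial_in_keys by (fastforce simp: LMs_def mon_span_def)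
  show "L \<subseteq> LMs (mon_span L :: (nat, 'a) mpoly set)"
  proof
    fix m assume "m \<in> L"
    then have "single m 1 \<in> (mon_span L :: (nat, 'a) mpoly set)" by (simp add: mon_span_def)
    moreover have "lead_monomial (single m 1 :: (nat, 'a) mpoly) = m" by (rule lead_monomial_eqI) auto
    ultimately show "m \<in> LMs (mon_span L :: (nat, 'a) mpoly set)"
      using LMsI[of "single m (1::'a)"] by (metis keys_eq_empty keys_single insert_not_empty zero_neq_one)
  qed
qed

text \<open>\<open>LMs K\<close> is closed under multiples, so its span is already an ideal;
  conversely, each of its terms is a scalar multiple of a leading term of \<open>K\<close>.\<close>

lemma LT_ideal_eq_mon_span:
  assumes K: "ideal K (S_ring l)"
  shows "LT_ideal l K = mon_span (LMs K)"
proof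
  have mi: "ideal (mon_span (LMs K)) (S_ring l :: (nat, 'a) mpoly ring)"
    using LMs_subset_mons[OF K] LMs_add[OF K] by (intro graded_ideal_ideal graded_ideal_mon_span) auto
  have sub: "lead_term ` (K - {0}) \<subseteq> mon_span (LMs K)"
    using LMsI[of _ K] by (auto simp: mon_span_def lead_term_def split: if_splits)
  then show "LT_ideal l K \<subseteq> mon_span (LMs K)"
    unfolding LT_ideal_def by (intro S.genideal_minimal mi)
  have c: "lead_term ` (K - {0}) \<subseteq> carrier (S_ring l)"
    using sub ideal_polys_in[OF mi] by auto
  have id: "ideal (LT_ideal l K) (S_ring l)"
    unfolding LT_ideal_def by (rule S.genideal_ideal[OF c])
  show "mon_span (LMs K) \<subseteq> LT_ideal l K"
  proof
    fix p :: "(nat, 'a) mpoly" assume p: "p \<in> mon_span (LMs K)"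
    have "single m (lookup p m) \<in> LT_ideal l K" if "m \<in> keys p" for m
    proof -
      have "m \<in> LMs K" using p that by (auto simp: mon_span_def)
      then obtain f where f: "f \<in> K" "f \<noteq> 0" "m = lead_monomial f"
        by (auto simp: LMs_def)
      have "lookup f m \<noteq> 0" using lead_monomial_in_keys[OF f(2)] f(3) by (simp add: in_keys_iff)
      then have "single m (lookup p m) = const (lookup p m / lookup f m) * lead_term f"
        using f(3) by (simp add: lead_term_def const_def mult_single)
      moreover have "lead_term f \<in> LT_ideal l K"
        unfolding LT_ideal_def using S.genideal_self[OF c] f by auto
      ultimately show ?thesis using ideal_mult[OF id polys_in_const] by metis
    qed
    then show "p \<in> LT_ideal l K"
      using ideal_sum[OF id, of "keys p" "\<lambda>m. single m (lookup p m)"] sum_single_lookup[of "keys p" p] by simp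
  qed
qed

text \<open>The definite description in \<open>rgin\<close> is legitimate because two generic
  conditions share a matrix, at which the two candidate ideals coincide.\<close>

lemma rgin_eq_mon_span:
  fixes I :: "(nat, 'a::field_char_0) mpoly set"
  assumes I: "graded_ideal l I" and gen: "generic l (\<lambda>g. LMs (GL_act l g ` I) = L)"
  shows "rgin l I = mon_span L"
proof -
  have gen': "generic l (\<lambda>g. LT_ideal l (GL_act l g ` I) = mon_span L)"
    using gen by (rule generic_mono)
      (simp add: LT_ideal_eq_mon_span[OF graded_ideal_ideal[OF graded_ideal_GL_act[OF I]]])
  have "rgin l I = (THE J. generic l (\<lambda>g. LT_ideal l (GL_act l g ` I) = J))"
    unfolding rgin_def generic_iff_zariski_open ..
  also have "\<dots> = mon_span L"
  proof (rule the_equality[of "\<lambda>J. generic l (\<lambda>g. LT_ideal l (GL_act l g ` I) = J)", OF gen'])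
    fix J assume "generic l (\<lambda>g. LT_ideal l (GL_act l g ` I) = J)"
    from generic_ex[OF generic_conj[OF gen' this]] show "J = mon_span L" by auto
  qed
  finally show ?thesis .
qed

section \<open>Moving Lefschetz elements to the last variables\<close>

lemma GL_act_image_inverse:
  assumes "g \<in> GL l" and "h \<in> GL l" and "g * h = 1\<^sub>m l" and "X \<subseteq> polys_in {..<l}"
  shows "GL_act l g ` GL_act l h ` X = X"
proof -
  have "GL_act l g (GL_act l h x) = x" if "x \<in> X" for x
    using assms(4) that by (intro GL_act_inverse[OF assms(1-3)]) auto
  then show ?thesis by (simp add: image_image)
qed

lemma GL_act_genideal:
  assumes g: "g \<in> GL l" and X: "X \<subseteq> polys_in {..<l}"
  shows "GL_act l g ` (Idl\<^bsub>S_ring l\<^esub> X) = Idl\<^bsub>S_ring l\<^esub> (GL_act l g ` X)"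
proof -
  have sub: "Idl\<^bsub>S_ring l\<^esub> (GL_act l g ` X) \<subseteq> GL_act l g ` (Idl\<^bsub>S_ring l\<^esub> X)"
    if g: "g \<in> GL l" and X: "X \<subseteq> polys_in {..<l}" for g and X :: "(nat, 'a) mpoly set"
    using X S.genideal_self[of X l] S.genideal_ideal[of X l]
    by (intro S.genideal_minimal ideal_GL_act g) auto
  obtain h where h: "h \<in> GL l" "g * h = 1\<^sub>m l" "h * g = 1\<^sub>m l" by (rule GL_inverse[OF g])
  have gX: "GL_act l g ` X \<subseteq> polys_in {..<l}" using X GL_act_polys_in by blast
  have idl: "Idl\<^bsub>S_ring l\<^esub> (GL_act l g ` X) \<subseteq> polys_in {..<l}"
    using ideal_polys_in[OF S.genideal_ideal, of "GL_act l g ` X" l] gX by auto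
  have "Idl\<^bsub>S_ring l\<^esub> X \<subseteq> GL_act l h ` (Idl\<^bsub>S_ring l\<^esub> (GL_act l g ` X))"
    using sub[OF h(1) gX] unfolding GL_act_image_inverse[OF h(1) g h(3) X] .
  then have "GL_act l g ` (Idl\<^bsub>S_ring l\<^esub> X) \<subseteq> GL_act l g ` GL_act l h ` (Idl\<^bsub>S_ring l\<^esub> (GL_act l g ` X))"
    by (rule image_mono)
  then show ?thesis using sub[OF g X] unfolding GL_act_image_inverse[OF g h(1,2) idl] by blast
qed

lemma full_rank_mod_GL_act_imp:
  assumes g: "g \<in> GL l" and K: "ideal K (S_ring l)" and f: "f \<in> S_deg l 1" and FR: "full_rank_mod l K f s d"
  shows "full_rank_mod l (GL_act l g ` K) (GL_act l g f) s d"
proof -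
  obtain h where h: "h \<in> GL l" "g * h = 1\<^sub>m l" "h * g = 1\<^sub>m l" by (rule GL_inverse[OF g])
  have gh: "GL_act l g (GL_act l h x) = x" "GL_act l h (GL_act l g x) = x" if "x \<in> polys_in {..<l}" for x
    using GL_act_inverse[OF g h(1,2) that] GL_act_inverse[OF h(1) g h(3) that] .
  have mem: "x \<in> GL_act l g ` K \<longleftrightarrow> GL_act l h x \<in> K" if "x \<in> polys_in {..<l}" for x
    using gh[OF that] gh ideal_polys_in[OF K] by (metis image_iff)
  have fp: "f \<in> polys_in {..<l}" "GL_act l g f \<in> polys_in {..<l}"
    using S_degD[OF f] GL_act_polys_in by auto
  have mult: "GL_act l h (GL_act l g f ^ s * x) = f ^ s * GL_act l h x" for x
    using gh(2)[OF fp(1)] by (simp add: GL_act.hom_mult GL_act.hom_power)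
  consider (inj) "\<forall>x\<in>S_deg l d. f ^ s * x \<in> K \<longrightarrow> x \<in> K"
    | (surj) "\<forall>y\<in>S_deg l (d + s). \<exists>x\<in>S_deg l d. y - f ^ s * x \<in> K"
    using FR unfolding full_rank_mod_def by blast
  then show ?thesis
  proof cases
    case inj
    have "x \<in> GL_act l g ` K" if x: "x \<in> S_deg l d" "GL_act l g f ^ s * x \<in> GL_act l g ` K" for x
    proof -
      have "f ^ s * GL_act l h x \<in> K"
        using x(2) mem[of "GL_act l g f ^ s * x"] S_degD[OF x(1)] fp(2)
        by (simp add: mult polys_in_mult polys_in_power)
      then have "GL_act l h x \<in> K" using inj GL_act_S_deg[OF x(1)] by blast
      then show ?thesis using mem S_degD[OF x(1)] by blast
    qed
    then show ?thesis unfolding full_rank_mod_def by blast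
  next
    case surj
    have "\<exists>x\<in>S_deg l d. y - GL_act l g f ^ s * x \<in> GL_act l g ` K" if y: "y \<in> S_deg l (d + s)" for y
    proof -
      obtain x where x: "x \<in> S_deg l d" "GL_act l h y - f ^ s * x \<in> K"
        using surj GL_act_S_deg[OF y, of h] by blast
      let ?x = "GL_act l g x"
      have "GL_act l h (y - GL_act l g f ^ s * ?x) \<in> K"
        using x(2) gh(2)[OF S_degD[OF x(1)]] by (simp add: GL_act_diff mult)
      then have "y - GL_act l g f ^ s * ?x \<in> GL_act l g ` K"
        using mem S_degD[OF y] fp(2) S_degD[OF GL_act_S_deg[OF x(1)]]
        by (simp add: polys_in_mult polys_in_power polys_in_diff)
      then show ?thesis using GL_act_S_deg[OF x(1)] by blast
    qed
    then show ?thesis unfolding full_rank_mod_def by blast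
  qed
qed

lemma Lefschetz_mod_GL_act:
  assumes g: "g \<in> GL l" and I: "ideal I (S_ring l)" and fs: "set fs \<subseteq> S_deg l 1" and LP: "Lefschetz_mod l A I fs"
  shows "Lefschetz_mod l A (GL_act l g ` I) (map (GL_act l g) fs)"
  unfolding Lefschetz_mod_def length_map
proof (intro allI ballI impI)
  fix i s d assume i: "i < length fs" and s: "s \<in> A"
  let ?X = "I \<union> set (take i fs)"
  have X: "?X \<subseteq> polys_in {..<l}"
    using ideal_polys_in[OF I] fs S_degD set_take_subset[of i fs] by blast
  have "full_rank_mod l (GL_act l g ` (Idl\<^bsub>S_ring l\<^esub> ?X)) (GL_act l g (fs ! i)) s d"
    using LP i s fs X by (intro full_rank_mod_GL_act_imp[OF g S.genideal_ideal]) (auto simp: Lefschetz_mod_def)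
  then show "full_rank_mod l (Idl\<^bsub>S_ring l\<^esub> (GL_act l g ` I \<union> set (take i (map (GL_act l g) fs)))) (map (GL_act l g) fs ! i) s d"
    using i by (simp add: GL_act_genideal[OF g X] image_Un take_map)
qed

text \<open>\<open>f ^ s - f' ^ s\<close> is a multiple of \<open>f - f'\<close>, so both powers act
  alike modulo \<open>K\<close>.\<close>

lemma full_rank_mod_cong:
  assumes K: "ideal K (S_ring l)" and f: "f \<in> S_deg l 1" and f': "f' \<in> S_deg l 1"
    and diff: "f - f' \<in> K" and FR: "full_rank_mod l K f s d"
  shows "full_rank_mod l K f' s d"
proof -
  note p = S_degD[OF f] S_degD[OF f']
  have pow: "f ^ s - f' ^ s \<in> K"
  proof -
    have "f ^ s - f' ^ s = (\<Sum>i<s. f ^ i * f' ^ (s - Suc i)) * (f - f')"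
      using power_diff_sumr2[of f s f'] by (simp add: mult.commute)
    also have "\<dots> \<in> K"
      by (intro ideal_mult[OF K _ diff] polys_in_sum polys_in_mult polys_in_power p)
    finally show ?thesis .
  qed
  have x: "f ^ s * x - f' ^ s * x \<in> K" if "x \<in> S_deg l d" for x
    using ideal_mult[OF K S_degD[OF that] pow] by (simp add: algebra_simps)
  have 1: "f ^ s * x \<in> K" if "x \<in> S_deg l d" "f' ^ s * x \<in> K" for x
    using ideal_add[OF K x[OF that(1)] that(2)] by simp
  have 2: "y - f' ^ s * x \<in> K" if "x \<in> S_deg l d" "y - f ^ s * x \<in> K" for x y
    using ideal_add[OF K that(2) x[OF that(1)]] by simp
  show ?thesis using FR 1 2 unfolding full_rank_mod_def by meson
qed

section \<open>Linear forms and elementary coordinate changes\<close>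

abbreviation lin_coeff :: "(nat, 'a::field) mpoly \<Rightarrow> nat \<Rightarrow> 'a" where
  "lin_coeff f i \<equiv> lookup f (single i 1)"

lemma Mon_1: "Mon l 1 = (\<lambda>i. single i 1) ` {..<l}"
proof
  show "Mon l 1 \<subseteq> (\<lambda>i. single i 1) ` {..<l}"
  proof
    fix m assume m: "m \<in> Mon l 1"
    then have "mdeg m = 1" by (simp add: Mon_def)
    then have "m \<noteq> 0" by auto
    then obtain i where i: "i \<in> keys m" by (metis equals0I keys_eq_empty)
    then have li: "1 \<le> lookup m i" by (simp add: in_keys_iff)
    have "m = single i 1 + (m - single i 1)"
      using li by (intro poly_mapping_eqI) (auto simp: lookup_add lookup_minus lookup_single when_def)
    moreover from this have "mdeg (m - single i 1) = 0"
      using \<open>mdeg m = 1\<close> mdeg_add[of "single i 1" "m - single i 1"] by simp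
    ultimately have "m = single i 1" by (simp add: mdeg_eq_0_iff)
    then show "m \<in> (\<lambda>i. single i 1) ` {..<l}" using m i by (auto simp: Mon_def)
  qed
qed (auto simp: Mon_def)

lemma single_index_eq [simp]: "single i (Suc 0) = single j (Suc 0) \<longleftrightarrow> i = j"
proof
  assume "single i (Suc 0) = single j (Suc 0)"
  then have "keys (single i (Suc 0)) = keys (single j (Suc 0))" by simp
  then show "i = j" by simp
qed simp

lemma linear_form_eq:
  fixes f :: "(nat, 'a::field) mpoly"
  assumes "f \<in> S_deg l 1"
  shows "f = (\<Sum>i<l. const (lin_coeff f i) * var i)"
proof -
  have "f = (\<Sum>m\<in>Mon l 1. single m (lookup f m))"
    using assms by (intro sum_single_lookup) (auto simp: finite_Mon S_deg_iff_keys)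
  also have "\<dots> = (\<Sum>i<l. single (single i 1) (lin_coeff f i))"
    unfolding Mon_1 by (subst sum.reindex) (auto intro!: inj_onI)
  finally show ?thesis by (simp add: const_def var_def mult_single)
qed

text \<open>\<open>g\<close> is the identity matrix with column \<open>q\<close> replaced by the
  coefficients of \<open>w\<close>. If \<open>g\<close> kills a vector \<open>u\<close>, row
  \<open>q\<close> gives \<open>u $ q = 0\<close>, and then row \<open>i\<close> gives
  \<open>u $ i = 0\<close>.\<close>

lemma GL_elementary:
  fixes w :: "(nat, 'a::field) mpoly"
  assumes w: "w \<in> S_deg l 1" and q: "q < l" and nz: "lin_coeff w q \<noteq> 0"
  obtains g where "g \<in> GL l" and "GL_act l g (var q) = w"
    and "\<And>j. j < l \<Longrightarrow> j \<noteq> q \<Longrightarrow> GL_act l g (var j) = var j"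
proof -
  define g where "g = mat l l (\<lambda>(i, j). if j = q then lin_coeff w i else if i = j then 1 else 0)"
  have gc: "g \<in> carrier_mat l l" by (simp add: g_def)
  have ent: "g $$ (i, j) = (if j = q then lin_coeff w i else if i = j then 1 else 0)" if "i < l" "j < l" for i j
    using that by (simp add: g_def)
  have "det g \<noteq> 0"
  proof
    assume "det g = 0"
    then obtain u where u: "u \<in> carrier_vec l" "u \<noteq> 0\<^sub>v l" "g *\<^sub>v u = 0\<^sub>v l"
      using det_0_iff_vec_prod_zero_field[OF gc] by blast
    have row: "(\<Sum>j<l. g $$ (i, j) * u $ j) = 0" if "i < l" for i
    proof -
      have "(g *\<^sub>v u) $ i = 0" using u(3) that by simp
      then show ?thesis using that gc u(1) by (simp add: scalar_prod_def atLeast0LessThan)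
    qed
    have row': "(\<Sum>j<l. g $$ (i, j) * u $ j) = (\<Sum>j<l. if j = q then lin_coeff w i * u $ q else 0) + (\<Sum>j<l. if j = i \<and> i \<noteq> q then u $ i else 0)" if "i < l" for i
      unfolding sum.distrib[symmetric] by (rule sum.cong) (use that in \<open>auto simp: ent\<close>)
    have "lin_coeff w q * u $ q = 0" using row[OF q] row'[OF q] q by simp
    then have uq: "u $ q = 0" using nz by simp
    have "u $ i = 0" if "i < l" for i
      using row[OF that] row'[OF that] that uq q by (cases "i = q") auto
    then show False using u(1,2) by (metis carrier_vecD eq_vecI index_zero_vec)
  qed
  then have "g \<in> GL l" using GL_det_iff[OF gc] by blast
  moreover have "GL_act l g (var q) = w"
  proof -
    have "GL_act l g (var q) = (\<Sum>i<l. const (lin_coeff w i) * var i)"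
      unfolding GL_act_var by (rule sum.cong) (use q in \<open>auto simp: ent\<close>)
    then show ?thesis using linear_form_eq[OF w] by simp
  qed
  moreover have "GL_act l g (var j) = var j" if j: "j < l" "j \<noteq> q" for j
  proof -
    have "GL_act l g (var j) = (\<Sum>i<l. if i = j then var j else 0)"
      unfolding GL_act_var by (rule sum.cong) (use j in \<open>auto simp: ent\<close>)
    then show ?thesis using j by simp
  qed
  ultimately show ?thesis using that by blast
qed

text \<open>If \<open>var p\<close> occurs in \<open>v\<close>, the inverse of an elementary change
  works. Otherwise \<open>var a\<close> with \<open>a < p\<close> occurs, and sending it to
  \<open>var a + var p\<close> makes \<open>var p\<close> occur. Neither map moves a variable after
  \<open>var p\<close>.\<close>

lemma GL_move_to_var:
  fixes v :: "(nat, 'a::field) mpoly"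
  assumes v: "v \<in> S_deg l 1" and p: "p < l" and nz: "\<exists>a\<le>p. lin_coeff v a \<noteq> 0"
  shows "\<exists>h\<in>GL l. GL_act l h v = var p \<and> (\<forall>j<l. p < j \<longrightarrow> GL_act l h (var j) = var j)"
proof -
  have A: "\<exists>h\<in>GL l. GL_act l h w = var p \<and> (\<forall>j<l. p < j \<longrightarrow> GL_act l h (var j) = var j)"
    if w: "w \<in> S_deg l 1" "lin_coeff w p \<noteq> 0" for w :: "(nat, 'a) mpoly"
  proof -
    obtain g where g: "g \<in> GL l" "GL_act l g (var p) = w" "\<And>j. j < l \<Longrightarrow> j \<noteq> p \<Longrightarrow> GL_act l g (var j) = var j"
      by (rule GL_elementary[OF w(1) p w(2)]) blast
    obtain h where h: "h \<in> GL l" "h * g = 1\<^sub>m l" using GL_inverse[OF g(1)] by metis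
    have hg: "GL_act l h (GL_act l g (var j)) = var j" if "j < l" for j
      using that by (intro GL_act_inverse[OF h(1) g(1) h(2)] polys_in_var) auto
    have "GL_act l h w = var p" using hg[OF p] g(2) by simp
    moreover have "GL_act l h (var j) = var j" if "j < l" "p < j" for j
      using hg[OF that(1)] g(3)[OF that(1)] that(2) by simp
    ultimately show ?thesis using h(1) by blast
  qed
  show ?thesis
  proof (cases "lin_coeff v p = 0")
    case False
    then show ?thesis using A[OF v] by blast
  next
    case True
    then obtain a where a: "a < p" "lin_coeff v a \<noteq> 0" using nz by (metis le_less)
    have al: "a < l" using a p by simp
    have "lin_coeff (var a + var p :: (nat, 'a) mpoly) a \<noteq> 0"
      using a(1) by (simp add: var_def lookup_add lookup_single when_def)
    moreover have "var a + var p \<in> (S_deg l 1 :: (nat, 'a) mpoly set)"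
      using al p by (intro S_deg_add S_deg_var)
    ultimately obtain g where g: "g \<in> GL l" "GL_act l g (var a) = (var a + var p :: (nat, 'a) mpoly)"
      "\<And>j. j < l \<Longrightarrow> j \<noteq> a \<Longrightarrow> GL_act l g (var j) = (var j :: (nat, 'a) mpoly)"
      using GL_elementary[OF _ al] by metis
    have "GL_act l g v = (\<Sum>i<l. const (lin_coeff v i) * GL_act l g (var i))"
      by (subst linear_form_eq[OF v]) (simp add: GL_act_sum GL_act.hom_mult)
    also have "\<dots> = (\<Sum>i<l. const (lin_coeff v i) * var i + (if i = a then const (lin_coeff v a) * var p else 0))"
      by (rule sum.cong) (use g(2,3) in \<open>auto simp: distrib_left\<close>)
    also have "\<dots> = v + const (lin_coeff v a) * var p"
      using al linear_form_eq[OF v] by (simp add: sum.distrib)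
    finally have "lin_coeff (GL_act l g v) p \<noteq> 0"
      using a(2) True by (simp add: lookup_add var_def)
    then obtain h where h: "h \<in> GL l" "GL_act l h (GL_act l g v) = var p"
      "\<And>j. j < l \<Longrightarrow> p < j \<Longrightarrow> GL_act l h (var j) = (var j :: (nat, 'a) mpoly)"
      using A[OF GL_act_S_deg[OF v]] by blast
    have hg: "GL_act l (h * g) x = GL_act l h (GL_act l g x)" if "x \<in> polys_in {..<l}" for x
      using GL_act_mult[OF GL_carrier[OF h(1)] GL_carrier[OF g(1)] that] by simp
    have "GL_act l (h * g) v = var p" using hg[OF S_degD[OF v]] h(2) by simp
    moreover have "GL_act l (h * g) (var j) = var j" if "j < l" "p < j" for j
      using that hg[OF polys_in_var, of j] g(3)[of j] h(3)[of j] a(1) by simp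
    ultimately show ?thesis using GL_mult[OF h(1) g(1)] by blast
  qed
qed

text \<open>Induction on the number \<open>j\<close> of forms already equal to the last variables,
  with \<open>K j\<close> the ideal of the predecessors. Outside \<open>K j\<close>, the next form
  involves a variable up to \<open>?p\<close>, and \<open>GL_move_to_var\<close> moves it while
  fixing the variables already placed. Inside \<open>K j\<close>, it is exchanged for
  \<open>var ?p\<close> without a change of coordinates.\<close>

lemma Lefschetz_mod_move_to_vars:
  fixes I :: "(nat, 'a::field) mpoly set"
  assumes I: "ideal I (S_ring l)" and k: "length fs \<le> l" and fs: "set fs \<subseteq> S_deg l 1"
    and LP: "Lefschetz_mod l A I fs" and A: "1 \<in> A" and j: "j \<le> length fs"
  shows "\<exists>g\<in>GL l. \<exists>fs'. length fs' = length fs \<and> set fs' \<subseteq> S_deg l 1 \<and> Lefschetz_mod l A (GL_act l g ` I) fs' \<and>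
    (\<forall>i<j. fs' ! i = var (l - Suc i))"
  using j
proof (induction j)
  case 0
  have "GL_act l (1\<^sub>m l) ` I = I"
    using GL_act_one[OF ideal_polys_in[OF I]] by simp
  then show ?case using GL_one fs LP by (intro bexI[of _ "1\<^sub>m l"] exI[of _ fs]) auto
next
  case (Suc j)
  then obtain g fs' where g: "g \<in> GL l" and fs': "length fs' = length fs" "set fs' \<subseteq> S_deg l 1"
    and LP': "Lefschetz_mod l A (GL_act l g ` I) fs'" and vars: "\<And>i. i < j \<Longrightarrow> fs' ! i = var (l - Suc i)" by auto
  define I' where "I' = GL_act l g ` I"
  have I': "ideal I' (S_ring l)" unfolding I'_def by (rule ideal_GL_act[OF I g])
  have jk: "j < length fs'" "j < l" using Suc.prems fs'(1) k by auto
  let ?v = "fs' ! j" and ?p = "l - Suc j"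
  have v: "?v \<in> S_deg l 1" using fs' jk by auto
  have p: "?p < l" using jk by simp
  define K where "K i = Idl\<^bsub>S_ring l\<^esub> (I' \<union> set (take i fs'))" for i
  have sub: "I' \<union> set (take i xs) \<subseteq> polys_in {..<l}" if "set xs \<subseteq> S_deg l 1" for i and xs :: "(nat, 'a) mpoly list"
    using ideal_polys_in[OF I'] that S_degD set_take_subset[of i xs] by blast
  have K: "ideal (K i) (S_ring l)" "I' \<union> set (take i fs') \<subseteq> K i" for i
  proof -
    have s: "I' \<union> set (take i fs') \<subseteq> carrier (S_ring l)" using sub[OF fs'(2)] by simp
    show "ideal (K i) (S_ring l)" "I' \<union> set (take i fs') \<subseteq> K i"
      unfolding K_def using S.genideal_ideal[OF s] S.genideal_self[OF s] .
  qed
  have FR: "full_rank_mod l (K i) (fs' ! i) s d" if "i < length fs'" "s \<in> A" for i s d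
    using LP' that unfolding Lefschetz_mod_def K_def I'_def by blast
  show ?case
  proof (cases "?v \<in> K j")
    case True
    \<comment> \<open>The case of exponent 1 and degree 0: multiplication by \<open>?v\<close> is
      zero modulo \<open>K j\<close>, so injectivity puts 1 into \<open>K j\<close> and surjectivity
      puts every linear form there.\<close>
    have S1: "y \<in> K j" if y: "y \<in> S_deg l 1" for y
    proof -
      consider "\<forall>x\<in>S_deg l 0. ?v * x \<in> K j \<longrightarrow> x \<in> K j" | "\<forall>y\<in>S_deg l 1. \<exists>x\<in>S_deg l 0. y - ?v * x \<in> K j"
        using FR[OF jk(1) A, of 0] unfolding full_rank_mod_def by auto
      then show ?thesis
      proof cases
        case 1
        then have "1 \<in> K j" using True S_deg_1[of l] by (metis mult.right_neutral)
        then show ?thesis using ideal_mult[OF K(1) S_degD[OF y]] by (metis mult.right_neutral)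
      next
        case 2
        then obtain x where x: "x \<in> S_deg l 0" "y - ?v * x \<in> K j" using y by blast
        have "?v * x \<in> K j"
          using ideal_mult[OF K(1) S_degD[OF x(1)] True] by (simp add: mult.commute)
        from ideal_add[OF K(1) x(2) this] show ?thesis by simp
      qed
    qed
    have vp: "var ?p \<in> S_deg l 1" using p by (rule S_deg_var)
    define fs'' where "fs'' = fs'[j := var ?p]"
    have fs'': "length fs'' = length fs" "set fs'' \<subseteq> S_deg l 1"
      using fs' vp set_update_subset_insert[of fs' j "var ?p"] by (auto simp: fs''_def)
    have mono: "K j \<subseteq> Idl\<^bsub>S_ring l\<^esub> (I' \<union> set (take i xs))"
      if "set xs \<subseteq> S_deg l 1" "j \<le> i" "take j xs = take j fs'" for i xs
    proof -
      have "set (take j fs') \<subseteq> set (take i xs)"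
        unfolding that(3)[symmetric] using set_take_subset_set_take[OF that(2)] .
      then show ?thesis unfolding K_def using sub[OF that(1), of i] by (intro S.subset_Idl_subset) auto
    qed
    \<comment> \<open>Ideals for \<open>i > j\<close> contain \<open>K j\<close>, hence both the old
      and the new entry; \<open>gen\<close> is applied in both directions of the exchange.\<close>
    have Keq: "Idl\<^bsub>S_ring l\<^esub> (I' \<union> set (take i fs'')) = K i" for i
    proof (cases "i \<le> j")
      case True
      then have "take i fs'' = take i fs'" by (simp add: fs''_def)
      then show ?thesis by (simp add: K_def)
    next
      case False
      have gen: "Idl\<^bsub>S_ring l\<^esub> (I' \<union> set (take i xs)) \<subseteq> Idl\<^bsub>S_ring l\<^esub> (I' \<union> set (take i ys))"
        if xs: "xs = ys[j := a]" and a: "a \<in> S_deg l 1" and ys: "set ys \<subseteq> S_deg l 1" "take j ys = take j fs'"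
        for xs ys and a :: "(nat, 'a) mpoly"
      proof (rule S.genideal_minimal)
        have s: "I' \<union> set (take i ys) \<subseteq> carrier (S_ring l)" using sub[OF ys(1)] by simp
        show "ideal (Idl\<^bsub>S_ring l\<^esub> (I' \<union> set (take i ys))) (S_ring l)" by (rule S.genideal_ideal[OF s])
        have "a \<in> Idl\<^bsub>S_ring l\<^esub> (I' \<union> set (take i ys))" using mono[OF ys(1) _ ys(2), of i] S1[OF a] False by auto
        moreover have "set (take i xs) \<subseteq> insert a (set (take i ys))"
          using set_update_subset_insert[of "take i ys" j a] by (simp add: xs take_update_swap)
        ultimately show "I' \<union> set (take i xs) \<subseteq> Idl\<^bsub>S_ring l\<^esub> (I' \<union> set (take i ys))"
          using S.genideal_self[OF s] by blast
      qed
      have "fs' = fs''[j := ?v]" by (simp add: fs''_def)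
      then show ?thesis
        unfolding K_def using gen[of fs'' fs' "var ?p"] gen[of fs' fs'' ?v] vp v fs' fs''
        by (intro subset_antisym) (auto simp: fs''_def)
    qed
    have "Lefschetz_mod l A I' fs''"
      unfolding Lefschetz_mod_def Keq
    proof (intro allI impI ballI)
      fix i s d assume i: "i < length fs''" and s: "s \<in> A"
      show "full_rank_mod l (K i) (fs'' ! i) s d"
      proof (cases "i = j")
        case True
        have "full_rank_mod l (K j) (var ?p) s d"
          using ideal_diff[OF K(1) S1[OF v] S1[OF vp]] by (rule full_rank_mod_cong[OF K(1) v vp _ FR[OF jk(1) s]])
        then show ?thesis using True jk by (simp add: fs''_def)
      next
        case False
        then show ?thesis using FR[of i s d] i s fs' by (simp add: fs''_def)
      qed
    qed
    moreover have "fs'' ! i = var (l - Suc i)" if "i < Suc j" for i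
      using that vars jk by (cases "i = j") (auto simp: fs''_def)
    ultimately show ?thesis using g fs'' unfolding I'_def by blast
  next
    case False
    have "\<exists>a\<le>?p. lin_coeff ?v a \<noteq> 0"
    proof (rule ccontr)
      assume H: "\<not> ?thesis"
      have "const (lin_coeff ?v a) * var a \<in> K j" if a: "a < l" for a
      proof (cases "a \<le> ?p")
        case True
        then show ?thesis using H ideal_0[OF K(1)] by simp
      next
        case False
        \<comment> \<open>The list runs backwards: \<open>var a\<close> with \<open>a > ?p\<close>
          is entry \<open>l - Suc a\<close>, one of the \<open>j\<close> entries already
          placed.\<close>
        then have i: "l - Suc a < j" "l - Suc (l - Suc a) = a" using a jk by auto
        then have "take j fs' ! (l - Suc a) = var a" using vars[OF i(1)] by simp
        then have "var a \<in> set (take j fs')" using i(1) jk(1) nth_mem[of "l - Suc a" "take j fs'"] by simp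
        then show ?thesis using K(2) by (intro ideal_mult[OF K(1)]) auto
      qed
      then have "?v \<in> K j" by (subst linear_form_eq[OF v]) (auto intro: ideal_sum[OF K(1)])
      then show False using \<open>?v \<notin> K j\<close> by simp
    qed
    from GL_move_to_var[OF v p this] obtain h where h: "h \<in> GL l" "GL_act l h ?v = var ?p"
      "\<And>j. j < l \<Longrightarrow> ?p < j \<Longrightarrow> GL_act l h (var j) = (var j :: (nat, 'a) mpoly)" by blast
    have LP'': "Lefschetz_mod l A (GL_act l h ` I') (map (GL_act l h) fs')"
      using LP' by (intro Lefschetz_mod_GL_act[OF h(1) I' fs'(2)]) (simp add: I'_def)
    have hg: "GL_act l h ` I' = GL_act l (h * g) ` I"
      unfolding I'_def image_image
      by (rule image_cong[OF refl GL_act_mult[OF GL_carrier[OF h(1)] GL_carrier[OF g] ideal_polys_in[OF I]]])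
    have "map (GL_act l h) fs' ! i = var (l - Suc i)" if i: "i < Suc j" for i
    proof (cases "i = j")
      case True
      then show ?thesis using h(2) jk by simp
    next
      case False
      then have "i < j" using i by simp
      then show ?thesis using h(3)[of "l - Suc i"] vars[of i] jk by simp
    qed
    moreover have "set (map (GL_act l h) fs') \<subseteq> S_deg l 1"     proof
      fix x assume "x \<in> set (map (GL_act l h) fs')"
      then obtain y where "y \<in> set fs'" "x = GL_act l h y" by auto
      then show "x \<in> S_deg l 1" using fs'(2) GL_act_S_deg[of y l 1 h] by blast
    qed
    ultimately show ?thesis
      using LP'' fs'(1) GL_mult[OF h(1) g] unfolding hg
      by (intro bexI[of _ "h * g"] exI[of _ "map (GL_act l h) fs'"]) auto
  qed
qed

lemma Lefschetz_mod_vars: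
  fixes I :: "(nat, 'a::field) mpoly set"
  assumes I: "ideal I (S_ring l)" and k: "length fs \<le> l" and fs: "set fs \<subseteq> S_deg l 1"
    and LP: "Lefschetz_mod l A I fs" and A: "1 \<in> A"
  shows "\<exists>g\<in>GL l. Lefschetz_mod l A (GL_act l g ` I) (map var (rev [l - length fs..<l]))"
proof -
  obtain g fs' where g: "g \<in> GL l" and fs': "length fs' = length fs" "Lefschetz_mod l A (GL_act l g ` I) fs'"
    "\<And>i. i < length fs \<Longrightarrow> fs' ! i = var (l - Suc i)"
    using Lefschetz_mod_move_to_vars[OF assms order.refl] by blast
  have "fs' = map var (rev [l - length fs..<l])"
    by (rule nth_equalityI) (use fs' k in \<open>auto simp: rev_nth\<close>)
  then show ?thesis using g fs'(2) by auto
qed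

section \<open>Reverse lexicographic leading monomials modulo the last variables\<close>

text \<open>The monomials of degree \<open>e\<close> outside the ideal generated by
  \<open>var p ^ s\<close> and the later variables. With \<open>Suc p\<close> and \<open>1\<close>
  in place of \<open>p\<close> and \<open>s\<close>, \<open>var p\<close> is left free: this is the
  stage before \<open>var p ^ s\<close> is added. The values \<open>p = l\<close> and
  \<open>s = 1\<close> give all of \<open>Mon l e\<close>.\<close>

definition mons_below :: "nat \<Rightarrow> nat \<Rightarrow> nat \<Rightarrow> nat \<Rightarrow> nat monomial set" where
  "mons_below l p s e = {m \<in> Mon l e. keys m \<subseteq> {..<Suc p} \<and> lookup m p < s}"

text \<open>At the last position where they differ, \<open>n\<close> has the larger exponent: at
  \<open>p\<close> if \<open>n\<close> has no later variable, as then
  \<open>lookup n p \<ge> s\<close>; otherwise at the last variable of \<open>n\<close>, which does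
  not occur in \<open>m\<close>.\<close>

lemma degrevlex_less_mons_below:
  assumes m: "m \<in> mons_below l p s e" and n: "n \<in> Mon l e" "n \<notin> mons_below l p s e"
  shows "degrevlex_less n m"
proof -
  have m': "keys m \<subseteq> {..<Suc p}" "lookup m p < s" "mdeg m = mdeg n"
    using m n(1) by (auto simp: mons_below_def Mon_def)
  have m0: "lookup m i = 0" if "p < i" for i using m'(1) that by (auto simp: in_keys_iff subset_iff)
  show ?thesis
  proof (cases "keys n \<subseteq> {..<Suc p}")
    case True
    then have "lookup m p < lookup n p" using n m' by (auto simp: mons_below_def)
    moreover have "lookup n i = lookup m i" if "p < i" for i
      using m0[OF that] True that by (auto simp: in_keys_iff subset_iff)
    ultimately show ?thesis using m'(3) unfolding degrevlex_less_def by auto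
  next
    case False
    then have ne: "keys n \<noteq> {}" and ex: "\<exists>i\<in>keys n. p < i"
      by (auto simp: subset_iff not_less Suc_le_eq)
    define j where "j = Max (keys n)"
    have "j \<in> keys n" using ne Max_in[of "keys n"] by (simp add: j_def)
    moreover obtain i where "i \<in> keys n" "p < i" using ex by blast
    moreover from this have "i \<le> j" by (simp add: j_def)
    ultimately have j: "j \<in> keys n" "p < j" by auto
    have "lookup m j < lookup n j" using j m0[of j] by (simp add: in_keys_iff)
    moreover have "lookup n i = lookup m i" if "j < i" for i
    proof -
      have "i \<notin> keys n"
      proof
        assume "i \<in> keys n"
        then have "i \<le> j" by (simp add: j_def)
        then show False using that by simp
      qed
      then show ?thesis using m0[of i] that j(2) by (simp add: in_keys_iff)
    qed
    ultimately show ?thesis using m'(3) unfolding degrevlex_less_def by auto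
  qed
qed

lemma upset_mons_below: "upset l e (mons_below l p s e)"
proof -
  have "n \<in> mons_below l p s e" if "m \<in> mons_below l p s e" "n \<in> Mon l e" "degrevlex_less m n" for m n
    using degrevlex_less_mons_below[OF that(1,2)] degrevlex_asym[OF that(3)] by blast
  moreover have "mons_below l p s e \<subseteq> Mon l e" by (auto simp: mons_below_def)
  ultimately show ?thesis unfolding upset_def by blast
qed

text \<open>The key property of the reverse lexicographic order: modulo the monomials outside of
  \<open>mons_below\<close>, a homogeneous polynomial either vanishes or keeps its leading monomial.\<close>

lemma LMs_plus_mon_span:
  fixes V :: "(nat, 'a::field) mpoly set"
  assumes V: "mp.subspace V" "V \<subseteq> S_deg l e"
    and W: "W = {a + b |a b. a \<in> V \<and> b \<in> mon_span (Mon l e - mons_below l p s e)}"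
  shows "Mon l e - LMs W = mons_below l p s e - LMs V"
proof -
  let ?N = "Mon l e - mons_below l p s e"
  have "m \<in> LMs W \<longleftrightarrow> m \<in> ?N \<or> m \<in> LMs V" if m: "m \<in> Mon l e" for m
  proof
    assume "m \<in> LMs W"
    then obtain f where f: "f \<in> W" "f \<noteq> 0" "m = lead_monomial f" by (auto simp: LMs_def)
    then obtain a b where ab: "a \<in> V" "keys b \<subseteq> ?N" "f = a + b" by (auto simp: W mon_span_def)
    show "m \<in> ?N \<or> m \<in> LMs V"
    proof (cases "m \<in> ?N")
      case False
      then have mb: "m \<in> mons_below l p s e" using m by simp
      have "lookup b m = 0" using ab(2) False by (auto simp: in_keys_iff)
      moreover have "lookup f m \<noteq> 0"
        using lead_monomial_in_keys[OF f(2)] unfolding f(3)[symmetric] in_keys_iff .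
      ultimately have ma: "m \<in> keys a" by (simp add: ab(3) in_keys_iff lookup_add)
      \<comment> \<open>Adding \<open>b\<close> can cancel terms of \<open>a\<close> only outside
        \<open>mons_below\<close>, and all monomials there are smaller than
        \<open>m\<close>.\<close>
      have "lead_monomial a = m"
      proof (rule lead_monomial_eqI[OF ma])
        fix n assume n: "n \<in> keys a" "n \<noteq> m"
        show "degrevlex_less n m"
        proof (cases "n \<in> keys b")
          case True
          then show ?thesis using ab(2) degrevlex_less_mons_below[OF mb] by auto
        next
          case False
          then have "n \<in> keys f" using n(1) by (simp add: ab(3) in_keys_iff lookup_add)
          then show ?thesis using lead_monomial_greatest[OF f(2)] n(2) f(3) by simp
        qed
      qed
      moreover have "a \<noteq> 0" using ma by auto
      ultimately show ?thesis using LMsI[OF ab(1)] by blast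
    qed simp
  next
    assume "m \<in> ?N \<or> m \<in> LMs V"
    then show "m \<in> LMs W"
    proof
      assume "m \<in> ?N"
      then have "m \<in> LMs (mon_span ?N :: (nat, 'a) mpoly set)" by (simp add: LMs_mon_span)
      moreover have "mon_span ?N \<subseteq> W"
      proof
        fix b :: "(nat, 'a) mpoly" assume "b \<in> mon_span ?N"
        then have "0 + b \<in> W" unfolding W using mp.subspace_0[OF V(1)] by blast
        then show "b \<in> W" by simp
      qed
      ultimately show ?thesis using LMs_mono by blast
    next
      assume "m \<in> LMs V"
      moreover have "V \<subseteq> W"
      proof
        fix a assume "a \<in> V"
        moreover have "(0 :: (nat, 'a) mpoly) \<in> mon_span ?N" by (simp add: mon_span_def)
        ultimately have "a + 0 \<in> W" unfolding W by blast
        then show "a \<in> W" by simp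
      qed
      ultimately show ?thesis using LMs_mono by blast
    qed
  qed
  moreover have "LMs V \<subseteq> Mon l e" "mons_below l p s e \<subseteq> Mon l e"
    using LMs_subset_Mon[OF V(2)] by (auto simp: mons_below_def)
  ultimately show ?thesis by blast
qed

text \<open>The variables from \<open>q\<close> on generate the span of the monomials that contain
  one of them, and \<open>K\<close> is \<open>I\<close> plus this span. Both summands are graded, so
  the degree \<open>e\<close> part can be taken in each of them.\<close>

lemma genideal_plus_vars:
  fixes I :: "(nat, 'a::field) mpoly set"
  assumes I: "graded_ideal l I" and q: "q \<le> l"
  defines "K \<equiv> Idl\<^bsub>S_ring l\<^esub> (I \<union> var ` {q..<l})"
  shows "ideal K (S_ring l)"
    and "K \<inter> S_deg l e = {a + b |a b. a \<in> I \<inter> S_deg l e \<and> b \<in> mon_span (Mon l e - {m. keys m \<subseteq> {..<q}})}"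
proof -
  note id = graded_ideal_ideal[OF I]
  have gens: "I \<union> var ` {q..<l} \<subseteq> carrier (S_ring l)"
    using ideal_polys_in[OF id] polys_in_var by (auto intro!: polys_in_var)
  show K: "ideal K (S_ring l)" unfolding K_def by (rule S.genideal_ideal[OF gens])
  have IK: "I \<subseteq> K" "var ` {q..<l} \<subseteq> K" using S.genideal_self[OF gens] by (auto simp: K_def)
  define N where "N = mons l - {m. keys m \<subseteq> {..<q}}"
  have N: "ideal (mon_span N) (S_ring l :: (nat, 'a) mpoly ring)"
    by (rule graded_ideal_ideal[OF graded_ideal_mon_span]) (auto simp: N_def mons_def)
  have mK: "single m c \<in> K" if m: "m \<in> N" for m c
  proof -
    obtain j where j: "j \<in> keys m" "j \<in> {q..<l}" using m by (force simp: N_def mons_def)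
    have "m = (m - single j 1) + single j 1"
      using j(1) by (intro poly_mapping_eqI) (auto simp: lookup_add lookup_minus lookup_single when_def in_keys_iff)
    then have "single m c = single (m - single j 1) c * var j"
      by (simp add: var_def mult_single)
    moreover have "single (m - single j 1) c \<in> polys_in {..<l}"
      using m by (intro polys_in_single) (auto simp: N_def mons_def in_keys_iff lookup_minus subset_iff)
    moreover have "var j \<in> K" using IK(2) j(2) by blast
    ultimately show ?thesis using ideal_mult[OF K] by metis
  qed
  have NK: "b \<in> K" if "keys b \<subseteq> N" for b
    using ideal_sum[OF K, of "keys b" "\<lambda>m. single m (lookup b m)"] mK that sum_single_lookup[of "keys b" b] by auto
  define P where "P = {a + b |a b. a \<in> I \<and> b \<in> mon_span N}"
  have "ideal P (S_ring l)"
    unfolding ideal_S_ring_iff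
  proof (intro conjI ballI)
    show "P \<subseteq> polys_in {..<l}"
      using ideal_polys_in[OF id] ideal_polys_in[OF N] by (auto simp: P_def intro!: polys_in_add)
    show "0 \<in> P" using ideal_0[OF id] ideal_0[OF N] unfolding P_def by (metis (mono_tags, lifting) add.right_neutral mem_Collect_eq)
    fix x y assume "x \<in> P" "y \<in> P"
    then obtain a b c d where "a \<in> I" "b \<in> mon_span N" "c \<in> I" "d \<in> mon_span N" "x = a + b" "y = c + d"
      unfolding P_def by blast
    then have "x + y = (a + c) + (b + d)" "a + c \<in> I" "b + d \<in> mon_span N"
      using ideal_add[OF id] ideal_add[OF N] by auto
    then show "x + y \<in> P" unfolding P_def by blast
  next
    fix r x :: "(nat, 'a) mpoly" assume r: "r \<in> polys_in {..<l}" and "x \<in> P"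
    then obtain a b where "a \<in> I" "b \<in> mon_span N" "x = a + b" unfolding P_def by blast
    then have "r * x = r * a + r * b" "r * a \<in> I" "r * b \<in> mon_span N"
      using ideal_mult[OF id r] ideal_mult[OF N r] by (auto simp: distrib_left)
    then show "r * x \<in> P" unfolding P_def by blast
  qed
  moreover have "I \<union> var ` {q..<l} \<subseteq> P"
  proof
    fix x assume "x \<in> I \<union> var ` {q..<l}"
    then have "x + 0 \<in> P \<or> 0 + x \<in> P"
    proof
      assume "x \<in> I"
      then have "x + 0 \<in> P" unfolding P_def using ideal_0[OF N] by blast
      then show ?thesis ..
    next
      assume "x \<in> var ` {q..<l}"
      then have "x \<in> mon_span N" by (auto simp: mon_span_def N_def mons_def var_def)
      then have "0 + x \<in> P" unfolding P_def using ideal_0[OF id] by blast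
      then show ?thesis ..
    qed
    then show "x \<in> P" by simp
  qed
  ultimately have KP: "K \<subseteq> P" unfolding K_def by (rule S.genideal_minimal)
  show "K \<inter> S_deg l e = {a + b |a b. a \<in> I \<inter> S_deg l e \<and> b \<in> mon_span (Mon l e - {m. keys m \<subseteq> {..<q}})}"
    (is "_ = ?R")
  proof
    show "K \<inter> S_deg l e \<subseteq> ?R"
    proof
      fix x assume x: "x \<in> K \<inter> S_deg l e"
      then obtain a b where ab: "a \<in> I" "keys b \<subseteq> N" "x = a + b"
        using KP by (auto simp: P_def mon_span_def)
      have "x = hcomp e a + hcomp e b"
        using hcomp_of_S_deg[of x l e e] x by (simp add: ab(3) restr_add)
      moreover have "hcomp e a \<in> I \<inter> S_deg l e"
        using graded_ideal_hcomp[OF I ab(1)] hcomp_S_deg ideal_polys_in[OF id ab(1)] by blast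
      moreover have "hcomp e b \<in> mon_span (Mon l e - {m. keys m \<subseteq> {..<q}})"
        using ab(2) by (auto simp: mon_span_def N_def mons_def Mon_def)
      ultimately show "x \<in> ?R" by blast
    qed
    show "?R \<subseteq> K \<inter> S_deg l e"
    proof
      fix x assume "x \<in> ?R"
      then obtain a b where ab: "a \<in> I \<inter> S_deg l e" "keys b \<subseteq> Mon l e - {m. keys m \<subseteq> {..<q}}" "x = a + b"
        by (auto simp: mon_span_def)
      have "keys b \<subseteq> N" using ab(2) by (auto simp: N_def Mon_def mons_def)
      then have "b \<in> K" by (rule NK)
      moreover have "b \<in> S_deg l e" using ab(2) by (auto simp: S_deg_iff_keys)
      moreover have "a \<in> K" using ab(1) IK(1) by auto
      ultimately show "x \<in> K \<inter> S_deg l e" using ab(1,3) ideal_add[OF K] S_deg_add by auto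
    qed
  qed
qed

lemma var_power: "var p ^ s = (single (single p s) 1 :: ('x, 'a::comm_ring_1) mpoly)"
  by (induction s) (auto simp: var_def mult_single single_add[symmetric])

lemma mons_below_1: "mons_below l q 1 e = {m \<in> Mon l e. keys m \<subseteq> {..<q}}"
proof -
  have "keys m \<subseteq> {..<Suc q} \<and> lookup m q < 1 \<longleftrightarrow> keys m \<subseteq> {..<q}" for m :: "nat monomial"
  proof -
    have "lookup m q < 1 \<longleftrightarrow> q \<notin> keys m" by (simp add: in_keys_iff)
    then show ?thesis by (auto simp: lessThan_Suc)
  qed
  then show ?thesis by (simp add: mons_below_def)
qed

text \<open>The number of standard monomials of degree \<open>e\<close> modulo the initial ideal with monomials \<open>L\<close>
  and modulo \<open>x\<^sub>p\<^sup>s\<close> and the variables after \<open>x\<^sub>p\<close>.\<close>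

definition std_count :: "nat \<Rightarrow> nat monomial set \<Rightarrow> nat \<Rightarrow> nat \<Rightarrow> nat \<Rightarrow> nat" where
  "std_count l L p s e = card (mons_below l p s e - L)"

text \<open>\<open>W\<close> is the degree \<open>d + s\<close> part of \<open>K\<close> plus the
  ideal of \<open>var p ^ s\<close>. Like the pieces of \<open>K\<close>, it is a piece of
  \<open>I\<close> plus the span of the monomials outside some \<open>mons_below\<close>, so
  \<open>LMs_plus_mon_span\<close> turns the numbers in \<open>full_rank_mod_iff_card\<close> into
  values of \<open>std_count\<close>.\<close>

lemma
  fixes I :: "(nat, 'a::field) mpoly set"
  assumes I: "graded_ideal l I" and p: "p < l"
  defines "K \<equiv> Idl\<^bsub>S_ring l\<^esub> (I \<union> var ` {Suc p..<l})" and "L \<equiv> LMs I"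
  shows full_rank_mod_var_iff: "full_rank_mod l K (var p) s d \<longleftrightarrow>
      std_count l L p s (d + s) = std_count l L (Suc p) 1 (d + s) - std_count l L (Suc p) 1 d" (is ?A)
    and std_count_ge: "std_count l L p s (d + s) \<ge>
      std_count l L (Suc p) 1 (d + s) - std_count l L (Suc p) 1 d" (is ?B)
proof -
  let ?f = "var p :: (nat, 'a) mpoly" and ?e = "d + s"
  note K = genideal_plus_vars[OF I, of "Suc p", folded K_def]
  have idK: "ideal K (S_ring l)" and Ke: "K \<inter> S_deg l e =
      {a + b |a b. a \<in> I \<inter> S_deg l e \<and> b \<in> mon_span (Mon l e - mons_below l (Suc p) 1 e)}" for e
  proof -
    have "Mon l e - {m. keys m \<subseteq> {..<Suc p}} = Mon l e - mons_below l (Suc p) 1 e" for e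
      unfolding mons_below_1 by blast
    then show "ideal K (S_ring l)" "K \<inter> S_deg l e =
      {a + b |a b. a \<in> I \<inter> S_deg l e \<and> b \<in> mon_span (Mon l e - mons_below l (Suc p) 1 e)}" for e
      using K p by auto
  qed
  have V: "mp.subspace (I \<inter> S_deg l e)" "I \<inter> S_deg l e \<subseteq> S_deg l e" for e
    by (auto intro: subspace_ideal_S_deg[OF graded_ideal_ideal[OF I]])
  have LI: "mons_below l r t e - LMs (I \<inter> S_deg l e) = mons_below l r t e - L" for r t e
    unfolding LMs_Int_Mon[OF I, symmetric] L_def by (auto simp: mons_below_def)
  have cK: "card (Mon l e - LMs (K \<inter> S_deg l e)) = std_count l L (Suc p) 1 e" for e
    unfolding std_count_def LMs_plus_mon_span[OF V Ke] LI ..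
  define W where "W = {?f ^ s * x + k |x k. x \<in> S_deg l d \<and> k \<in> K \<inter> S_deg l ?e}"
  have W: "W = {a + b |a b. a \<in> I \<inter> S_deg l ?e \<and> b \<in> mon_span (Mon l ?e - mons_below l p s ?e)}" (is "_ = ?R")
  proof
    show "W \<subseteq> ?R"
    proof
      fix y assume "y \<in> W"
      then obtain x k where xk: "x \<in> S_deg l d" "k \<in> K \<inter> S_deg l ?e" "y = ?f ^ s * x + k" unfolding W_def by blast
      obtain a b where ab: "a \<in> I \<inter> S_deg l ?e" "keys b \<subseteq> Mon l ?e - mons_below l (Suc p) 1 ?e" "k = a + b"
        using xk(2) unfolding Ke mon_span_def by blast
      have "m \<in> Mon l ?e - mons_below l p s ?e" if m: "m \<in> keys (?f ^ s * x)" for m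
      proof -
        obtain n where n: "n \<in> keys x" "m = single p s + n"
          using keys_single_mult_subset[of "single p s" 1 x] m by (auto simp: var_power)
        then show ?thesis using xk(1) p
          by (auto simp: mons_below_def S_deg_iff_keys Mon_def lookup_add subset_iff split: if_splits)
      qed
      moreover have "keys b \<subseteq> Mon l ?e - mons_below l p s ?e"
        using ab(2) unfolding mons_below_1 by (auto simp: mons_below_def)
      ultimately have "?f ^ s * x + b \<in> mon_span (Mon l ?e - mons_below l p s ?e)"
        using keys_add[of "?f ^ s * x" b] by (auto simp: mon_span_def)
      moreover have "y = a + (?f ^ s * x + b)" by (simp add: xk(3) ab(3))
      ultimately show "y \<in> ?R" using ab(1) by blast
    qed
    show "?R \<subseteq> W"
    proof
      fix y assume "y \<in> ?R"
      then obtain a b where ab: "a \<in> I \<inter> S_deg l ?e" "keys b \<subseteq> Mon l ?e - mons_below l p s ?e" "y = a + b"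
        by (auto simp: mon_span_def)
      define N where "N = {m :: nat monomial. keys m \<subseteq> {..<Suc p}}"
      \<comment> \<open>The terms of \<open>b\<close> in variables up to \<open>var p\<close> are
        divisible by \<open>var p ^ s\<close>, and \<open>x\<close> collects the quotients. The
        other terms contain a later variable and lie in \<open>K\<close>.\<close>
      define x where "x = (\<Sum>m\<in>keys b \<inter> N. single (m - single p s) (lookup b m))"
      have ms: "single p s + (m - single p s) = m" "m - single p s \<in> Mon l d" if m: "m \<in> keys b \<inter> N" for m
      proof -
        have le: "s \<le> lookup m p" "m \<in> Mon l ?e" using m ab(2) by (auto simp: mons_below_def N_def)
        then show eq: "single p s + (m - single p s) = m"
          by (intro poly_mapping_eqI) (auto simp: lookup_add lookup_minus lookup_single when_def)
        have "mdeg (single p s + (m - single p s)) = d + s" unfolding eq using le(2) by (simp add: Mon_def)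
        then have "mdeg (m - single p s) = d" by simp
        moreover have "keys (m - single p s) \<subseteq> {..<l}"
          using le(2) by (auto simp: Mon_def in_keys_iff lookup_minus subset_iff)
        ultimately show "m - single p s \<in> Mon l d" by (simp add: Mon_def)
      qed
      have "?f ^ s * x = (\<Sum>m\<in>keys b \<inter> N. single m (lookup b m))"
        unfolding x_def var_power sum_distrib_left mult_single
        by (rule sum.cong[OF refl]) (simp add: ms(1))
      then have fx: "?f ^ s * x = restr N b" by (simp add: restr_def)
      have xd: "x \<in> S_deg l d"
        unfolding x_def by (rule S_deg_sum) (use ms(2) in \<open>auto simp: S_deg_iff_keys\<close>)
      have "restr (- N) b \<in> mon_span (Mon l ?e - mons_below l (Suc p) 1 ?e)"
        unfolding mons_below_1 using ab(2) by (auto simp: mon_span_def N_def)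
      then have "a + restr (- N) b \<in> K \<inter> S_deg l ?e" unfolding Ke using ab(1) by blast
      moreover have "y = ?f ^ s * x + (a + restr (- N) b)"
        using restr_plus_restr_compl[of N b] by (simp add: fx ab(3) add.left_commute)
      ultimately show "y \<in> W" unfolding W_def using xd by blast
    qed
  qed
  have cW: "card (Mon l ?e - LMs W) = std_count l L p s ?e"
    unfolding std_count_def LMs_plus_mon_span[OF V W] LI ..
  note FR = full_rank_mod_iff_card[OF idK S_deg_var[OF p], of s d, folded W_def] card_cokernel_ge[OF idK S_deg_var[OF p], of d s, folded W_def]
  show ?A using FR(1) by (simp add: cW cK)
  show ?B using FR(2) by (simp add: cW cK)
qed

text \<open>Entry \<open>i\<close> is \<open>var p\<close> with \<open>p = l - Suc i\<close>, and
  its predecessors are the variables from \<open>Suc p = l - i\<close> on; hence the two indices in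
  the counts.\<close>

lemma Lefschetz_mod_vars_iff:
  fixes I :: "(nat, 'a::field) mpoly set"
  assumes I: "graded_ideal l I" and k: "k \<le> l"
  shows "Lefschetz_mod l A I (map var (rev [l - k..<l])) \<longleftrightarrow>
    (\<forall>i<k. \<forall>s\<in>A. \<forall>d. std_count l (LMs I) (l - Suc i) s (d + s) =
       std_count l (LMs I) (l - i) 1 (d + s) - std_count l (LMs I) (l - i) 1 d)"
proof -
  let ?vs = "map var (rev [l - k..<l]) :: (nat, 'a) mpoly list"
  have nth: "?vs ! i = var (l - Suc i)" if "i < k" for i using that k by (auto simp: rev_nth)
  have tk: "set (take i ?vs) = var ` {l - i..<l}" if "i < k" for i
  proof -
    have "take i (rev [l - k..<l]) = rev [l - i..<l]" using that k by (simp add: take_rev)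
    then show ?thesis by (simp add: take_map)
  qed
  have "full_rank_mod l (Idl\<^bsub>S_ring l\<^esub> (I \<union> set (take i ?vs))) (?vs ! i) s d \<longleftrightarrow>
      std_count l (LMs I) (l - Suc i) s (d + s) =
       std_count l (LMs I) (l - i) 1 (d + s) - std_count l (LMs I) (l - i) 1 d" if "i < k" for i s d
    using full_rank_mod_var_iff[OF I, of "l - Suc i" s d] that k
    unfolding nth[OF that] tk[OF that] by (simp add: Suc_diff_Suc)
  then show ?thesis using k by (simp add: Lefschetz_mod_def)
qed

section \<open>Comparison with the generic initial ideal\<close>

text \<open>The number of leading monomials is the dimension. It does not grow under a linear map,
  and the inverse map gives the other inequality.\<close>

lemma card_LMs_GL_act:
  fixes V :: "(nat, 'a::field) mpoly set"
  assumes V: "mp.subspace V" "V \<subseteq> S_deg l d" and g: "g \<in> GL l"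
  shows "card (LMs (GL_act l g ` V)) = card (LMs V)"
proof -
  have le: "card (LMs (GL_act l g ` V)) \<le> card (LMs V) \<and> mp.subspace (GL_act l g ` V) \<and> GL_act l g ` V \<subseteq> S_deg l d"
    if V: "mp.subspace V" "V \<subseteq> S_deg l d" for g and V :: "(nat, 'a) mpoly set"
  proof -
    interpret lin: Vector_Spaces.linear "\<lambda>c p. const c * p" "\<lambda>c p. const c * p" "GL_act l g"
      by unfold_locales (auto simp: GL_act.hom_add GL_act.hom_mult)
    have s: "mp.subspace (GL_act l g ` V)" by (rule lin.subspace_image[OF V(1)])
    have S: "GL_act l g ` V \<subseteq> S_deg l d" using V(2) GL_act_S_deg by blast
    obtain B where B: "finite B" "V \<subseteq> mp.span B" "card B = card (LMs V)"
      by (rule lead_monomial_basis[OF V]) blast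
    have "GL_act l g ` V \<subseteq> mp.span (GL_act l g ` B)"
      using B(2) by (simp add: lin.span_image image_mono)
    then have "mp.dim (GL_act l g ` V) \<le> card (GL_act l g ` B)"
      using B(1) by (intro mp.dim_le_card) auto
    also have "\<dots> \<le> card (LMs V)" using card_image_le[OF B(1)] B(3) by metis
    finally show ?thesis using s S dim_eq_card_LMs[OF s S] by simp
  qed
  obtain h where h: "h \<in> GL l" "h * g = 1\<^sub>m l" using GL_inverse[OF g] by metis
  have "GL_act l h ` GL_act l g ` V = V"
    using V(2) S_degD by (intro GL_act_image_inverse[OF h(1) g h(2)]) blast
  then show ?thesis using le[OF V, of g] le[of "GL_act l g ` V" h] by auto
qed

text \<open>No variable is cut off here: the count is the Hilbert function of the quotient, which
  changes of coordinates preserve. It starts the induction over the variables.\<close>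

lemma std_count_top:
  fixes I :: "(nat, 'a::field) mpoly set"
  assumes I: "graded_ideal l I" and g: "g \<in> GL l" and h: "h \<in> GL l"
  shows "std_count l (LMs (GL_act l g ` I)) l 1 e = std_count l (LMs (GL_act l h ` I)) l 1 e"
proof -
  let ?V = "I \<inter> S_deg l e"
  have V: "mp.subspace ?V" "?V \<subseteq> S_deg l e"
    by (auto intro: subspace_ideal_S_deg[OF graded_ideal_ideal[OF I]])
  have Mon: "mons_below l l 1 e = Mon l e" unfolding mons_below_1 by (auto simp: Mon_def)
  have "std_count l (LMs (GL_act l g ` I)) l 1 e = card (Mon l e) - card (LMs ?V)" if g: "g \<in> GL l" for g
  proof -
    have "LMs (GL_act l g ` I) \<inter> Mon l e = LMs (GL_act l g ` ?V) \<inter> Mon l e"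
      by (rule LMs_GL_act_Int_upset[OF I g]) (simp add: upset_def)
    also have "\<dots> = LMs (GL_act l g ` ?V)"
      using LMs_subset_Mon[of "GL_act l g ` ?V" l e] GL_act_S_deg by blast
    finally have "Mon l e - LMs (GL_act l g ` I) = Mon l e - LMs (GL_act l g ` ?V)" by blast
    moreover have sub: "LMs (GL_act l g ` ?V) \<subseteq> Mon l e"
      using GL_act_S_deg by (intro LMs_subset_Mon) blast
    ultimately show ?thesis
      unfolding std_count_def Mon using card_LMs_GL_act[OF V g] finite_subset[OF sub finite_Mon]
      by (simp add: card_Diff_subset)
  qed
  then show ?thesis using g h by simp
qed

lemma std_count_mono:
  assumes "card (L' \<inter> mons_below l p s e) \<le> card (L \<inter> mons_below l p s e)"
  shows "std_count l L p s e \<le> std_count l L' p s e"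
proof -
  let ?T = "mons_below l p s e"
  have fin: "finite ?T" by (rule finite_subset[OF _ finite_Mon[of l e]]) (auto simp: mons_below_def)
  have "card (?T - M) = card ?T - card (M \<inter> ?T)" for M
    using fin by (simp add: card_Diff_subset_Int Int_commute)
  then show ?thesis using assms by (simp add: std_count_def)
qed

text \<open>The recursion with exponent 1 reaches degrees of the form \<open>d + 1\<close>; this
  supplies degree 0.\<close>

lemma std_count_deg_0: "std_count l L q 1 0 = std_count l L r 1 0"
proof -
  have "mons_below l q 1 0 = {0}" for q
    unfolding mons_below_1 by (auto simp: Mon_def mdeg_eq_0_iff)
  then show ?thesis by (simp only: std_count_def)
qed

text \<open>A squeeze: if the counts agree at stage \<open>i\<close>, the lower bound
  \<open>ge\<close> for \<open>K\<close> equals the value attained by \<open>I\<close>, and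
  \<open>le\<close> bounds the count for \<open>K\<close> by that value from above. With exponent 1
  this is the agreement at stage \<open>i + 1\<close>, except in degree 0.\<close>

lemma Lefschetz_mod_vars_if_std_count_le:
  fixes I K :: "(nat, 'a::field) mpoly set"
  assumes I: "graded_ideal l I" and K: "graded_ideal l K" and k: "k \<le> l" and A: "1 \<in> A"
    and top: "\<And>e. std_count l (LMs K) l 1 e = std_count l (LMs I) l 1 e"
    and le: "\<And>p s e. std_count l (LMs K) p s e \<le> std_count l (LMs I) p s e"
    and LP: "Lefschetz_mod l A I (map var (rev [l - k..<l]))"
  shows "Lefschetz_mod l A K (map var (rev [l - k..<l]))"
proof -
  let ?c = "std_count l (LMs I)" and ?c' = "std_count l (LMs K)"
  have c: "?c (l - Suc i) s (d + s) = ?c (l - i) 1 (d + s) - ?c (l - i) 1 d" if "i < k" "s \<in> A" for i s d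
    using LP that unfolding Lefschetz_mod_vars_iff[OF I k] by blast
  have ge: "?c' (l - i) 1 (d + s) - ?c' (l - i) 1 d \<le> ?c' (l - Suc i) s (d + s)" if "i < k" for i s d
    using std_count_ge[OF K, of "l - Suc i" d s] that k by (simp add: Suc_diff_Suc)
  have step: "?c' (l - Suc i) s (d + s) = ?c (l - Suc i) s (d + s)"
    if "i < k" "s \<in> A" "\<And>e. ?c' (l - i) 1 e = ?c (l - i) 1 e" for i s d
    using c[OF that(1,2), of d] ge[OF that(1), of d s] le[of "l - Suc i" s "d + s"] that(3) by simp
  have eq: "?c' (l - i) 1 e = ?c (l - i) 1 e" if "i < k" for i e
    using that
  proof (induction i arbitrary: e)
    case 0
    then show ?case using top by simp
  next
    case (Suc i)
    show ?case
    proof (cases e)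
      case 0
      have "?c' (l - Suc i) 1 0 = ?c' (l - i) 1 0" "?c (l - Suc i) 1 0 = ?c (l - i) 1 0"
        by (rule std_count_deg_0)+
      then show ?thesis using Suc 0 by simp
    next
      case (Suc d)
      then show ?thesis using step[of i 1 d] Suc.IH Suc.prems A by simp
    qed
  qed
  show ?thesis
    unfolding Lefschetz_mod_vars_iff[OF K k]
  proof (intro allI impI ballI)
    fix i s d assume i: "i < k" and s: "s \<in> A"
    show "?c' (l - Suc i) s (d + s) = ?c' (l - i) 1 (d + s) - ?c' (l - i) 1 d"
      using step[OF i s eq[OF i], of d] c[OF i s, of d] eq[OF i] by simp
  qed
qed

theorem Lefschetz_mod_iff_rgin:
  fixes I :: "(nat, 'a::field_char_0) mpoly set"
  assumes I: "graded_ideal l I" and k: "k \<le> l" and A: "1 \<in> A"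
  shows "graded_ideal l (rgin l I)"
    and "(\<exists>fs. length fs = k \<and> set fs \<subseteq> S_deg l 1 \<and> Lefschetz_mod l A I fs) \<longleftrightarrow>
      Lefschetz_mod l A (rgin l I) (map var (rev [l - k..<l]))"
proof -
  let ?vs = "map var (rev [l - k..<l]) :: (nat, 'a) mpoly list"
  obtain L where L: "L \<subseteq> mons l" "\<And>m n. m \<in> L \<Longrightarrow> n \<in> mons l \<Longrightarrow> n + m \<in> L"
    and gen: "generic l (\<lambda>g. LMs (GL_act l g ` I) = L)"
    and max: "\<And>g d T. g \<in> GL l \<Longrightarrow> upset l d T \<Longrightarrow> card (LMs (GL_act l g ` I) \<inter> T) \<le> card (L \<inter> T)"
    using galligo[OF I] by metis
  have rgin: "rgin l I = mon_span L" by (rule rgin_eq_mon_span[OF I gen])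
  have LM: "LMs (rgin l I) = L" unfolding rgin by (rule LMs_mon_span)
  show J: "graded_ideal l (rgin l I)" unfolding rgin by (rule graded_ideal_mon_span[OF L])
  obtain g0 where g0: "g0 \<in> GL l" "LMs (GL_act l g0 ` I) = L" using generic_ex[OF gen] by blast
  note idI = graded_ideal_ideal[OF I]
  have vs: "set ?vs \<subseteq> S_deg l 1" "length ?vs = k" using k by (auto intro: S_deg_var[unfolded One_nat_def])
  show "(\<exists>fs. length fs = k \<and> set fs \<subseteq> S_deg l 1 \<and> Lefschetz_mod l A I fs) \<longleftrightarrow> Lefschetz_mod l A (rgin l I) ?vs"
  proof
    assume "\<exists>fs. length fs = k \<and> set fs \<subseteq> S_deg l 1 \<and> Lefschetz_mod l A I fs"
    then obtain fs where fs: "length fs = k" "set fs \<subseteq> S_deg l 1" "Lefschetz_mod l A I fs" by blast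
    then obtain g where g: "g \<in> GL l" "Lefschetz_mod l A (GL_act l g ` I) ?vs"
      using Lefschetz_mod_vars[OF idI _ fs(2,3) A] k by auto
    show "Lefschetz_mod l A (rgin l I) ?vs"
    proof (rule Lefschetz_mod_vars_if_std_count_le[OF graded_ideal_GL_act[OF I g(1)] J k A _ _ g(2)])
      show "std_count l (LMs (rgin l I)) l 1 e = std_count l (LMs (GL_act l g ` I)) l 1 e" for e
        using std_count_top[OF I g0(1) g(1)] by (simp add: LM g0(2))
      show "std_count l (LMs (rgin l I)) p s e \<le> std_count l (LMs (GL_act l g ` I)) p s e" for p s e
        unfolding LM by (rule std_count_mono[OF max[OF g(1) upset_mons_below]])
    qed
  next
    assume "Lefschetz_mod l A (rgin l I) ?vs"
    \<comment> \<open>Both conditions are the same equations between counts, because the two ideals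
      have the same leading monomials \<open>L\<close>. The inverse of \<open>g0\<close> then
      carries the last variables to Lefschetz elements for \<open>I\<close>.\<close>
    then have "Lefschetz_mod l A (GL_act l g0 ` I) ?vs"
      unfolding Lefschetz_mod_vars_iff[OF J k] Lefschetz_mod_vars_iff[OF graded_ideal_GL_act[OF I g0(1)] k] LM g0(2) .
    moreover obtain h where h: "h \<in> GL l" "h * g0 = 1\<^sub>m l" using GL_inverse[OF g0(1)] by metis
    ultimately have "Lefschetz_mod l A (GL_act l h ` GL_act l g0 ` I) (map (GL_act l h) ?vs)"
      by (intro Lefschetz_mod_GL_act[OF h(1) ideal_GL_act[OF idI g0(1)] vs(1)])
    moreover have "GL_act l h ` GL_act l g0 ` I = I"
      using ideal_polys_in[OF idI] by (intro GL_act_image_inverse[OF h(1) g0(1) h(2)]) blast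
    moreover have "set (map (GL_act l h) ?vs) \<subseteq> S_deg l 1"
      unfolding set_map[of "GL_act l h"] using vs(1) GL_act_S_deg by blast
    ultimately show "\<exists>fs. length fs = k \<and> set fs \<subseteq> S_deg l 1 \<and> Lefschetz_mod l A I fs"
      using vs(2) by (intro exI[of _ "map (GL_act l h) ?vs"]) simp
  qed
qed

theorem theorem3p6:
  fixes I :: "(nat, 'a::field_char_0) mpoly set" and k l :: nat
  assumes "homogeneous_ideal l I" and "1 \<le> k" and "k \<le> l"
  defines "S \<equiv> S_ring l :: (nat, 'a) mpoly ring"
    and "J \<equiv> rgin l I"
  shows "(has_kSLP k (S Quot I) (quot_grading S I (S_deg l)) \<longleftrightarrow>
          has_kSLP_with k (S Quot J) (quot_grading S J (S_deg l))
            (map (\<lambda>i. J +>\<^bsub>S\<^esub> var i) (rev [l - k..<l])))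
       \<and> (has_kWLP k (S Quot I) (quot_grading S I (S_deg l)) \<longleftrightarrow>
          has_kWLP_with k (S Quot J) (quot_grading S J (S_deg l))
            (map (\<lambda>i. J +>\<^bsub>S\<^esub> var i) (rev [l - k..<l])))"
  proof -
  note hI = graded_ideal_if_homogeneous_ideal[OF assms(1)]
  note ids = graded_ideal_ideal[OF hI] graded_ideal_ideal[OF Lefschetz_mod_iff_rgin(1)[OF hI assms(3) UNIV_I], folded J_def]
  define vs where "vs = (map var (rev [l - k..<l]) :: (nat, 'a) mpoly list)"
  have vs: "length vs = k" "set vs \<subseteq> S_deg l 1"
    using assms(3) S_deg_var[of _ l] by (auto simp: vs_def)
  have cosets: "map (\<lambda>i. J +>\<^bsub>S\<^esub> var i) (rev [l - k..<l]) = map (\<lambda>f. J +>\<^bsub>S\<^esub> f) vs"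
    by (simp add: vs_def)
  have main: "(\<exists>fs. length fs = k \<and> set fs \<subseteq> S_deg l 1 \<and> Lefschetz_mod l A I fs) \<longleftrightarrow> Lefschetz_mod l A J vs"
    if "1 \<in> A" for A
    using Lefschetz_mod_iff_rgin(2)[OF hI assms(3) that] by (simp only: J_def vs_def)
  show ?thesis
    unfolding S_def cosets[unfolded S_def] has_kSLP_quot_iff[OF ids(1) assms(2)]
      has_kWLP_quot_iff[OF ids(1) assms(2)] has_kSLP_with_quot_iff[OF ids(2) assms(2) vs]
      has_kWLP_with_quot_iff[OF ids(2) assms(2) vs]
    using main[of "{1..}"] main[of "{1}"] by simp
qed

end
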